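(* Let $S=\mathbb C[x,y,z]$, let $F\in S$ be the projected hypersurface polynomial of a dihedral quotient singularity $\mathbb D_{n,q}$ (see context), $A=S/(F)$, let $A\hookrightarrow B$ be the normalization of $A$, and $K=\operatorname{Frac}(B)$. Let $U$ be an indecomposable rank-two special Cohen-Macaulay $B$-module. Assume that, after a change of basis in $K^2$ and multiplication by an element of $K^\times$, $U$ admits a four-generator fractional lattice presentation $$U\cong\operatorname{im}\begin{pmatrix}Q_1&Q_2&Q_3&0\\-P_2&P_1&0&Q_3\end{pmatrix}\subseteq K^2,$$ where the $P_i,Q_i$ are monomials satisfying $P_1Q_1+P_2Q_2+P_3Q_3=mF$ for some monomial $m$. Let $(\widetilde\Phi,\widetilde\Psi)$ be the corresponding three-term Koszul matrix factorization of $mF$. Suppose that there exists a diagonal monomial matrix $D$ such that $\Phi=\widetilde\Phi D^{-1}$ and $\Psi=D\,\frac{\widetilde\Psi}{m}$ have entries in $S$, and assume that $E:=\operatorname{coker}(\Phi)$ has rank two. Assume moreover that a $2\times4$ submatrix $T$ (two rows) of $\Psi_B$ has generic rank two and satisfies $C\,\operatorname{im}(T)\cong U$ for some $C\in\operatorname{GL}_2(K)$. Then $$(E\otimes_AB)^{\vee\vee}\cong U.$$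
   Context: For a $B$-module $M$, $M^\vee=\operatorname{Hom}_B(M,B)$. $\Psi_B$ is $\Psi$ with entries mapped to $B$. Monomials are monomials in $x,y,z$ with coefficient in $\mathbb C^\times$ (signs allowed); the $P_i,Q_i$ are elements of $S$, and in the displayed matrix they denote their images in $K$. "Image" of the $2\times 4$ matrix means the $B$-submodule of $K^2$ generated by its columns. The Koszul matrix factorization attached to $P_1Q_1+P_2Q_2+P_3Q_3=mF$ is $$\widetilde\Phi=\begin{pmatrix}P_1&-Q_2&-Q_3&0\\P_2&Q_1&0&-Q_3\\P_3&0&Q_1&Q_2\\0&P_3&-P_2&P_1\end{pmatrix},\qquad\widetilde\Psi=\begin{pmatrix}Q_1&Q_2&Q_3&0\\-P_2&P_1&0&Q_3\\-P_3&0&P_1&-Q_2\\0&-P_3&P_2&Q_1\end{pmatrix},$$ with $\widetilde\Phi\widetilde\Psi=\widetilde\Psi\widetilde\Phi=mF\,\mathrm{Id}_4$. For coprime $1<q<n$ with Hirzebruch-Jung expansion $\frac n{n-q}=[a_2,\dots,a_{e-1}]=a_2-\cfrac{1}{a_3-\cfrac{1}{\ddots-\cfrac1{a_{e-1}}}}$, $a_i\ge2$, $e\ge4$, one has $F=y^{2\alpha+2s_3}+x^{a_2-1}y^{2\alpha}z^{2\widehat s_3}-xz^{2\beta+2\widehat s_3}$, which is irreducible. Exponents for $e\ge5$: $s_e=0$, $s_{e-1}=1$, $s_{e-2}=a_{e-1}$, $s_j=(a_{j+1}-1)s_{j+1}+(a_{j+2}-1)s_{j+2}-s_{j+3}$ ($3\le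 j\le e-3$); $\widehat s_{e-1}=0$, $\widehat s_{e-2}=1$, $\widehat s_{e-3}=a_{e-2}$, $\widehat s_j=(a_{j+1}-1)\widehat s_{j+1}+(a_{j+2}-1)\widehat s_{j+2}-\widehat s_{j+3}$ ($3\le j\le e-4$); $\alpha=1+\sum_{j=3}^{e-1}(a_j-2)s_j$, $\beta=1+\sum_{j=3}^{e-2}(a_j-2)\widehat s_j$. For $e=4$: $s_3=1$, $\widehat s_3=0$, $\alpha=a_3-1$, $\beta=1$. The normalization $B$ is the coordinate ring of the dihedral quotient singularity $\mathbb D_{n,q}$, a two-dimensional normal domain with a rational singularity. A maximal Cohen-Macaulay $B$-module $M$ (necessarily reflexive) is special if $H^1(\widetilde X,\widetilde M^\vee)=0$, where $\pi\colon\widetilde X\to\operatorname{Spec}B$ is the minimal resolution and $\widetilde M=\pi^*M/\mathrm{torsion}$; equivalently (Iyama-Wemyss), $\operatorname{Ext}^1_B(M,B)=0$. *)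

theory Defs
  imports
    "HOL-Analysis.Cartesian_Space"
    "HOL-Computational_Algebra.Polynomial_Factorial"
    "HOL-Library.Extended_Nat"
    "HOL-Algebra.QuotRing"
    "HOL-Algebra.Module"
    "HOL-Algebra.Free_Abelian_Groups"
    "HOL-Algebra.Algebraic_Closure_Type"
begin

section \<open>Modules over a commutative ring\<close>

text \<open>
  Modules are the records of \<^theory>\<open>HOL-Algebra.Module\<close>. That record extends the ring record; its
  multiplicative fields play no role for modules and are left undefined below.
\<close>

definition self_module :: "'r ring \<Rightarrow> ('r, 'r) module" where
  "self_module R = \<lparr>carrier = carrier R, monoid.mult = monoid.mult R, one = one R, zero = ring.zero R, add = ring.add R,
     module.smult = monoid.mult R\<rparr>"

definition linear_maps ::
    "'r ring \<Rightarrow> ('r, 'm) module \<Rightarrow> ('r, 'n) module \<Rightarrow> ('m \<Rightarrow> 'n) set" where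
  "linear_maps R M N = {f \<in> carrier M \<rightarrow>\<^sub>E carrier N.
     (\<forall>x\<in>carrier M. \<forall>y\<in>carrier M. f (x \<oplus>\<^bsub>M\<^esub> y) = f x \<oplus>\<^bsub>N\<^esub> f y) \<and>
     (\<forall>c\<in>carrier R. \<forall>x\<in>carrier M. f (c \<odot>\<^bsub>M\<^esub> x) = c \<odot>\<^bsub>N\<^esub> f x)}"

definition hom_module ::
    "'r ring \<Rightarrow> ('r, 'm) module \<Rightarrow> ('r, 'n) module \<Rightarrow> ('r, 'm \<Rightarrow> 'n) module" where
  "hom_module R M N = \<lparr>carrier = linear_maps R M N, monoid.mult = undefined, one = undefined,
     zero = (\<lambda>x\<in>carrier M. \<zero>\<^bsub>N\<^esub>),
     add = (\<lambda>f g. \<lambda>x\<in>carrier M. f x \<oplus>\<^bsub>N\<^esub> g x),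
     module.smult = (\<lambda>c f. \<lambda>x\<in>carrier M. c \<odot>\<^bsub>N\<^esub> f x)\<rparr>"

definition dual :: "'r ring \<Rightarrow> ('r, 'm) module \<Rightarrow> ('r, 'm \<Rightarrow> 'r) module" where
  "dual R M = hom_module R M (self_module R)"

definition module_iso :: "'r ring \<Rightarrow> ('r, 'm) module \<Rightarrow> ('r, 'n) module \<Rightarrow> bool" where
  "module_iso R M N \<longleftrightarrow> (\<exists>f\<in>linear_maps R M N. bij_betw f (carrier M) (carrier N))"

definition finitely_generated :: "'r ring \<Rightarrow> ('r, 'm) module \<Rightarrow> bool" where
  "finitely_generated R M \<longleftrightarrow> (\<exists>V. finite V \<and> V \<subseteq> carrier M \<and>
     carrier M = {finsum M (\<lambda>x. c x \<odot>\<^bsub>M\<^esub> x) V | c. c \<in> V \<rightarrow> carrier R})"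

definition linearly_independent :: "'r ring \<Rightarrow> ('r, 'm) module \<Rightarrow> 'm set \<Rightarrow> bool" where
  "linearly_independent R M V \<longleftrightarrow> finite V \<and> V \<subseteq> carrier M \<and>
     (\<forall>c\<in>V \<rightarrow> carrier R. finsum M (\<lambda>x. c x \<odot>\<^bsub>M\<^esub> x) V = \<zero>\<^bsub>M\<^esub> \<longrightarrow> (\<forall>x\<in>V. c x = \<zero>\<^bsub>R\<^esub>))"

text \<open>The rank of a module over a domain: the maximal number of linearly independent elements.\<close>

definition has_rank :: "'r ring \<Rightarrow> ('r, 'm) module \<Rightarrow> nat \<Rightarrow> bool" where
  "has_rank R M r \<longleftrightarrow> (\<exists>V. linearly_independent R M V \<and> card V = r) \<and>
     (\<forall>V. linearly_independent R M V \<longrightarrow> card V \<le> r)"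

definition indecomposable :: "'r ring \<Rightarrow> ('r, 'm) module \<Rightarrow> bool" where
  "indecomposable R M \<longleftrightarrow> carrier M \<noteq> {\<zero>\<^bsub>M\<^esub>} \<and>
     (\<forall>V Y. submodule V R M \<and> submodule Y R M \<and> V \<inter> Y = {\<zero>\<^bsub>M\<^esub>} \<and>
        carrier M = {x \<oplus>\<^bsub>M\<^esub> y | x y. x \<in> V \<and> y \<in> Y} \<longrightarrow> V = {\<zero>\<^bsub>M\<^esub>} \<or> Y = {\<zero>\<^bsub>M\<^esub>})"

definition quotient_module :: "('r, 'm) module \<Rightarrow> 'm set \<Rightarrow> ('r, 'm set) module" where
  "quotient_module M N = \<lparr>carrier = a_rcosets\<^bsub>M\<^esub> N, monoid.mult = undefined, one = undefined,
     zero = N, add = set_add M,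
     module.smult = (\<lambda>c V. \<Union>x\<in>V. N +>\<^bsub>M\<^esub> (c \<odot>\<^bsub>M\<^esub> x))\<rparr>"

text \<open>
  An \<open>R\<close>-module annihilated by the ideal \<open>I\<close>, with elements being cosets, as a module over \<open>R Quot I\<close>:
  a scalar is a coset \<open>c\<close> of \<open>I\<close>, all of whose members \<open>s\<close> yield the same coset \<open>s V\<close>.
\<close>

definition factor_scalars :: "('r, 'm set) module \<Rightarrow> ('r set, 'm set) module" where
  "factor_scalars M = \<lparr>carrier = carrier M, monoid.mult = undefined, one = undefined,
     zero = ring.zero M, add = ring.add M, module.smult = (\<lambda>c V. \<Union>s\<in>c. s \<odot>\<^bsub>M\<^esub> V)\<rparr>"


subsection \<open>Tensor product with an algebra\<close>

text \<open>
  For an \<open>A\<close>-module \<open>M\<close> and a ring homomorphism \<open>\<iota>\<close> from \<open>A\<close> to \<open>R\<close>, the tensor product of \<open>M\<close> and \<open>R\<close>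
  over \<open>A\<close> is the free abelian group on pairs modulo the bilinear relations, with \<open>R\<close> acting on
  the second factor.
\<close>

definition tensor_relations ::
    "'a ring \<Rightarrow> ('a, 'm) module \<Rightarrow> 'r ring \<Rightarrow> ('a \<Rightarrow> 'r) \<Rightarrow> ('m \<times> 'r \<Rightarrow>\<^sub>0 int) set" where
  "tensor_relations A M R \<iota> = generate (free_Abelian_group (carrier M \<times> carrier R))
     ({frag_of (x \<oplus>\<^bsub>M\<^esub> y, b) - frag_of (x, b) - frag_of (y, b) | x y b.
         x \<in> carrier M \<and> y \<in> carrier M \<and> b \<in> carrier R} \<union>
      {frag_of (x, b \<oplus>\<^bsub>R\<^esub> b') - frag_of (x, b) - frag_of (x, b') | x b b'.
         x \<in> carrier M \<and> b \<in> carrier R \<and> b' \<in> carrier R} \<union>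
      {frag_of (a \<odot>\<^bsub>M\<^esub> x, b) - frag_of (x, \<iota> a \<otimes>\<^bsub>R\<^esub> b) | a x b.
         a \<in> carrier A \<and> x \<in> carrier M \<and> b \<in> carrier R})"

definition tensor_algebra ::
    "'a ring \<Rightarrow> ('a, 'm) module \<Rightarrow> 'r ring \<Rightarrow> ('a \<Rightarrow> 'r) \<Rightarrow> ('r, ('m \<times> 'r \<Rightarrow>\<^sub>0 int) set) module" where
  "tensor_algebra A M R \<iota> =
     (let G = free_Abelian_group (carrier M \<times> carrier R); N = tensor_relations A M R \<iota> in
       \<lparr>carrier = carrier (G Mod N), monoid.mult = undefined, one = undefined,
        zero = one (G Mod N), add = monoid.mult (G Mod N),
        module.smult = (\<lambda>c V. \<Union>f\<in>V. N #>\<^bsub>G\<^esub> frag_extend (\<lambda>(x, b). frag_of (x, c \<otimes>\<^bsub>R\<^esub> b)) f)\<rparr>)"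


subsection \<open>Vanishing of the first Ext group\<close>

definition free_module :: "'r ring \<Rightarrow> 'x set \<Rightarrow> ('r, 'x \<Rightarrow> 'r) module" where
  "free_module R V = \<lparr>carrier = {f. (\<forall>x\<in>V. f x \<in> carrier R) \<and> (\<forall>x. x \<notin> V \<longrightarrow> f x = \<zero>\<^bsub>R\<^esub>) \<and>
        finite {x. f x \<noteq> \<zero>\<^bsub>R\<^esub>}},
     monoid.mult = undefined, one = undefined,
     zero = (\<lambda>x. \<zero>\<^bsub>R\<^esub>), add = (\<lambda>f g x. f x \<oplus>\<^bsub>R\<^esub> g x), module.smult = (\<lambda>c f x. c \<otimes>\<^bsub>R\<^esub> f x)\<rparr>"

text \<open>The kernel of the canonical surjection onto \<open>M\<close> from the free module on the elements of \<open>M\<close>.\<close>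

definition first_syzygy :: "'r ring \<Rightarrow> ('r, 'm) module \<Rightarrow> ('r, 'm \<Rightarrow> 'r) module" where
  "first_syzygy R M = (free_module R (carrier M))
     \<lparr>carrier := {f \<in> carrier (free_module R (carrier M)).
        finsum M (\<lambda>x. f x \<odot>\<^bsub>M\<^esub> x) {x. f x \<noteq> \<zero>\<^bsub>R\<^esub>} = \<zero>\<^bsub>M\<^esub>}\<rparr>"

text \<open>
  From the free presentation with kernel \<open>\<Omega>\<close> = \<^const>\<open>first_syzygy\<close> and middle term \<open>L\<close>,
  the group \<open>Ext\<^sup>1(M, N)\<close> is the cokernel of the restriction map from \<open>Hom(L, N)\<close> to \<open>Hom(\<Omega>, N)\<close>.
\<close>

definition Ext1_vanishes :: "'r ring \<Rightarrow> ('r, 'm) module \<Rightarrow> ('r, 'n) module \<Rightarrow> bool" where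
  "Ext1_vanishes R M N \<longleftrightarrow>
     (\<forall>h\<in>linear_maps R (first_syzygy R M) N. \<exists>g\<in>linear_maps R (free_module R (carrier M)) N.
        \<forall>f\<in>carrier (first_syzygy R M). g f = h f)"


subsection \<open>Maximal Cohen-Macaulay and special modules\<close>

definition height :: "'r ring \<Rightarrow> 'r set \<Rightarrow> enat" where
  "height R p = Sup {enat n | n. \<exists>c :: nat \<Rightarrow> 'r set.
     (\<forall>i\<le>n. primeideal (c i) R) \<and> (\<forall>i<n. c i \<subset> c (Suc i)) \<and> c n = p}"

text \<open>The submodule \<open>(r\<^sub>1, \<dots>, r\<^sub>k) M\<close>.\<close>

primrec multiples :: "('r, 'm) module \<Rightarrow> 'r list \<Rightarrow> 'm set" where
  "multiples M [] = {\<zero>\<^bsub>M\<^esub>}"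
| "multiples M (r # rs) = {(r \<odot>\<^bsub>M\<^esub> x) \<oplus>\<^bsub>M\<^esub> y | x y. x \<in> carrier M \<and> y \<in> multiples M rs}"

text \<open>The elements of \<open>M\<close> whose image in the localization of \<open>M / N\<close> at \<open>p\<close> is zero.\<close>

definition locally_in :: "'r ring \<Rightarrow> ('r, 'm) module \<Rightarrow> 'r set \<Rightarrow> 'm set \<Rightarrow> 'm set" where
  "locally_in R M p N = {x \<in> carrier M. \<exists>s\<in>carrier R - p. s \<odot>\<^bsub>M\<^esub> x \<in> N}"

text \<open>
  Regularity of a sequence of elements of \<open>p\<close> on the localization of \<open>M\<close> at \<open>p\<close>, with
  denominators cleared: each entry is a nonzerodivisor on the localized quotient by the previous
  ones, and the quotient by all of them is nonzero.
\<close>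

definition local_regular_sequence ::
    "'r ring \<Rightarrow> ('r, 'm) module \<Rightarrow> 'r set \<Rightarrow> 'r list \<Rightarrow> bool" where
  "local_regular_sequence R M p rs \<longleftrightarrow> set rs \<subseteq> p \<and>
     (\<forall>i<length rs. \<forall>x\<in>carrier M.
        rs ! i \<odot>\<^bsub>M\<^esub> x \<in> locally_in R M p (multiples M (take i rs)) \<longrightarrow>
        x \<in> locally_in R M p (multiples M (take i rs))) \<and>
     locally_in R M p (multiples M rs) \<noteq> carrier M"

text \<open>
  The depth of the localization \<open>M\<^sub>p\<close> over the local ring \<open>R\<^sub>p\<close>. Every element of the maximal ideal
  is a unit multiple of an element of \<open>p\<close>, so sequences in \<open>p\<close> suffice.
\<close>

definition local_depth :: "'r ring \<Rightarrow> ('r, 'm) module \<Rightarrow> 'r set \<Rightarrow> enat" where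
  "local_depth R M p = Sup {enat (length rs) | rs. local_regular_sequence R M p rs}"

text \<open>
  Over a ring that need not be local, \<open>M\<close> is maximal Cohen-Macaulay if \<open>depth M\<^sub>p = dim R\<^sub>p\<close>
  for all primes \<open>p\<close> (the convention of Iyama and Wemyss).
\<close>

definition maximal_CM :: "'r ring \<Rightarrow> ('r, 'm) module \<Rightarrow> bool" where
  "maximal_CM R M \<longleftrightarrow> Module.module R M \<and> finitely_generated R M \<and>
     (\<forall>p. primeideal p R \<longrightarrow> local_depth R M p = height R p)"

text \<open>
  For a rational surface singularity the vanishing of \<open>Ext\<^sup>1(M, R)\<close> is equivalent, by a theorem of
  Iyama and Wemyss, to Wunram's condition \<open>H\<^sup>1 = 0\<close> for the dual of the full sheaf of \<open>M\<close> on the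
  minimal resolution.
\<close>

definition special_CM :: "'r ring \<Rightarrow> ('r, 'm) module \<Rightarrow> bool" where
  "special_CM R M \<longleftrightarrow> maximal_CM R M \<and> Ext1_vanishes R M (self_module R)"


section \<open>Fraction field and normalization\<close>

text \<open>A model of the fraction field is any field with an embedding of \<open>A\<close> of which it is the field of quotients.\<close>

definition is_fraction_field :: "'a ring \<Rightarrow> ('a \<Rightarrow> 'k::field) \<Rightarrow> bool" where
  "is_fraction_field A \<iota> \<longleftrightarrow> \<iota> \<in> ring_hom A ring_of_type_algebra \<and> inj_on \<iota> (carrier A) \<and>
     (\<forall>x. \<exists>a\<in>carrier A. \<exists>b\<in>carrier A. \<iota> b \<noteq> 0 \<and> x = \<iota> a / \<iota> b)"

text \<open>The integral closure of \<open>A\<close> in the field into which \<open>\<iota>\<close> embeds it.\<close>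

definition normalization :: "'a ring \<Rightarrow> ('a \<Rightarrow> 'k::field) \<Rightarrow> 'k ring" where
  "normalization A \<iota> = ring_of_type_algebra
     \<lparr>carrier := {x. \<exists>f :: 'k poly. lead_coeff f = 1 \<and> (\<forall>i. coeff f i \<in> \<iota> ` carrier A) \<and> poly f x = 0}\<rparr>"


section \<open>The polynomial ring in three variables\<close>

text \<open>Three-variable polynomials are iterated univariate ones, nested in the order \<open>x\<close>, \<open>z\<close>, \<open>y\<close>.\<close>

type_synonym poly3 = "complex poly poly poly"

definition const3 :: "complex \<Rightarrow> poly3" where "const3 c = [:[:[:c:]:]:]"
definition X3 :: poly3 where "X3 = [:[:[:0, 1:]:]:]"
definition Z3 :: poly3 where "Z3 = [:[:0, 1:]:]"
definition Y3 :: poly3 where "Y3 = [:0, 1:]"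

abbreviation S3 :: "poly3 ring" where "S3 \<equiv> ring_of_type_algebra"

definition is_monomial :: "poly3 \<Rightarrow> bool" where
  "is_monomial p \<longleftrightarrow> (\<exists>c i j k. c \<noteq> 0 \<and> p = const3 c * X3 ^ i * Y3 ^ j * Z3 ^ k)"

definition hypersurface_ring :: "poly3 \<Rightarrow> poly3 set ring" where
  "hypersurface_ring F = S3 Quot (PIdl\<^bsub>S3\<^esub> F)"

text \<open>The image of a polynomial in the fraction field of the hypersurface ring.\<close>

definition eval_K :: "poly3 \<Rightarrow> (poly3 set \<Rightarrow> 'k::field) \<Rightarrow> poly3 \<Rightarrow> 'k" where
  "eval_K F \<iota> s = \<iota> ((PIdl\<^bsub>S3\<^esub> F) +>\<^bsub>S3\<^esub> s)"


section \<open>The projected hypersurface of a dihedral singularity\<close>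

fun hirzebruch_jung :: "nat list \<Rightarrow> rat" where
  "hirzebruch_jung [] = 0"
| "hirzebruch_jung [a] = of_nat a"
| "hirzebruch_jung (a # b # bs) = of_nat a - 1 / hirzebruch_jung (b # bs)"

text \<open>The parameters are \<open>n\<close>, \<open>q\<close> and the coefficients \<open>a\<^sub>2, \<dots>, a\<^sub>e\<^sub>-\<^sub>1\<close> of the expansion.\<close>

definition dihedral_data :: "nat \<Rightarrow> nat \<Rightarrow> nat \<Rightarrow> (nat \<Rightarrow> nat) \<Rightarrow> bool" where
  "dihedral_data n q e a \<longleftrightarrow> 1 < q \<and> q < n \<and> coprime n q \<and> e \<ge> 4 \<and> (\<forall>i\<in>{2..e-1}. a i \<ge> 2) \<and>
     of_nat n / of_nat (n - q) = hirzebruch_jung (map a [2..<e])"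

text \<open>
  The descending recursion, indexed by the distance \<open>k\<close> from the top index \<open>e\<close>. The second sequence
  satisfies the same recursion and initial values with \<open>e - 1\<close> in place of \<open>e\<close>, and for \<open>e = 4\<close> the
  general formulas specialise to the values prescribed there (see the lemmas below).
\<close>

fun s_aux :: "nat \<Rightarrow> (nat \<Rightarrow> nat) \<Rightarrow> nat \<Rightarrow> int" where
  "s_aux e a 0 = 0"
| "s_aux e a (Suc 0) = 1"
| "s_aux e a (Suc (Suc 0)) = int (a (e - 1))"
| "s_aux e a (Suc (Suc (Suc k))) =
     (int (a (e - (k + 2))) - 1) * s_aux e a (k + 2) + (int (a (e - (k + 1))) - 1) * s_aux e a (k + 1)
       - s_aux e a k"

definition s_exp :: "nat \<Rightarrow> (nat \<Rightarrow> nat) \<Rightarrow> nat \<Rightarrow> int" where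
  "s_exp e a j = s_aux e a (e - j)"

definition s_hat :: "nat \<Rightarrow> (nat \<Rightarrow> nat) \<Rightarrow> nat \<Rightarrow> int" where
  "s_hat e a j = s_aux (e - 1) a (e - 1 - j)"

definition alpha_exp :: "nat \<Rightarrow> (nat \<Rightarrow> nat) \<Rightarrow> int" where
  "alpha_exp e a = 1 + (\<Sum>j = 3..e - 1. (int (a j) - 2) * s_exp e a j)"

definition beta_exp :: "nat \<Rightarrow> (nat \<Rightarrow> nat) \<Rightarrow> int" where
  "beta_exp e a = 1 + (\<Sum>j = 3..e - 2. (int (a j) - 2) * s_hat e a j)"

lemma s_exp_initial:
  assumes "e \<ge> 4"
  shows "s_exp e a e = 0" "s_exp e a (e - 1) = 1" "s_exp e a (e - 2) = int (a (e - 1))"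
proof -
  obtain k where "e = k + 4" using assms by (metis le_iff_add add.commute)
  then show "s_exp e a e = 0" "s_exp e a (e - 1) = 1" "s_exp e a (e - 2) = int (a (e - 1))"
    by (simp_all add: s_exp_def numeral_eq_Suc)
qed

lemma s_exp_rec:
  assumes "3 \<le> j" "j + 3 \<le> e"
  shows "s_exp e a j = (int (a (j + 1)) - 1) * s_exp e a (j + 1)
           + (int (a (j + 2)) - 1) * s_exp e a (j + 2) - s_exp e a (j + 3)"
proof -
  obtain k where "e = j + 3 + k" using assms by (metis le_iff_add)
  then show ?thesis by (simp add: s_exp_def numeral_eq_Suc)
qed

lemma s_hat_initial:
  assumes "e \<ge> 5"
  shows "s_hat e a (e - 1) = 0" "s_hat e a (e - 2) = 1" "s_hat e a (e - 3) = int (a (e - 2))"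
proof -
  obtain k where "e = k + 5" using assms by (metis le_iff_add add.commute)
  then show "s_hat e a (e - 1) = 0" "s_hat e a (e - 2) = 1" "s_hat e a (e - 3) = int (a (e - 2))"
    by (simp_all add: s_hat_def numeral_eq_Suc)
qed

lemma s_hat_rec:
  assumes "3 \<le> j" "j + 4 \<le> e"
  shows "s_hat e a j = (int (a (j + 1)) - 1) * s_hat e a (j + 1)
           + (int (a (j + 2)) - 1) * s_hat e a (j + 2) - s_hat e a (j + 3)"
proof -
  obtain k where "e = j + 4 + k" using assms by (metis le_iff_add)
  then show ?thesis by (simp add: s_hat_def numeral_eq_Suc)
qed

lemma exponents_4:
  "s_exp 4 a 3 = 1" "s_hat 4 a 3 = 0" "alpha_exp 4 a = int (a 3) - 1" "beta_exp 4 a = 1"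
  by (simp_all add: s_exp_def s_hat_def alpha_exp_def beta_exp_def)

definition dihedral_poly :: "nat \<Rightarrow> (nat \<Rightarrow> nat) \<Rightarrow> poly3" where
  "dihedral_poly e a =
     Y3 ^ nat (2 * alpha_exp e a + 2 * s_exp e a 3)
     + X3 ^ (a 2 - 1) * Y3 ^ nat (2 * alpha_exp e a) * Z3 ^ nat (2 * s_hat e a 3)
     - X3 * Z3 ^ nat (2 * beta_exp e a + 2 * s_hat e a 3)"


section \<open>Matrices and lattices\<close>

definition koszul_Phi :: "'c::comm_ring_1^3 \<Rightarrow> 'c^3 \<Rightarrow> 'c^4^4" where
  "koszul_Phi P Q = vector
     [vector [P$1, - Q$2, - Q$3, 0],
      vector [P$2, Q$1, 0, - Q$3],
      vector [P$3, 0, Q$1, Q$2],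
      vector [0, P$3, - P$2, P$1]]"

definition koszul_Psi :: "'c::comm_ring_1^3 \<Rightarrow> 'c^3 \<Rightarrow> 'c^4^4" where
  "koszul_Psi P Q = vector
     [vector [Q$1, Q$2, Q$3, 0],
      vector [- P$2, P$1, 0, Q$3],
      vector [- P$3, 0, P$1, - Q$2],
      vector [0, - P$3, P$2, Q$1]]"

definition lattice_matrix :: "'c::comm_ring_1^3 \<Rightarrow> 'c^3 \<Rightarrow> 'c^4^2" where
  "lattice_matrix P Q = vector
     [vector [Q$1, Q$2, Q$3, 0],
      vector [- P$2, P$1, 0, Q$3]]"

definition diagonal_monomial_matrix :: "poly3^'n^'n \<Rightarrow> bool" where
  "diagonal_monomial_matrix D \<longleftrightarrow> (\<forall>i j. i \<noteq> j \<longrightarrow> D$i$j = 0) \<and> (\<forall>i. is_monomial (D$i$i))"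

definition two_rows :: "'c::zero^'n^'m \<Rightarrow> 'm \<Rightarrow> 'm \<Rightarrow> 'c^'n^2" where
  "two_rows M i j = vector [M$i, M$j]"

text \<open>A set of vectors closed under addition and the relevant scalars, as a module.\<close>

definition vec_module :: "('c::comm_ring_1^'n) set \<Rightarrow> ('c, 'c^'n) module" where
  "vec_module L = \<lparr>carrier = L, monoid.mult = undefined, one = undefined, zero = 0, add = (+), module.smult = (*s)\<rparr>"

definition column_lattice :: "'k ring \<Rightarrow> 'k::field^'n^'m \<Rightarrow> ('k^'m) set" where
  "column_lattice B M = {M *v b | b. \<forall>j. b$j \<in> carrier B}"

text \<open>
  The cokernel of a square matrix over the polynomial ring, as a module over a hypersurface ring.
  The equation of the hypersurface must annihilate the cokernel, as it does when the matrix is one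
  half of a matrix factorization.
\<close>

definition coker :: "poly3^'n^'n \<Rightarrow> (poly3 set, (poly3^'n) set) module" where
  "coker M = factor_scalars (quotient_module (vec_module UNIV) (range (\<lambda>v. M *v v)))"

end

theory Submission
  imports Defs
begin

text \<open>
  Two rows of \<open>\<Psi>\<close> annihilate the columns of \<open>\<Phi>\<close>, so they map \<open>E \<otimes> B\<close> onto the lattice
  \<open>L = im T\<close>. Over the fraction field the columns of \<open>\<Phi>\<close> span the kernel of \<open>T\<close>, so the kernel of
  \<open>E \<otimes> B \<rightarrow> L\<close> is torsion, and the two modules have the same bidual. It remains to see that \<open>L\<close>,
  being isomorphic to the maximal Cohen-Macaulay module \<open>U\<close>, is reflexive.

  Let \<open>v\<close> be in the bidual of \<open>L\<close> but not in \<open>L\<close>, and let \<open>p\<close> be a prime minimal over the ideal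
  \<open>{c. c v \<in> L}\<close>. As \<open>F\<close> is monic in \<open>y\<close>, the ring \<open>B\<close> is the integral closure of \<open>\<complex>[x, z]\<close> in \<open>K\<close>.
  If \<open>p\<close> meets \<open>\<complex>[x, z]\<close> in a principal ideal, then the localization of \<open>B\<close> at \<open>p\<close> is a valuation
  ring, and \<open>L\<close> becomes free there. Otherwise \<open>p\<close> has height at least two by going down, and a
  regular pair on the localization of \<open>L\<close> puts \<open>v\<close> into it, because powers of both its members
  do so with multiples of \<open>v\<close>.
\<close>

text \<open>The work takes place over the factorial ring \<complex>[x, z], where prime elements and
  Gauss's lemma do what dimension theory would do over \<open>B\<close>. A prime of \<open>B\<close>
  contracts to a prime of that ring, and such a contraction either contains a prime element \<pi>
  together with an element not divisible by \<pi>, or consists of multiples of a single nonunit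
  (zero included). Localizations are never formed: a statement about the localization at
  \<open>p\<close> is one about multipliers \<open>s\<close> outside \<open>p\<close>, and a common
  multiplier serves finitely many conditions at once.

  Duals are computed inside the plane over \<open>K\<close>. A functional on a lattice of full rank
  is the pairing \<open>dot2 a\<close> with a unique vector \<open>a\<close>, so the bidual is the
  set of vectors on which all integral functionals are integral, and reflexivity becomes an equality
  of subsets of the plane. A map with torsion kernel then changes nothing, since functionals with
  values in \<open>B\<close> vanish on torsion.\<close>

no_notation fps_nth (infixl "$" 75)

section \<open>Integral elements\<close>

text \<open>The homomorphism may have a kernel: the locale is used for the evaluation of all
  polynomials in \<open>K\<close>, whose kernel is generated by \<open>F\<close>, and for its
  restriction to \<complex>[x, z].\<close>

locale field_over =
  fixes \<rho> :: "'r::comm_ring_1 \<Rightarrow> 'k::field"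
  assumes hom_1: "\<rho> 1 = 1"
    and hom_add: "\<rho> (a + b) = \<rho> a + \<rho> b"
    and hom_mult: "\<rho> (a * b) = \<rho> a * \<rho> b"
begin

lemma hom_0 [simp]: "\<rho> 0 = 0"
  using hom_add[of 0 0] by (metis add.right_neutral add_left_cancel)

lemma hom_uminus [simp]: "\<rho> (- a) = - \<rho> a"
  using hom_add[of a "- a"] by (simp add: eq_neg_iff_add_eq_0 add.commute)

lemma hom_diff: "\<rho> (a - b) = \<rho> a - \<rho> b"
  using hom_add[of a "- b"] by simp

lemma hom_sum: "\<rho> (sum f I) = (\<Sum>i\<in>I. \<rho> (f i))"
  by (induction I rule: infinite_finite_induct) (auto simp: hom_add)

lemma hom_power: "\<rho> (a ^ n) = \<rho> a ^ n"
  by (induction n) (auto simp: hom_1 hom_mult)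

definition ev :: "'r poly \<Rightarrow> 'k \<Rightarrow> 'k" where
  "ev f x = poly (map_poly \<rho> f) x"

lemma ev_0 [simp]: "ev 0 x = 0"
  by (simp add: ev_def)

lemma ev_pCons [simp]: "ev (pCons c f) x = \<rho> c + x * ev f x"
  by (simp add: ev_def map_poly_pCons)

lemma ev_add: "ev (f + g) x = ev f x + ev g x"
  by (induction f g rule: poly_induct2) (auto simp: hom_add algebra_simps)

lemma ev_smult: "ev (smult c f) x = \<rho> c * ev f x"
  by (induction f) (auto simp: hom_mult algebra_simps)

lemma ev_mult: "ev (f * g) x = ev f x * ev g x"
  by (induction f) (auto simp: ev_add ev_smult algebra_simps)

lemma ev_diff: "ev (f - g) x = ev f x - ev g x"
  using ev_add[of "f - g" g x] by (simp add: algebra_simps)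

lemma ev_altdef: "degree f \<le> n \<Longrightarrow> ev f x = (\<Sum>i\<le>n. \<rho> (coeff f i) * x ^ i)"
proof -
  have "degree (map_poly \<rho> f) \<le> degree f" by (rule degree_le) (simp add: coeff_map_poly coeff_eq_0)
  then show "degree f \<le> n \<Longrightarrow> ?thesis"
    unfolding ev_def poly_altdef
    by (intro sum.mono_neutral_cong_left) (auto simp: coeff_map_poly intro!: le_degree)
qed

definition integral :: "'k \<Rightarrow> bool" where
  "integral x \<longleftrightarrow> (\<exists>f. lead_coeff f = 1 \<and> ev f x = 0)"

text \<open>The field as a module over the base ring, so that \<open>M.span E\<close> is the
  submodule generated by \<open>E\<close>.\<close>

sublocale M: Modules.module "\<lambda>a x. \<rho> a * x"
  by unfold_locales (auto simp: hom_add hom_mult hom_1 algebra_simps)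

text \<open>Gaussian elimination without division: clearing a column by cross-multiplication preserves
  the shape ``monic of degree \<open>d\<close> on the diagonal, smaller degree elsewhere'' with \<open>d\<close> doubled.\<close>

lemma monic_elimination:
  assumes "finite I" "i0 \<notin> I"
    and "\<And>i. i \<in> insert i0 I \<Longrightarrow> lead_coeff (m i i) = 1 \<and> degree (m i i) = d"
    and "\<And>i j. i \<in> insert i0 I \<Longrightarrow> j \<in> insert i0 I \<Longrightarrow> i \<noteq> j \<Longrightarrow> degree (m i j) < d"
    and "\<And>i. i \<in> insert i0 I \<Longrightarrow> (\<Sum>j\<in>insert i0 I. ev (m i j) x * v j) = 0"
    and "v i0 \<noteq> 0"
  shows "integral x"
  using assms
proof (induction I arbitrary: m d rule: finite_induct)
  case empty
  \<comment> \<open>The index \<open>i0\<close> is never eliminated; its 1 x 1 system remains and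
    \<open>v i0\<close> cancels.\<close>
  then have "ev (m i0 i0) x = 0" by auto
  with empty show ?case unfolding integral_def by blast
next
  case (insert l I)
  let ?J = "insert i0 I"
  define m' where "m' = (\<lambda>i j. m l l * m i j - m i l * m l j)"
  have monic: "lead_coeff (m i i) = 1" "degree (m i i) = d" if "i \<in> insert l ?J" for i
    using insert.prems(2)[of i] that by auto
  have off: "degree (m i j) < d" if "i \<in> insert l ?J" "j \<in> insert l ?J" "i \<noteq> j" for i j
    using insert.prems(3)[of i j] that by auto
  have l: "l \<notin> ?J" using insert by auto
  have dll: "coeff (m l l) d = 1" using monic[of l] by auto
  show ?case
  proof (rule insert.IH[of m' "d + d"])
    show "i0 \<notin> I" using insert by auto
    show "v i0 \<noteq> 0" by fact
    fix i assume i: "i \<in> ?J"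
    then have il: "i \<noteq> l" using l by auto
    have small: "degree (m i l * m l j) < d + d" if "j \<in> ?J" for j
      using off[of i l] off[of l j] i that il l degree_mult_le[of "m i l" "m l j"]
      by (metis add_less_mono insertCI le_less_trans)
    have "coeff (m l l * m i i) (d + d) = 1"
      using coeff_mult_degree_sum[of "m l l" "m i i"] monic[of l] monic[of i] i by auto
    then have c: "coeff (m' i i) (d + d) = 1"
      using small[OF i] by (simp add: m'_def coeff_eq_0)
    have "degree (m' i i) \<le> d + d"
      unfolding m'_def using degree_mult_le[of "m l l" "m i i"] monic[of l] monic[of i] i small[OF i]
      by (intro degree_diff_le) auto
    then show "lead_coeff (m' i i) = 1 \<and> degree (m' i i) = d + d"
      using c by (metis le_antisym le_degree zero_neq_one)
    show "(\<Sum>j\<in>?J. ev (m' i j) x * v j) = 0"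
    proof -
      have fin: "finite ?J" using insert by auto
      have s: "(\<Sum>j\<in>?J. ev (m k j) x * v j) = - (ev (m k l) x * v l)" if "k \<in> insert l ?J" for k
      proof -
        have "(\<Sum>j\<in>insert l ?J. ev (m k j) x * v j) = 0"
          using insert.prems(4)[of k] that by (metis insert_commute)
        then have "ev (m k l) x * v l + (\<Sum>j\<in>?J. ev (m k j) x * v j) = 0"
          using sum.insert[OF fin l] by metis
        then show ?thesis by (rule minus_unique[symmetric])
      qed
      have "(\<Sum>j\<in>?J. ev (m' i j) x * v j)
          = ev (m l l) x * (\<Sum>j\<in>?J. ev (m i j) x * v j) - ev (m i l) x * (\<Sum>j\<in>?J. ev (m l j) x * v j)"
        by (simp add: m'_def ev_diff ev_mult sum_distrib_left sum_subtractf algebra_simps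
            del: sum.insert)
      also have "\<dots> = ev (m l l) x * (- (ev (m i l) x * v l)) - ev (m i l) x * (- (ev (m l l) x * v l))"
        using s[OF insertI2[OF i]] s[OF insertI1] by (simp only:)
      finally show ?thesis by simp
    qed
    fix j assume j: "j \<in> ?J" "i \<noteq> j"
    have "degree (m l l * m i j) < d + d"
      using off[of i j] monic[of l] i j degree_mult_le[of "m l l" "m i j"]
      by (metis (no_types, lifting) add_strict_left_mono insertCI le_less_trans)
    then show "degree (m' i j) < d + d"
      unfolding m'_def using small[OF j(1)] by (rule degree_diff_less)
  qed
qed

text \<open>The Cayley-Hamilton argument: the members of \<open>E\<close> form a nonzero null vector
  of the matrix \<open>x - u\<close>, where \<open>u\<close> describes multiplication by
  \<open>x\<close> on \<open>E\<close>, and \<open>monic_elimination\<close> turns this into an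
  equation for \<open>x\<close>.\<close>

lemma integral_if_stable:
  assumes "finite E" "e0 \<in> E" "e0 \<noteq> 0" and stable: "\<And>e. e \<in> E \<Longrightarrow> x * e \<in> M.span E"
  shows "integral x"
proof -
  have "\<exists>u. x * e = (\<Sum>e'\<in>E. \<rho> (u e') * e')" if "e \<in> E" for e
    using stable[OF that] M.span_finite[OF assms(1)] by auto
  then obtain u where u: "\<And>e. e \<in> E \<Longrightarrow> x * e = (\<Sum>e'\<in>E. \<rho> (u e e') * e')"
    by metis
  \<comment> \<open>The characteristic matrix of \<open>u\<close>: monic linear on the diagonal and
    constant off it, hence the degree \<open>1\<close> below.\<close>
  define m where "m = (\<lambda>i j. (if i = j then [:0, 1:] else 0) - [:u i j:])"
  have E: "insert e0 (E - {e0}) = E" using assms by auto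
  show ?thesis
  proof (rule monic_elimination[of "E - {e0}" e0 m 1 x "\<lambda>e. e"]; (unfold E)?)
    fix i assume i: "i \<in> E"
    have "(\<Sum>j\<in>E. ev (m i j) x * j) = (\<Sum>j\<in>E. (if i = j then x * j else 0) - \<rho> (u i j) * j)"
      by (intro sum.cong) (auto simp: m_def ev_diff hom_1 algebra_simps)
    also have "\<dots> = 0" using i assms(1) u[OF i] by (simp add: sum_subtractf)
    finally show "(\<Sum>j\<in>E. ev (m i j) x * j) = 0" .
  qed (use assms in \<open>auto simp: m_def\<close>)
qed

text \<open>\<open>M.span E\<close> is then a subring that is finitely generated as a module; such
  rings are represented by their generators.\<close>

definition mult_closed :: "'k set \<Rightarrow> bool" where
  "mult_closed E \<longleftrightarrow> finite E \<and> 1 \<in> E \<and> (\<forall>e\<in>E. \<forall>e'\<in>E. e * e' \<in> M.span E)"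

lemma span_stable:
  assumes "\<And>e. e \<in> E \<Longrightarrow> x * e \<in> M.span E'" "s \<in> M.span E"
  shows "x * s \<in> M.span E'"
  using assms(2)
proof (induction rule: M.span_induct_alt)
  case (step c e y)
  have "x * (\<rho> c * e + y) = \<rho> c * (x * e) + x * y" by (simp add: algebra_simps)
  then show ?case using step assms(1) by (simp add: M.span_add M.span_scale)
qed (simp add: M.span_zero)

lemma mult_closed_span:
  assumes "mult_closed E" "s \<in> M.span E" "t \<in> M.span E"
  shows "s * t \<in> M.span E"
proof (rule span_stable[OF _ assms(3)])
  fix e assume e: "e \<in> E"
  have "e * s \<in> M.span E" using assms e by (intro span_stable[OF _ assms(2)]) (auto simp: mult_closed_def)
  then show "s * e \<in> M.span E" by (simp add: mult.commute)
qed

lemma integral_if_in_span: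
  assumes "mult_closed E" "x \<in> M.span E"
  shows "integral x"
  using assms integral_if_stable[of E 1 x]
  by (simp add: mult_closed_def M.span_base mult_closed_span[OF assms(1)])

text \<open>Adjoining a root of a monic polynomial keeps the ring finite as a module. The
  coefficients may lie in the span and not just in the base ring, which is what towers of integral
  equations require.\<close>

lemma adjoin_root:
  assumes E: "mult_closed E" and f: "lead_coeff f = 1" "\<And>i. coeff f i \<in> M.span E" "poly f b = 0"
  obtains E' where "mult_closed E'" "E \<subseteq> E'" "b \<in> M.span E'"
proof -
  define n where "n = degree f"
  have n: "n > 0"
  proof (rule ccontr)
    assume "\<not> n > 0"
    then obtain c where "f = [:c:]" by (metis degree_eq_zeroE n_def neq0_conv)
    with f show False by simp
  qed
  define E' where "E' = (\<lambda>(e, i). e * b ^ i) ` (E \<times> {..<n})"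
  have sub: "E \<subseteq> E'"
    unfolding E'_def using n by (auto intro!: image_eqI[of _ _ "(_, 0)"])
  have bn: "b ^ n = - (\<Sum>k<n. coeff f k * b ^ k)"
  proof -
    have "0 = (\<Sum>k\<le>n. coeff f k * b ^ k)" using f(3) by (simp add: poly_altdef n_def)
    also have "\<dots> = (\<Sum>k<n. coeff f k * b ^ k) + b ^ n"
      using f(1) by (simp add: n_def lessThan_Suc_atMost[symmetric])
    finally show ?thesis by (simp add: eq_neg_iff_add_eq_0 add.commute)
  qed
  have gen: "s * b ^ i \<in> M.span E'" if "s \<in> M.span E" for s i
    using that
  proof (induction i arbitrary: s rule: less_induct)
    case (less i)
    show ?case
    proof (cases "i < n")
      case True
      have "b ^ i * s \<in> M.span E'"
        using True by (intro span_stable[OF _ less(2)] M.span_base)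
          (auto simp: E'_def mult.commute intro!: image_eqI[of _ _ "(_, i)"])
      then show ?thesis by (simp add: mult.commute)
    next
      case False
      then have "b ^ i = b ^ n * b ^ (i - n)" by (simp add: power_add[symmetric])
      \<comment> \<open>Replacing \<open>b ^ n\<close> lowers the exponent:
        \<open>k + (i - n) < i\<close> for \<open>k < n\<close>.\<close>
      then have "s * b ^ i = - (\<Sum>k<n. (s * coeff f k) * b ^ (k + (i - n)))"
        by (simp add: bn sum_distrib_left sum_distrib_right power_add algebra_simps)
      also have "\<dots> \<in> M.span E'"
        using False n by (intro M.span_neg M.span_sum less.IH mult_closed_span[OF E less(2) f(2)]) auto
      finally show ?thesis .
    qed
  qed
  have "mult_closed E'"
    unfolding mult_closed_def
  proof (intro conjI ballI)
    show "finite E'" using E by (auto simp: E'_def mult_closed_def)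
    show "1 \<in> E'" using E sub by (auto simp: mult_closed_def)
    fix c d assume "c \<in> E'" "d \<in> E'"
    then obtain e i e' j where "e \<in> E" "e' \<in> E" "c = e * b ^ i" "d = e' * b ^ j"
      unfolding E'_def by auto
    then show "c * d \<in> M.span E'"
      using gen[of "e * e'" "i + j"] E by (auto simp: mult_closed_def power_add algebra_simps)
  qed
  moreover have "b \<in> M.span E'"
    using gen[of 1 1] E by (auto simp: mult_closed_def M.span_base)
  ultimately show ?thesis using sub that by blast
qed

text \<open>Whatever sums and products are formed from members of \<open>C\<close> stay in one
  subring that is finite as a module, so they are integral by
  \<open>integral_if_in_span\<close>.\<close>

lemma integral_set:
  assumes "finite C" "\<And>c. c \<in> C \<Longrightarrow> integral c"
  obtains E where "mult_closed E" "C \<subseteq> M.span E"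
  using assms
proof (induction C arbitrary: thesis rule: finite_induct)
  case empty
  have "mult_closed {1}" by (auto simp: mult_closed_def M.span_base)
  then show ?case using empty by blast
next
  case (insert c C)
  then obtain E where E: "mult_closed E" "C \<subseteq> M.span E" by blast
  have "integral c" using insert.prems(2) by simp
  then obtain f where f: "lead_coeff f = 1" "ev f c = 0" unfolding integral_def by blast
  have "\<rho> a \<in> M.span E" for a
    using M.span_scale[of 1 E a] E by (auto simp: mult_closed_def M.span_base)
  moreover have "lead_coeff (map_poly \<rho> f) = 1"
  proof -
    have "degree (map_poly \<rho> f) = degree f"
      by (intro antisym degree_le le_degree) (use f(1) in \<open>auto simp: coeff_map_poly coeff_eq_0 hom_1\<close>)
    then show ?thesis using f(1) by (simp add: coeff_map_poly hom_1)
  qed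
  ultimately obtain E' where E': "mult_closed E'" "E \<subseteq> E'" "c \<in> M.span E'"
    using adjoin_root[OF E(1), of "map_poly \<rho> f" c] f(2) by (auto simp: coeff_map_poly ev_def)
  have "insert c C \<subseteq> M.span E'" using E E' M.span_mono by blast
  then show ?case using insert.prems(1) E'(1) by blast
qed

theorem integral_tower:
  assumes "lead_coeff f = 1" "\<And>i. integral (coeff f i)" "poly f x = 0"
  shows "integral x"
proof -
  obtain E where E: "mult_closed E" "coeff f ` {..degree f} \<subseteq> M.span E"
    by (rule integral_set[of "coeff f ` {..degree f}"]) (use assms in auto)
  have c: "coeff f i \<in> M.span E" for i
    using E(2) by (cases "i \<le> degree f") (auto simp: coeff_eq_0 M.span_zero)
  obtain E' where "mult_closed E'" "E \<subseteq> E'" "x \<in> M.span E'"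
    by (rule adjoin_root[OF E(1) assms(1) c assms(3)])
  then show ?thesis using integral_if_in_span by blast
qed

lemma integral_hom: "integral (\<rho> a)"
  unfolding integral_def by (intro exI[of _ "[:- a, 1:]"]) (simp add: hom_1)

lemma integral_add: assumes "integral x" "integral y" shows "integral (x + y)"
  by (rule integral_set[of "{x, y}"]) (use assms in \<open>auto intro: integral_if_in_span M.span_add\<close>)

lemma integral_mult: assumes "integral x" "integral y" shows "integral (x * y)"
  by (rule integral_set[of "{x, y}"]) (use assms in \<open>auto intro: integral_if_in_span mult_closed_span\<close>)

lemma integral_uminus: "integral x \<Longrightarrow> integral (- x)"
  using integral_mult[OF integral_hom[of "- 1"], of x] by (simp add: hom_1)

lemma integral_diff: "integral x \<Longrightarrow> integral y \<Longrightarrow> integral (x - y)"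
  using integral_add[of x "- y"] integral_uminus by auto

lemma integral_0: "integral 0" and integral_1: "integral 1"
  using integral_hom[of 0] integral_hom[of 1] by (auto simp: hom_1)

lemma integral_power: "integral x \<Longrightarrow> integral (x ^ n)"
  by (induction n) (auto simp: integral_1 integral_mult)

lemma integral_sum: "(\<And>i. i \<in> I \<Longrightarrow> integral (f i)) \<Longrightarrow> integral (sum f I)"
  by (induction I rule: infinite_finite_induct) (auto simp: integral_0 integral_add)

end

section \<open>Integral extensions of a factorial ring\<close>

text \<open>\<open>fraction\<close> combines two facts, that the field is algebraic over the base
  and that denominators can be taken in the base; \<open>hom_eq_0D\<close> makes the base a subring.
  Factoriality of the base stands behind Gauss's lemma.\<close>

locale normal_field_over = field_over \<rho>
  for \<rho> :: "'r::{factorial_ring_gcd, semiring_Gcd, semiring_gcd_mult_normalize} \<Rightarrow> 'k::field" +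
  assumes hom_eq_0D: "\<rho> a = 0 \<Longrightarrow> a = 0"
    and fraction: "\<exists>r. r \<noteq> 0 \<and> integral (\<rho> r * u)"
begin

text \<open>Gauss's lemma. The primitive part of an annihilator of least degree divides every
  annihilator over the field of fractions, by division with remainder, and then over the base
  because it is primitive. It divides a monic polynomial, so its leading coefficient is a
  unit.\<close>

lemma minimal_polynomial:
  assumes "integral b"
  obtains h where "lead_coeff h = 1" "ev h b = 0" "\<And>g. ev g b = 0 \<Longrightarrow> h dvd g"
proof -
  obtain f where f: "lead_coeff f = 1" "ev f b = 0" using assms by (auto simp: integral_def)
  then have "f \<noteq> 0 \<and> ev f b = 0" by auto
  then obtain g0 where g0: "g0 \<noteq> 0" "ev g0 b = 0"
    and least: "\<And>g. g \<noteq> 0 \<Longrightarrow> ev g b = 0 \<Longrightarrow> degree g0 \<le> degree g"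
    using ex_has_least_nat[of "\<lambda>g. g \<noteq> 0 \<and> ev g b = 0" f degree] by blast
  define h where "h = primitive_part g0"
  have h: "content h = 1" "degree h = degree g0" "h \<noteq> 0"
    using g0 by (auto simp: h_def)
  have "\<rho> (content g0) * ev h b = 0"
    using g0(2) content_times_primitive_part[of g0] by (simp add: h_def flip: ev_smult)
  then have h0: "ev h b = 0" using hom_eq_0D[of "content g0"] g0(1) by auto
  have dvd: "h dvd g" if "ev g b = 0" for g
  proof -
    obtain a q where aq: "a \<noteq> 0" "smult a g = h * q + pseudo_mod g h"
      using pseudo_mod(1)[OF h(3), of g] by auto
    have "ev (pseudo_mod g h) b = ev (smult a g - h * q) b" using aq by simp
    also have "\<dots> = 0" using that h0 by (simp add: ev_diff ev_mult ev_smult)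
    \<comment> \<open>A nonzero remainder would annihilate \<open>b\<close> in smaller degree than
      \<open>h\<close>.\<close>
    finally have "pseudo_mod g h = 0"
      using pseudo_mod(2)[OF h(3), of g] least[of "pseudo_mod g h"] h(2) by force
    then have "fract_poly h dvd smult (to_fract a) (fract_poly g)"
      using aq(2) by (metis add.right_neutral dvd_triv_left fract_poly_dvd fract_poly_smult)
    then have "fract_poly h dvd fract_poly g"
      using aq(1) by (simp add: dvd_smult_iff)
    then show ?thesis using h(1) by (rule fract_poly_dvdD)
  qed
  obtain q where q: "f = h * q" using dvd[OF f(2)] by auto
  have u: "lead_coeff h * lead_coeff q = 1" using f(1) q by (simp add: lead_coeff_mult)
  show ?thesis
  \<comment> \<open>\<open>lead_coeff q\<close> is the inverse of the leading coefficient of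
    \<open>h\<close>.\<close>
  proof (rule that[of "smult (lead_coeff q) h"])
    show "lead_coeff (smult (lead_coeff q) h) = 1"
      using u by (cases "q = 0") (auto simp: mult.commute)
    show "ev (smult (lead_coeff q) h) b = 0" using h0 by (simp add: ev_smult)
    have "smult (lead_coeff q) h dvd h"
      by (rule dvdI[of _ _ "[:lead_coeff h:]"]) (use u in \<open>simp add: mult.commute\<close>)
    then show "smult (lead_coeff q) h dvd g" if "ev g b = 0" for g
      using dvd[OF that] by (rule dvd_trans)
  qed
qed

text \<open>The numerator of \<open>f (c t / a)\<close>.\<close>

definition rescale :: "'r \<Rightarrow> 'r \<Rightarrow> 'r poly \<Rightarrow> 'r poly" where
  "rescale a c f = (\<Sum>i\<le>degree f. monom (coeff f i * a ^ (degree f - i) * c ^ i) i)"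

lemma coeff_rescale: "coeff (rescale a c f) i = coeff f i * a ^ (degree f - i) * c ^ i"
proof -
  have "coeff (rescale a c f) i
      = (\<Sum>j\<le>degree f. if j = i then coeff f j * a ^ (degree f - j) * c ^ j else 0)"
    by (auto simp: rescale_def coeff_sum intro!: sum.cong)
  then show ?thesis by (simp add: coeff_eq_0)
qed

lemma degree_rescale:
  assumes "c \<noteq> 0"
  shows "degree (rescale a c f) = degree f"
proof (rule antisym)
  show "degree (rescale a c f) \<le> degree f" by (rule degree_le) (simp add: coeff_rescale coeff_eq_0)
  show "degree f \<le> degree (rescale a c f)"
    using assms by (cases "f = 0") (auto intro: le_degree simp: coeff_rescale)
qed

text \<open>Both sides are the homogenization of \<open>f\<close>, at
  \<open>(\<rho> c * y, \<rho> a)\<close> and at \<open>(\<rho> a * t, \<rho> a)\<close>.\<close>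

lemma ev_rescale:
  assumes "\<rho> c * y = \<rho> a * t"
  shows "ev (rescale a c f) y = \<rho> a ^ degree f * ev f t"
proof -
  have "degree (rescale a c f) \<le> degree f" by (rule degree_le) (simp add: coeff_rescale coeff_eq_0)
  then have "ev (rescale a c f) y = (\<Sum>i\<le>degree f. \<rho> (coeff f i) * \<rho> a ^ (degree f - i) * (\<rho> c * y) ^ i)"
    by (simp add: ev_altdef coeff_rescale hom_mult hom_power power_mult_distrib algebra_simps)
  also have "\<dots> = (\<Sum>i\<le>degree f. \<rho> a ^ degree f * (\<rho> (coeff f i) * t ^ i))"
  proof (intro sum.cong refl)
    fix i assume "i \<in> {..degree f}"
    then have "\<rho> a ^ degree f = \<rho> a ^ (degree f - i) * \<rho> a ^ i" by (simp flip: power_add)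
    then show "\<rho> (coeff f i) * \<rho> a ^ (degree f - i) * (\<rho> c * y) ^ i = \<rho> a ^ degree f * (\<rho> (coeff f i) * t ^ i)"
      by (simp add: assms power_mult_distrib)
  qed
  finally show ?thesis by (simp add: ev_altdef[of f "degree f"] sum_distrib_left)
qed

lemma algebraic: "\<exists>g. g \<noteq> 0 \<and> ev g u = 0"
proof -
  obtain r where r: "r \<noteq> 0" "integral (\<rho> r * u)" using fraction by blast
  then obtain h where h: "lead_coeff h = 1" "ev h (\<rho> r * u) = 0" by (auto simp: integral_def)
  \<comment> \<open>With \<open>a = 1\<close> rescaling is the substitution of \<open>r * t\<close>
    for the variable.\<close>
  have "ev (rescale 1 r h) u = 0" using h(2) by (subst ev_rescale[where t = "\<rho> r * u"]) (auto simp: hom_1)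
  moreover have "coeff (rescale 1 r h) (degree h) \<noteq> 0" using h(1) r(1) by (simp add: coeff_rescale)
  ultimately show ?thesis by (metis coeff_0)
qed

text \<open>The minimal polynomials of \<open>s\<close> and \<open>b\<close> are rescalings of each other, so \<open>\<pi>\<close> divides all
  lower coefficients of the one of \<open>s\<close>.\<close>

lemma power_dvd_of_prime:
  assumes \<pi>: "prime_elem \<pi>" "\<not> \<pi> dvd x" and int: "integral s" "integral b" and eq: "\<rho> x * s = \<rho> \<pi> * b"
  obtains n c where "integral c" "s ^ n = \<rho> \<pi> * c"
proof -
  obtain f where f: "lead_coeff f = 1" "ev f s = 0" "\<And>g. ev g s = 0 \<Longrightarrow> f dvd g"
    using minimal_polynomial[OF int(1)] by blast
  obtain h where h: "lead_coeff h = 1" "ev h b = 0" "\<And>g. ev g b = 0 \<Longrightarrow> h dvd g"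
    using minimal_polynomial[OF int(2)] by blast
  define n where "n = degree f"
  have nz: "\<pi> \<noteq> 0" "x \<noteq> 0" "f \<noteq> 0" "h \<noteq> 0" using \<pi> f h by auto
  \<comment> \<open>Rescaling carries annihilators of \<open>b\<close> to annihilators of
    \<open>s\<close> and, with \<pi> and \<open>x\<close> exchanged, those of \<open>s\<close> to
    those of \<open>b\<close>; so the two degrees agree.\<close>
  have "f dvd rescale \<pi> x h" using h by (intro f(3)) (subst ev_rescale[where t = b], auto simp: eq)
  moreover have "rescale \<pi> x h \<noteq> 0"
    using h(1) nz coeff_rescale[of \<pi> x h "degree h"] by auto
  ultimately have "n \<le> degree h"
    using degree_rescale[OF nz(2)] dvd_imp_degree_le n_def by metis
  have P: "coeff (rescale x \<pi> f) n = \<pi> ^ n" using f(1) by (simp add: coeff_rescale n_def)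
  have "h dvd rescale x \<pi> f" using f by (intro h(3)) (subst ev_rescale[where t = s], auto simp: eq)
  then obtain q where q: "rescale x \<pi> f = h * q" by auto
  have "q \<noteq> 0" using q P nz by auto
  then have "degree h + degree q = n"
    using q degree_rescale[OF nz(1), of x f] nz by (simp add: degree_mult_eq n_def)
  then have dh: "degree h = n" and "degree q = 0" using \<open>n \<le> degree h\<close> by auto
  then obtain d where d: "q = [:d:]" by (metis degree_eq_zeroE)
  \<comment> \<open>The quotient is constant, and as \<open>h\<close> is monic it equals the leading
    coefficient of the rescaled \<open>f\<close>.\<close>
  have d': "d = \<pi> ^ n" using P h(1) dh by (simp add: q d)
  have dvd: "\<pi> dvd coeff f i" if "i < n" for i
  proof -
    have "coeff f i * x ^ (n - i) * \<pi> ^ i = \<pi> ^ n * coeff h i"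
      using coeff_rescale[of x \<pi> f i] by (simp add: q d d' n_def)
    \<comment> \<open>After cancelling \<open>\<pi> ^ i\<close>, a power of \<pi> with positive
      exponent \<open>n - i\<close> remains on the right, and \<pi> does not divide
      \<open>x\<close>.\<close>
    also have "\<pi> ^ n = \<pi> ^ (n - i) * \<pi> ^ i" using that by (simp flip: power_add)
    finally have "coeff f i * x ^ (n - i) = \<pi> ^ (n - i) * coeff h i" using nz by simp
    then have "\<pi> dvd coeff f i * x ^ (n - i)" using that by (simp add: dvd_power dvd_mult2)
    then show ?thesis using \<pi> prime_elem_dvd_multD prime_elem_dvd_power by blast
  qed
  then have "\<forall>i. \<exists>g. i < n \<longrightarrow> coeff f i = \<pi> * g" by (meson dvdE)
  then obtain g where g: "\<And>i. i < n \<Longrightarrow> coeff f i = \<pi> * g i" by metis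
  have "0 = (\<Sum>i<n. \<rho> (coeff f i) * s ^ i) + s ^ n"
    using f(1,2) by (simp add: ev_altdef[of f n] n_def hom_1 flip: lessThan_Suc_atMost)
  moreover have "(\<Sum>i<n. \<rho> (coeff f i) * s ^ i) = \<rho> \<pi> * (\<Sum>i<n. \<rho> (g i) * s ^ i)"
    unfolding sum_distrib_left by (intro sum.cong) (simp_all add: g hom_mult)
  ultimately have "s ^ n = \<rho> \<pi> * (- (\<Sum>i<n. \<rho> (g i) * s ^ i))"
    by (simp add: eq_neg_iff_add_eq_0 add.commute)
  moreover have "integral (- (\<Sum>i<n. \<rho> (g i) * s ^ i))"
    by (intro integral_uminus integral_sum integral_mult integral_hom integral_power int)
  ultimately show ?thesis using that by blast
qed

section \<open>The integral closure as a ring, its ideals and primes\<close>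

definition B :: "'k ring" where
  "B = ring_of_type_algebra\<lparr>carrier := {x. integral x}\<rparr>"

lemma B_simps [simp]:
  "x \<in> carrier B \<longleftrightarrow> integral x" "x \<otimes>\<^bsub>B\<^esub> y = x * y" "x \<oplus>\<^bsub>B\<^esub> y = x + y"
  "\<one>\<^bsub>B\<^esub> = 1" "\<zero>\<^bsub>B\<^esub> = 0" "monoid.mult B = (*)" "add B = (+)"
  by (auto simp: B_def ring_of_type_algebra_def)

lemma cring_B: "cring B"
proof (intro cringI abelian_groupI comm_monoidI)
  fix x assume "x \<in> carrier B"
  then show "\<exists>y\<in>carrier B. y \<oplus>\<^bsub>B\<^esub> x = \<zero>\<^bsub>B\<^esub>"
    by (intro bexI[of _ "- x"]) (auto simp: integral_uminus)
qed (auto simp: integral_add integral_mult integral_0 integral_1 algebra_simps)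

text \<open>A restatement of \<open>ideal\<close> in the operations of the field;
  \<open>is_prime\<close> below plays the same role for \<open>primeideal\<close>.\<close>

definition is_ideal :: "'k set \<Rightarrow> bool" where
  "is_ideal I \<longleftrightarrow> I \<subseteq> {x. integral x} \<and> 0 \<in> I \<and> (\<forall>x\<in>I. \<forall>y\<in>I. x + y \<in> I) \<and>
     (\<forall>x\<in>I. \<forall>c. integral c \<longrightarrow> c * x \<in> I)"

definition is_prime :: "'k set \<Rightarrow> bool" where
  "is_prime p \<longleftrightarrow> is_ideal p \<and> 1 \<notin> p \<and> (\<forall>a b. integral a \<longrightarrow> integral b \<longrightarrow> a * b \<in> p \<longrightarrow> a \<in> p \<or> b \<in> p)"

definition is_mult :: "'k set \<Rightarrow> bool" where
  "is_mult S \<longleftrightarrow> S \<subseteq> {x. integral x} \<and> 1 \<in> S \<and> (\<forall>x\<in>S. \<forall>y\<in>S. x * y \<in> S)"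

lemma ideal_iff: "ideal I B \<longleftrightarrow> is_ideal I"
proof
  assume "ideal I B"
  then interpret ideal I B .
  show "is_ideal I"
    unfolding is_ideal_def
    using a_subset zero_closed I_l_closed additive_subgroup.a_closed[OF is_additive_subgroup] additive_subgroup.zero_closed[OF is_additive_subgroup]
    by auto
next
  assume I: "is_ideal I"
  have neg: "- x \<in> I" if "x \<in> I" for x
  proof -
    have "- 1 * x \<in> I" using I that integral_uminus[OF integral_1] unfolding is_ideal_def by blast
    then show ?thesis by simp
  qed
  show "ideal I B"
  proof (rule idealI)
    show "ring B" using cring_B by (simp add: cring_def)
    interpret cring B by (rule cring_B)
    show "subgroup I (add_monoid B)"
    proof (rule group.subgroupI[OF a_group])
      fix x assume x: "x \<in> I"
      then have "inv\<^bsub>add_monoid B\<^esub> x = - x"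
        using I neg[OF x] by (intro comm_monoid.comm_inv_char[OF a_comm_monoid]) (auto simp: is_ideal_def)
      then show "inv\<^bsub>add_monoid B\<^esub> x \<in> I" using neg[OF x] by simp
    qed (use I in \<open>auto simp: is_ideal_def\<close>)
  qed (use I in \<open>auto simp: is_ideal_def mult.commute\<close>)
qed

lemma primeideal_iff: "primeideal p B \<longleftrightarrow> is_prime p"
proof
  assume "primeideal p B"
  then interpret primeideal p B .
  show "is_prime p"
    unfolding is_prime_def using is_ideal[unfolded ideal_iff] I_prime I_notcarr one_imp_carrier by auto
next
  assume p: "is_prime p"
  show "primeideal p B"
    by (rule primeidealI) (use p ideal_iff cring_B integral_1 in \<open>auto simp: is_prime_def\<close>)
qed

text \<open>An ideal \<open>p\<close> maximal among those that contain \<open>I\<close> and avoid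
  \<open>S\<close> is prime: if \<open>a\<close> and \<open>b\<close> lie outside \<open>p\<close>,
  then \<open>p + (a)\<close> and \<open>p + (b)\<close> both meet \<open>S\<close>, and the product
  of two such meeting points lies in \<open>p + (a b)\<close>.\<close>

lemma exists_prime_disjoint:
  assumes I: "is_ideal I" and S: "is_mult S" and disj: "I \<inter> S = {}"
  obtains p where "is_prime p" "I \<subseteq> p" "p \<inter> S = {}"
proof -
  let ?X = "{J. is_ideal J \<and> I \<subseteq> J \<and> J \<inter> S = {}}"
  have "\<exists>p\<in>?X. \<forall>J\<in>?X. p \<subseteq> J \<longrightarrow> J = p"
  proof (rule subset_Zorn_nonempty)
    show "?X \<noteq> {}" using I disj by auto
    fix C assume C: "C \<noteq> {}" "subset.chain ?X C"
    have id: "is_ideal J" "I \<subseteq> J" "J \<inter> S = {}" if "J \<in> C" for J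
      using C(2) that by (auto simp: subset_chain_def)
    have "is_ideal (\<Union>C)"
      unfolding is_ideal_def
    proof (intro conjI ballI allI impI)
      show "\<Union>C \<subseteq> {x. integral x}" using id(1) unfolding is_ideal_def by blast
      show "0 \<in> \<Union>C" using id(1) C(1) unfolding is_ideal_def by blast
      fix x assume "x \<in> \<Union>C"
      then obtain J where J: "J \<in> C" "x \<in> J" by blast
      show "c * x \<in> \<Union>C" if "integral c" for c
        using J that id(1)[OF J(1)] unfolding is_ideal_def by blast
      fix y assume "y \<in> \<Union>C"
      then obtain J' where J': "J' \<in> C" "y \<in> J'" by blast
      have "J \<subseteq> J' \<or> J' \<subseteq> J" using C(2) J J' by (auto simp: subset_chain_def)
      then obtain L where L: "L \<in> C" "x \<in> L" "y \<in> L" using J J' by blast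
      then have "x + y \<in> L" using id(1)[OF L(1)] by (simp add: is_ideal_def)
      then show "x + y \<in> \<Union>C" using L(1) by blast
    qed
    then show "\<Union>C \<in> ?X" using id C(1) by blast
  qed
  then obtain p where "p \<in> ?X" and max': "\<forall>J\<in>?X. p \<subseteq> J \<longrightarrow> J = p" by (rule bexE)
  then have p: "is_ideal p" "I \<subseteq> p" "p \<inter> S = {}" by simp_all
  have max: "J = p" if "is_ideal J" "p \<subseteq> J" "J \<inter> S = {}" for J
  proof -
    have "J \<in> ?X" using that p(2) by auto
    then show ?thesis using bspec[OF max'] that(2) by iprover
  qed
  have meets: "\<exists>j\<in>p. \<exists>c. integral c \<and> j + c * a \<in> S" if a: "integral a" "a \<notin> p" for a
  proof (rule ccontr)
    assume none: "\<not> ?thesis"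
    let ?J = "{j + c * a | j c. j \<in> p \<and> integral c}"
    have "is_ideal ?J"
      unfolding is_ideal_def
    proof (intro conjI ballI allI impI)
      show "?J \<subseteq> {x. integral x}" using p(1) a by (auto simp: is_ideal_def integral_add integral_mult subset_iff)
      show "0 \<in> ?J" using p(1) integral_0 by (auto simp: is_ideal_def intro!: exI[of _ 0])
      fix x assume "x \<in> ?J"
      then obtain j c where jc: "x = j + c * a" "j \<in> p" "integral c" by auto
      { fix y assume "y \<in> ?J"
        then obtain j' c' where "y = j' + c' * a" "j' \<in> p" "integral c'" by auto
        then show "x + y \<in> ?J" using jc p(1)
          by (intro CollectI exI[of _ "j + j'"] exI[of _ "c + c'"])
            (auto simp: is_ideal_def integral_add algebra_simps) }
      fix d assume "integral d"
      then show "d * x \<in> ?J" using jc p(1)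
        by (intro CollectI exI[of _ "d * j"] exI[of _ "d * c"])
          (auto simp: is_ideal_def integral_mult algebra_simps)
    qed
    moreover have "p \<subseteq> ?J"
    proof
      fix j assume "j \<in> p"
      then show "j \<in> ?J" using integral_0 by (intro CollectI exI[of _ j] exI[of _ 0]) simp
    qed
    moreover have "?J \<inter> S = {}" using none by auto
    ultimately have "?J = p" by (rule max)
    moreover have "a \<in> ?J"
      using p(1) integral_1 by (intro CollectI exI[of _ 0] exI[of _ 1]) (simp add: is_ideal_def)
    ultimately show False using a by simp
  qed
  have "is_prime p"
    unfolding is_prime_def
  proof (intro conjI allI impI)
    show "1 \<notin> p" using p(3) S by (auto simp: is_mult_def)
    fix a b assume ab: "integral a" "integral b" "a * b \<in> p"
    show "a \<in> p \<or> b \<in> p"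
    proof (rule ccontr)
      assume "\<not> (a \<in> p \<or> b \<in> p)"
      then obtain j c j' c' where "j \<in> p" "integral c" "j + c * a \<in> S" "j' \<in> p" "integral c'" "j' + c' * b \<in> S"
        using meets[of a] meets[of b] ab by blast
      then have "(j + c * a) * (j' + c' * b) \<in> S" using S by (auto simp: is_mult_def)
      moreover have "(j + c * a) * (j' + c' * b) = (j' + c' * b) * j + ((c * a) * j' + (c * c') * (a * b))"
        by (simp add: algebra_simps)
      moreover have "(j' + c' * b) * j + ((c * a) * j' + (c * c') * (a * b)) \<in> p"
        using p(1) ab \<open>j \<in> p\<close> \<open>j' \<in> p\<close> \<open>integral c\<close> \<open>integral c'\<close>
        unfolding is_ideal_def by (auto simp: integral_add integral_mult subset_iff)
      ultimately show False using p(3) by auto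
    qed
  qed (use p in auto)
  then show ?thesis using p that by blast
qed

text \<open>A prime minimal over \<open>I\<close>, obtained as the complement of a maximal multiplicative set
  avoiding \<open>I\<close>: in the localization at \<open>p\<close> every element of \<open>p\<close> is nilpotent modulo \<open>I\<close>.\<close>

lemma exists_minimal_prime:
  assumes I: "is_ideal I" "1 \<notin> I"
  obtains p where "is_prime p" "I \<subseteq> p" "\<And>r. r \<in> p \<Longrightarrow> \<exists>N s. integral s \<and> s \<notin> p \<and> s * r ^ N \<in> I"
proof -
  let ?X = "{S. is_mult S \<and> I \<inter> S = {}}"
  have "\<exists>T\<in>?X. \<forall>S\<in>?X. T \<subseteq> S \<longrightarrow> S = T"
  proof (rule subset_Zorn_nonempty)
    have "{1} \<in> ?X" using I integral_1 by (auto simp: is_mult_def)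
    then show "?X \<noteq> {}" by blast
    fix C assume C: "C \<noteq> {}" "subset.chain ?X C"
    have id: "is_mult J" "I \<inter> J = {}" if "J \<in> C" for J
      using C(2) that by (auto simp: subset_chain_def)
    have "is_mult (\<Union>C)"
      unfolding is_mult_def
    proof (intro conjI ballI allI impI)
      fix x y assume "x \<in> \<Union>C" "y \<in> \<Union>C"
      then obtain J J' where J: "J \<in> C" "J' \<in> C" "x \<in> J" "y \<in> J'" by blast
      then have "J \<subseteq> J' \<or> J' \<subseteq> J" using C(2) by (auto simp: subset_chain_def)
      then obtain L where L: "L \<in> C" "x \<in> L" "y \<in> L" using J by blast
      then have "x * y \<in> L" using id(1)[OF L(1)] by (simp add: is_mult_def)
      then show "x * y \<in> \<Union>C" using L(1) by blast
    next
      show "\<Union>C \<subseteq> {x. integral x}" using id(1) unfolding is_mult_def by blast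
      show "1 \<in> \<Union>C" using id(1) C(1) unfolding is_mult_def by blast
    qed
    then show "\<Union>C \<in> ?X" using id by auto
  qed
  then obtain T where "T \<in> ?X" and max': "\<forall>S\<in>?X. T \<subseteq> S \<longrightarrow> S = T" by (rule bexE)
  then have T: "is_mult T" "I \<inter> T = {}" by simp_all
  have max: "S = T" if "is_mult S" "T \<subseteq> S" "I \<inter> S = {}" for S
  proof -
    have "S \<in> ?X" using that by simp
    then show ?thesis using bspec[OF max'] that(2) by iprover
  qed
  obtain p where p: "is_prime p" "I \<subseteq> p" "p \<inter> T = {}"
    using exists_prime_disjoint[OF I(1) T] by blast
  have "is_mult ({x. integral x} - p)"
    using p(1) by (auto simp: is_mult_def is_prime_def integral_1 integral_mult)
  \<comment> \<open>The complement of \<open>p\<close> contains \<open>T\<close> and avoids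
    \<open>I\<close>, so maximality of \<open>T\<close> makes them equal.\<close>
  then have "{x. integral x} - p = T" using p T by (intro max) (auto simp: is_mult_def)
  then have T_eq: "s \<in> T \<longleftrightarrow> integral s \<and> s \<notin> p" for s by auto
  have "\<exists>N s. integral s \<and> s \<notin> p \<and> s * r ^ N \<in> I" if r: "r \<in> p" for r
  proof (rule ccontr)
    assume none: "\<not> ?thesis"
    have "integral r" using r p(1) by (auto simp: is_prime_def is_ideal_def)
    \<comment> \<open>The multiplicative set generated by \<open>T\<close> and \<open>r\<close>.
      Avoiding \<open>I\<close>, it would be \<open>T\<close> itself, which contains no element of
      \<open>p\<close>.\<close>
    let ?S = "{s * r ^ N | s N. s \<in> T}"
    have "is_mult ?S"
      unfolding is_mult_def
    proof (intro conjI ballI)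
      show "?S \<subseteq> {x. integral x}" 
        using \<open>integral r\<close> by (auto simp: T_eq intro: integral_mult integral_power)
      show "1 \<in> ?S" using T(1) by (intro CollectI exI[of _ 1] exI[of _ 0]) (simp add: is_mult_def)
      fix x y assume "x \<in> ?S" "y \<in> ?S"
      then obtain s N s' N' where "x = s * r ^ N" "y = s' * r ^ N'" "s \<in> T" "s' \<in> T" by auto
      then show "x * y \<in> ?S" using T(1)
        by (intro CollectI exI[of _ "s * s'"] exI[of _ "N + N'"]) (auto simp: is_mult_def power_add algebra_simps)
    qed
    moreover have "T \<subseteq> ?S"
    proof
      fix s assume "s \<in> T"
      then show "s \<in> ?S" by (intro CollectI exI[of _ s] exI[of _ 0]) simp
    qed
    moreover have "I \<inter> ?S = {}" using none T_eq by auto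
    ultimately have "?S = T" by (rule max)
    moreover have "r \<in> ?S"
      using T(1) by (intro CollectI exI[of _ 1]) (simp add: is_mult_def)
    ultimately show False using r T_eq by simp
  qed
  then show ?thesis using p that by blast
qed

section \<open>Primes of the integral closure and their contractions to the factorial ring\<close>

lemma is_prime_multD:
  "is_prime p \<Longrightarrow> integral a \<Longrightarrow> integral b \<Longrightarrow> a * b \<in> p \<Longrightarrow> a \<in> p \<or> b \<in> p"
  by (simp add: is_prime_def)

lemma is_prime_mult: "is_prime p \<Longrightarrow> integral c \<Longrightarrow> x \<in> p \<Longrightarrow> c * x \<in> p"
  by (simp add: is_prime_def is_ideal_def)

lemma zero_prime: "is_prime {0}"
  by (auto simp: is_prime_def is_ideal_def integral_0)

text \<open>Going down from \<open>p\<close> to the prime generated by \<pi>. The members of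
  \<open>?S\<close> are products of an element outside \<open>p\<close> and an element of the base
  not divisible by \<pi>. A prime over \<pi> that avoids \<open>?S\<close> lies inside
  \<open>p\<close> (take \<open>y = 1\<close>) and misses \<open>\<rho> x\<close> (take
  \<open>s = 1\<close>), so it stands strictly between zero and \<open>p\<close>.\<close>

lemma height_ge_2:
  assumes p: "is_prime p" and \<pi>: "prime_elem \<pi>" "\<rho> \<pi> \<in> p" and x: "\<rho> x \<in> p" "\<not> \<pi> dvd x"
  shows "height B p \<ge> 2"
proof -
  let ?I = "{\<rho> \<pi> * c | c. integral c}"
  let ?S = "{s * \<rho> y | s y. integral s \<and> s \<notin> p \<and> \<not> \<pi> dvd y}"
  have "is_ideal ?I"
    unfolding is_ideal_def
  proof (intro conjI ballI allI impI)
    show "?I \<subseteq> {x. integral x}" by (auto intro: integral_mult integral_hom)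
    show "0 \<in> ?I" by (auto intro!: exI[of _ 0] integral_0)
    fix x assume "x \<in> ?I"
    then obtain c where c: "x = \<rho> \<pi> * c" "integral c" by auto
    { fix y assume "y \<in> ?I"
      then obtain d where "y = \<rho> \<pi> * d" "integral d" by auto
      then show "x + y \<in> ?I" using c
        by (intro CollectI exI[of _ "c + d"]) (auto simp: integral_add algebra_simps) }
    fix d assume "integral d"
    then show "d * x \<in> ?I" using c
      by (intro CollectI exI[of _ "d * c"]) (auto simp: integral_mult algebra_simps)
  qed
  moreover have "is_mult ?S"
    unfolding is_mult_def
  proof (intro conjI ballI)
    show "?S \<subseteq> {x. integral x}" by (auto intro: integral_mult integral_hom)
    show "1 \<in> ?S" using p \<pi> by (auto simp: is_prime_def integral_1 hom_1 prime_elem_def intro!: exI[of _ 1])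
    fix u v assume "u \<in> ?S" "v \<in> ?S"
    then obtain s y s' y' where "u = s * \<rho> y" "v = s' * \<rho> y'" "integral s" "integral s'" "s \<notin> p" "s' \<notin> p"
      "\<not> \<pi> dvd y" "\<not> \<pi> dvd y'" by auto
    then show "u * v \<in> ?S" using p \<pi>
      by (intro CollectI exI[of _ "s * s'"] exI[of _ "y * y'"])
        (auto simp: is_prime_def hom_mult integral_mult prime_elem_dvd_mult_iff algebra_simps)
  qed
  moreover have "?I \<inter> ?S = {}"
  proof (rule ccontr)
    assume "?I \<inter> ?S \<noteq> {}"
    then obtain c s y where c: "\<rho> \<pi> * c = s * \<rho> y" "integral c" "integral s" "s \<notin> p" "\<not> \<pi> dvd y" by blast
    \<comment> \<open>If the two sets met, \<open>power_dvd_of_prime\<close> would put a power of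
      \<open>s\<close> into \<open>p\<close>.\<close>
    have "\<rho> y * s = \<rho> \<pi> * c" using c(1) by (simp add: mult.commute)
    from power_dvd_of_prime[OF \<pi>(1) c(5,3,2) this]
    obtain n d where nd: "integral d" "s ^ n = \<rho> \<pi> * d" by blast
    then have "d * \<rho> \<pi> \<in> p" using \<pi> p by (auto simp: is_prime_def is_ideal_def)
    then have "s ^ n \<in> p" using nd by (simp add: mult.commute)
    moreover have "s ^ k \<notin> p" for k
      using c(3,4) p integral_power[OF c(3)] unfolding is_prime_def by (induction k) auto
    ultimately show False by blast
  qed
  ultimately obtain P where P: "is_prime P" "?I \<subseteq> P" "P \<inter> ?S = {}" by (rule exists_prime_disjoint)
  have one: "\<not> \<pi> dvd 1" using \<pi>(1) by (simp add: prime_elem_def)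
  have "P \<subseteq> p"
  proof
    fix s assume s: "s \<in> P"
    then have "s \<notin> ?S" "integral s" using P by (auto simp: is_prime_def is_ideal_def)
    then have "\<not> (s \<notin> p \<and> \<not> \<pi> dvd 1)" by (auto simp: hom_1 dest!: spec[of _ s] spec[of _ 1])
    then show "s \<in> p" using one by simp
  qed
  moreover have "\<rho> x \<notin> P"
  proof -
    have "1 * \<rho> x \<in> ?S" using x p by (intro CollectI exI[of _ 1] exI[of _ x]) (auto simp: is_prime_def integral_1)
    then show ?thesis using P(3) by auto
  qed
  moreover have "\<rho> \<pi> \<in> P"
  proof -
    have "\<rho> \<pi> \<in> ?I" using integral_1 by (intro CollectI exI[of _ 1]) simp
    then show ?thesis using P(2) by blast
  qed
  moreover have "\<rho> \<pi> \<noteq> 0" using \<pi>(1) hom_eq_0D[of \<pi>] by (auto simp: prime_elem_def)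
  moreover have "0 \<in> P" using P(1) by (auto simp: is_prime_def is_ideal_def)
  ultimately have chain: "{0} \<subset> P" "P \<subset> p" using x by auto
  define c where "c = (\<lambda>i::nat. if i = 0 then {0} else if i = 1 then P else p)"
  have "\<exists>c::nat \<Rightarrow> 'k set. (\<forall>i\<le>2. primeideal (c i) B) \<and> (\<forall>i<2. c i \<subset> c (Suc i)) \<and> c 2 = p"
    by (intro exI[of _ c])
      (use chain p P zero_prime in \<open>auto simp: c_def primeideal_iff less_Suc_eq numeral_2_eq_2\<close>)
  then have "enat 2 \<le> height B p"
    unfolding height_def by (intro Sup_upper) blast
  then show ?thesis by (simp add: numeral_eq_enat)
qed

text \<open>If a polynomial with integral coefficients, not all in \<open>p\<close>, vanishes at \<open>u\<close>, then \<open>u\<close> or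
  \<open>1/u\<close> lies in the localization at \<open>p\<close>: absorb the leading term \<open>c\<^sub>n u\<^sup>n\<close> into the next one, as
  \<open>c\<^sub>n u\<close> is integral.\<close>

lemma local_valuation_aux:
  assumes p: "is_prime p"
    and "\<And>i. integral (coeff f i)" "coeff f j \<notin> p" "poly f u = 0"
  shows "\<exists>s. integral s \<and> s \<notin> p \<and> (integral (s * u) \<or> integral (s / u))"
  using assms(2-)
proof (induction "degree f" arbitrary: f j rule: less_induct)
  case less
  define n where "n = degree f"
  define c where "c = lead_coeff f"
  have p0: "0 \<in> p" using p by (auto simp: is_prime_def is_ideal_def)
  then have f0: "f \<noteq> 0" using less.prems by auto
  have n0: "n > 0"
  proof (rule ccontr)
    assume "\<not> n > 0"
    then obtain d where "f = [:d:]" by (metis degree_eq_zeroE n_def neq0_conv)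
    then show False using less.prems p0 by (auto simp: coeff_pCons split: nat.splits)
  qed
  have cu: "integral (c * u)"
  proof -
    \<comment> \<open>This is \<open>c ^ (n - 1) * f (t / c)\<close>, a monic polynomial with
      integral coefficients and root \<open>c * u\<close>.\<close>
    define g where "g = monom 1 n + (\<Sum>i<n. monom (coeff f i * c ^ (n - 1 - i)) i)"
    have g: "coeff g i = (if i = n then 1 else if i < n then coeff f i * c ^ (n - 1 - i) else 0)" for i
    proof -
      have "coeff g i = (if i = n then 1 else 0) + (\<Sum>k<n. if k = i then coeff f k * c ^ (n - 1 - k) else 0)"
        by (auto simp: g_def coeff_sum intro!: sum.cong)
      then show ?thesis by simp
    qed
    then have "degree g = n" by (intro antisym degree_le le_degree) auto
    moreover have "poly g (c * u) = c ^ (n - 1) * poly f u"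
    proof -
      have "poly g (c * u) = (c * u) ^ n + (\<Sum>i<n. (coeff f i * c ^ (n - 1 - i)) * (c * u) ^ i)"
        by (simp add: g_def poly_sum poly_monom)
      also have "(c * u) ^ n = c ^ (n - 1) * (c * u ^ n)"
        using n0 by (cases n) (simp_all add: power_mult_distrib mult_ac)
      also have "(\<Sum>i<n. (coeff f i * c ^ (n - 1 - i)) * (c * u) ^ i)
          = (\<Sum>i<n. c ^ (n - 1) * (coeff f i * u ^ i))"
      proof (intro sum.cong refl)
        fix i assume "i \<in> {..<n}"
        then have "c ^ (n - 1) = c ^ (n - 1 - i) * c ^ i" by (simp flip: power_add)
        then show "(coeff f i * c ^ (n - 1 - i)) * (c * u) ^ i = c ^ (n - 1) * (coeff f i * u ^ i)"
          by (simp add: power_mult_distrib)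
      qed
      also have "c ^ (n - 1) * (c * u ^ n) + (\<Sum>i<n. c ^ (n - 1) * (coeff f i * u ^ i)) = c ^ (n - 1) * poly f u"
        by (simp add: poly_altdef n_def c_def sum_distrib_left algebra_simps flip: lessThan_Suc_atMost)
      finally show ?thesis .
    qed
    moreover have "integral (coeff g i)" for i
      unfolding g c_def by (simp add: less.prems(1) integral_0 integral_1 integral_mult integral_power)
    ultimately show ?thesis
      using integral_tower[of g "c * u"] by (simp add: g less.prems(3))
  qed
  show ?case
  proof (cases "c \<in> p")
    case False
    then show ?thesis using cu less.prems(1)[of "degree f"] unfolding c_def by blast
  next
    case c: True
    show ?thesis
    proof (cases "c * u \<in> p")
      case False
      then have "u \<noteq> 0" using p0 by auto
      \<comment> \<open>Here \<open>c * u\<close> is the multiplier, and \<open>1 / u\<close> is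
        what it makes integral.\<close>
      then have "integral (c * u / u)" using less.prems(1)[of "degree f"] by (simp add: c_def)
      then show ?thesis using False cu by blast
    next
      case True
      \<comment> \<open>The degree drops, and the coefficient at \<open>n - 1\<close> changes by an
        element of \<open>p\<close>. Since the leading coefficient lies in \<open>p\<close>, the
        index \<open>j\<close> is below \<open>n\<close>, and \<open>coeff g j\<close> stays outside
        \<open>p\<close>.\<close>
      define g where "g = f - monom c n + monom (c * u) (n - 1)"
      have g: "coeff g i = (if i = n - 1 then coeff f i + c * u else if i < n then coeff f i else 0)" for i
        using n0 by (auto simp: g_def c_def n_def coeff_eq_0)
      have "degree g \<le> n - 1" by (rule degree_le) (use g in auto)
      then have "degree g < degree f" using n0 by (simp add: n_def)
      moreover have "integral (coeff g i)" for i
        unfolding g using cu by (simp add: less.prems(1) integral_0 integral_add)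
      moreover have "poly g u = 0"
        using less.prems(3) n0 by (cases n) (simp_all add: g_def poly_monom mult_ac)
      moreover have "coeff g j \<notin> p"
      proof -
        have "j < n" using less.prems(2) c p0 le_degree[of f j]
          unfolding c_def n_def by (metis nat_less_le)
        moreover have "coeff f j + c * u \<notin> p"
        proof
          assume "coeff f j + c * u \<in> p"
          moreover have "- (c * u) \<in> p"
          proof -
            have "- 1 * (c * u) \<in> p"
              using True p integral_uminus[OF integral_1] unfolding is_prime_def is_ideal_def by blast
            then show ?thesis by simp
          qed
          ultimately have "(coeff f j + c * u) + - (c * u) \<in> p"
            using p unfolding is_prime_def is_ideal_def by blast
          then show False using less.prems(2) by simp
        qed
        ultimately show ?thesis using less.prems(2) by (simp only: g split: if_split) blast
      qed
      ultimately show ?thesis by (intro less.hyps[of g j])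
    qed
  qed
qed

text \<open>Gauss's lemma again: \<open>u\<close> is a root of a primitive polynomial over the base,
  and \<pi> does not divide all its coefficients, so one of them lies outside
  \<open>p\<close>.\<close>

lemma local_valuation:
  assumes p: "is_prime p" and \<pi>: "\<not> \<pi> dvd 1" "\<And>r. \<rho> r \<in> p \<Longrightarrow> \<pi> dvd r"
  shows "\<exists>s. integral s \<and> s \<notin> p \<and> (integral (s * u) \<or> integral (s / u))"
proof -
  obtain g where g: "g \<noteq> 0" "ev g u = 0" using algebraic by blast
  define h where "h = primitive_part g"
  have "\<rho> (content g) * ev h u = 0"
    using g(2) content_times_primitive_part[of g] by (simp add: h_def flip: ev_smult)
  then have h: "content h = 1" "ev h u = 0" using hom_eq_0D[of "content g"] g(1) by (auto simp: h_def)
  have "\<exists>j. \<not> \<pi> dvd coeff h j"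
  proof (rule ccontr)
    assume "\<not> ?thesis"
    then have "\<pi> dvd content h" by (simp flip: const_poly_dvd_iff_dvd_content add: const_poly_dvd_iff)
    then show False using \<pi> h by simp
  qed
  then obtain j where "coeff (map_poly \<rho> h) j \<notin> p" using \<pi>(2) by (auto simp: coeff_map_poly)
  then show ?thesis
    using h(2) by (intro local_valuation_aux[OF p, of "map_poly \<rho> h" j]) (auto simp: coeff_map_poly integral_hom ev_def)
qed

text \<open>A nonzero element of the contraction is a product of primes up to a unit, and one of
  these primes lies in \<open>p\<close>. The cases differ in whether that prime divides the whole
  contraction.\<close>

lemma prime_contraction_cases:
  assumes p: "is_prime p"
  obtains (big) \<pi> x where "prime_elem \<pi>" "\<rho> \<pi> \<in> p" "\<rho> x \<in> p" "\<not> \<pi> dvd x"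
    | (principal) \<pi> where "\<not> \<pi> dvd 1" "\<And>r. \<rho> r \<in> p \<Longrightarrow> \<pi> dvd r"
proof (cases "\<exists>r. r \<noteq> 0 \<and> \<rho> r \<in> p")
  case True
  then obtain r where "r \<noteq> 0" "\<rho> r \<in> p" by blast
  then have "\<exists>\<pi>. prime_elem \<pi> \<and> \<rho> \<pi> \<in> p"
  proof (induction r rule: prime_divisors_induct)
    case (unit r)
    then obtain r' where "1 = r * r'" by blast
    then have "\<rho> r' * \<rho> r = 1" by (simp add: hom_1 mult.commute flip: hom_mult)
    moreover have "\<rho> r' * \<rho> r \<in> p" using unit(3) by (intro is_prime_mult[OF p] integral_hom)
    ultimately show ?case using p by (simp add: is_prime_def)
  next
    case (factor \<pi> r)
    then have "\<rho> \<pi> \<in> p \<or> \<rho> r \<in> p"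
      by (intro is_prime_multD[OF p] integral_hom) (simp flip: hom_mult)
    then show ?case using factor by auto
  qed auto
  then obtain \<pi> where "prime_elem \<pi>" "\<rho> \<pi> \<in> p" by blast
  then show ?thesis using big principal[of \<pi>] by (metis prime_elem_def)
next
  case False
  \<comment> \<open>Divisibility by \<open>0\<close> expresses that the contraction is zero.\<close>
  then show ?thesis using principal[of 0] by auto
qed

end

section \<open>Lattices and double duals\<close>

text \<open>Vectors serve as functionals: the dual of a full lattice in the plane is the set of
  those \<open>a\<close> whose pairing with it is integral.\<close>

definition dot2 :: "'k::field^2 \<Rightarrow> 'k^2 \<Rightarrow> 'k" where
  "dot2 a v = a$1 * v$1 + a$2 * v$2"

definition det2 :: "'k::field^2 \<Rightarrow> 'k^2 \<Rightarrow> 'k" where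
  "det2 u v = u$1 * v$2 - u$2 * v$1"

lemma dot2_simps:
  "dot2 a (v + w) = dot2 a v + dot2 a w" "dot2 a (c *s v) = c * dot2 a v"
  "dot2 a 0 = 0" "dot2 (a + b) v = dot2 a v + dot2 b v" "dot2 (c *s a) v = c * dot2 a v"
  by (auto simp: dot2_def algebra_simps)

lemma vec2_eq_iff: "u = v \<longleftrightarrow> u$1 = v$1 \<and> u$2 = v$2" for u v :: "'k^2"
  by (auto simp: vec_eq_iff forall_2)

lemma matrix_vector_axis: "m *v axis k 1 = column k m" for m :: "'c::comm_semiring_1^'n^'m"
  by (simp add: vec_eq_iff matrix_vector_mult_def axis_def column_def if_distrib cong: if_cong)

lemma self_module_simps [simp]:
  "carrier (self_module R) = carrier R" "x \<oplus>\<^bsub>self_module R\<^esub> y = x \<oplus>\<^bsub>R\<^esub> y"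
  "c \<odot>\<^bsub>self_module R\<^esub> x = c \<otimes>\<^bsub>R\<^esub> x"
  by (auto simp: self_module_def)

lemma dual_simps:
  "carrier (dual R M) = linear_maps R M (self_module R)"
  "f \<oplus>\<^bsub>dual R M\<^esub> g = (\<lambda>x\<in>carrier M. f x \<oplus>\<^bsub>R\<^esub> g x)"
  "c \<odot>\<^bsub>dual R M\<^esub> f = (\<lambda>x\<in>carrier M. c \<otimes>\<^bsub>R\<^esub> f x)"
  by (auto simp: dual_def hom_module_def self_module_def)

lemma vec_module_simps [simp]:
  "carrier (vec_module L) = L" "x \<oplus>\<^bsub>vec_module L\<^esub> y = x + y"
  "c \<odot>\<^bsub>vec_module L\<^esub> x = c *s x" "\<zero>\<^bsub>vec_module L\<^esub> = 0"
  by (auto simp: vec_module_def)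

lemma linear_maps_comp:
  assumes "f \<in> linear_maps R M N" "g \<in> linear_maps R N N'"
    and closed: "\<And>x y. x \<in> carrier M \<Longrightarrow> y \<in> carrier M \<Longrightarrow> x \<oplus>\<^bsub>M\<^esub> y \<in> carrier M"
      "\<And>c x. c \<in> carrier R \<Longrightarrow> x \<in> carrier M \<Longrightarrow> c \<odot>\<^bsub>M\<^esub> x \<in> carrier M"
  shows "restrict (g \<circ> f) (carrier M) \<in> linear_maps R M N'"
proof -
  have "f x \<in> carrier N" if "x \<in> carrier M" for x using assms(1) that by (auto simp: linear_maps_def PiE_def)
  then show ?thesis using assms unfolding linear_maps_def by (auto simp: PiE_iff Pi_iff)
qed

lemma module_iso_trans:
  assumes "module_iso R M N" "module_iso R N N'"
    and "\<And>x y. x \<in> carrier M \<Longrightarrow> y \<in> carrier M \<Longrightarrow> x \<oplus>\<^bsub>M\<^esub> y \<in> carrier M"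
      "\<And>c x. c \<in> carrier R \<Longrightarrow> x \<in> carrier M \<Longrightarrow> c \<odot>\<^bsub>M\<^esub> x \<in> carrier M"
  shows "module_iso R M N'"
proof -
  obtain f g where f: "f \<in> linear_maps R M N" "bij_betw f (carrier M) (carrier N)"
    and g: "g \<in> linear_maps R N N'" "bij_betw g (carrier N) (carrier N')"
    using assms(1,2) by (auto simp: module_iso_def)
  have "bij_betw (restrict (g \<circ> f) (carrier M)) (carrier M) (carrier N')"
    using bij_betw_trans[OF f(2) g(2)] by (simp add: bij_betw_restrict_eq)
  then show ?thesis
    using linear_maps_comp[OF f(1) g(1) assms(3,4)] unfolding module_iso_def by blast
qed

section \<open>Denominators and values at a prime\<close>

context normal_field_over
begin

lemma common_denominator:
  assumes "finite Y"
  obtains d where "integral d" "d \<noteq> 0" "\<And>x. x \<in> Y \<Longrightarrow> integral (d * x)"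
  using assms
proof (induction Y arbitrary: thesis rule: finite_induct)
  case empty
  then show ?case using integral_1 by force
next
  case (insert x Y)
  obtain d where d: "integral d" "d \<noteq> 0" "\<And>x. x \<in> Y \<Longrightarrow> integral (d * x)" using insert.IH by blast
  obtain r where r: "r \<noteq> 0" "integral (\<rho> r * x)" using fraction by blast
  show ?case
  proof (rule insert.prems[of "\<rho> r * d"])
    show "\<rho> r * d \<noteq> 0" using d r hom_eq_0D[of r] by auto
    fix y assume "y \<in> insert x Y"
    then show "integral (\<rho> r * d * y)"
    proof
      assume "y = x"
      then show ?thesis using integral_mult[OF d(1) r(2)] by (simp add: mult_ac)
    next
      assume "y \<in> Y"
      then show ?thesis using integral_mult[OF integral_hom[of r] d(3)[of y]] by (simp add: mult_ac)
    qed
  qed (use d integral_hom integral_mult in auto)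
qed

lemma local_denominator:
  assumes p: "is_prime p" and "finite Y" and "\<And>x. x \<in> Y \<Longrightarrow> \<exists>s. integral s \<and> s \<notin> p \<and> integral (s * x)"
  obtains s where "integral s" "s \<notin> p" "\<And>x. x \<in> Y \<Longrightarrow> integral (s * x)"
  using assms(2,3)
proof (induction Y arbitrary: thesis rule: finite_induct)
  case empty
  then show ?case using integral_1 p by (force simp: is_prime_def)
next
  case (insert x Y)
  obtain s where s: "integral s" "s \<notin> p" "\<And>x. x \<in> Y \<Longrightarrow> integral (s * x)"
    using insert.IH insert.prems(2) by blast
  obtain t where t: "integral t" "t \<notin> p" "integral (t * x)" using insert.prems(2) by blast
  show ?case
  proof (rule insert.prems(1)[of "t * s"])
    show "t * s \<notin> p" using is_prime_multD[OF p t(1) s(1)] t s by blast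
    fix y assume "y \<in> insert x Y"
    then show "integral (t * s * y)"
    proof
      assume "y = x"
      then show ?thesis using integral_mult[OF s(1) t(3)] by (simp add: mult_ac)
    next
      assume "y \<in> Y"
      then show ?thesis using integral_mult[OF t(1) s(3)[of y]] by (simp add: mult_ac)
    qed
  qed (use s t integral_mult in auto)
qed

text \<open>By \<open>val\<close> the values at \<open>p\<close> are linearly ordered, so a finite
  set has a nonzero member of least value, which divides all others locally. In the induction,
  either the new \<open>x\<close> is a local multiple of \<open>x0\<close>, or \<open>x0\<close> is
  one of \<open>x\<close> and the rest follows by transitivity.\<close>

lemma local_minimal_value:
  assumes p: "is_prime p"
    and val: "\<And>u. \<exists>s. integral s \<and> s \<notin> p \<and> (integral (s * u) \<or> integral (s / u))"
    and "finite Y" "\<exists>x\<in>Y. x \<noteq> 0"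
  shows "\<exists>x0\<in>Y. x0 \<noteq> 0 \<and> (\<forall>x\<in>Y. \<exists>s. integral s \<and> s \<notin> p \<and> integral (s * (x / x0)))"
  using assms(3,4)
proof (induction Y rule: finite_induct)
  case (insert x Y)
  have one: "integral 1" "1 \<notin> p" using p integral_1 by (auto simp: is_prime_def)
  show ?case
  proof (cases "\<exists>x\<in>Y. x \<noteq> 0")
    case False
    then have "x \<noteq> 0" using insert.prems by auto
    moreover have "integral (1 * (y / x))" if "y \<in> insert x Y" for y
      using that False \<open>x \<noteq> 0\<close> by (auto simp: integral_0 integral_1)
    ultimately show ?thesis using one by (intro bexI[of _ x]) auto
  next
    case True
    then obtain x0 where x0: "x0 \<in> Y" "x0 \<noteq> 0"
      and le: "\<And>y. y \<in> Y \<Longrightarrow> \<exists>s. integral s \<and> s \<notin> p \<and> integral (s * (y / x0))"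
      using insert.IH by blast
    obtain s where s: "integral s" "s \<notin> p" "integral (s * (x / x0)) \<or> integral (s / (x / x0))"
      using val by blast
    show ?thesis
    \<comment> \<open>For \<open>x = 0\<close> the second alternative for \<open>s\<close> says
      nothing, because division by \<open>0\<close> gives \<open>0\<close>; hence the separate
      treatment.\<close>
    proof (cases "x = 0 \<or> integral (s * (x / x0))")
      case True
      then have "integral (s * (x / x0))" by (auto simp: integral_0)
      then show ?thesis using x0 le s by (intro bexI[of _ x0]) auto
    next
      case False
      then have inv: "integral (s * (x0 / x))" "x \<noteq> 0" using s(3) by auto
      have "\<exists>t. integral t \<and> t \<notin> p \<and> integral (t * (y / x))" if y: "y \<in> insert x Y" for y
      proof (cases "y = x")
        case True
        then show ?thesis using one inv(2) by (intro exI[of _ 1]) simp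
      next
        case False
        then obtain t where t: "integral t" "t \<notin> p" "integral (t * (y / x0))" using le y by blast
        have "integral ((t * (y / x0)) * (s * (x0 / x)))" by (rule integral_mult[OF t(3) inv(1)])
        also have "(t * (y / x0)) * (s * (x0 / x)) = (t * s) * (y / x)" using x0 by simp
        finally show ?thesis
          using t s is_prime_multD[OF p t(1) s(1)] integral_mult[OF t(1) s(1)] by blast
      qed
      then show ?thesis using inv(2) by (intro bexI[of _ x]) auto
    qed
  qed
qed simp

section \<open>Reflexivity of plane lattices of depth two\<close>

definition is_lattice :: "('k^'n) set \<Rightarrow> bool" where
  "is_lattice L \<longleftrightarrow> 0 \<in> L \<and> (\<forall>u\<in>L. \<forall>v\<in>L. u + v \<in> L) \<and> (\<forall>c. \<forall>v\<in>L. integral c \<longrightarrow> c *s v \<in> L)"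

lemma is_latticeD:
  assumes "is_lattice L"
  shows "0 \<in> L" "u \<in> L \<Longrightarrow> v \<in> L \<Longrightarrow> u + v \<in> L" "integral c \<Longrightarrow> v \<in> L \<Longrightarrow> c *s v \<in> L"
  using assms by (auto simp: is_lattice_def)

lemma column_lattice_lattice: "is_lattice (column_lattice B m)"
  unfolding is_lattice_def
proof (intro conjI ballI allI impI)
  show "0 \<in> column_lattice B m"
    unfolding column_lattice_def by (auto intro!: exI[of _ 0] simp: integral_0)
  fix u assume "u \<in> column_lattice B m"
  then obtain b where b: "u = m *v b" "\<forall>j. integral (b$j)" by (auto simp: column_lattice_def)
  { fix v assume "v \<in> column_lattice B m"
    then obtain b' where "v = m *v b'" "\<forall>j. integral (b'$j)" by (auto simp: column_lattice_def)
    then show "u + v \<in> column_lattice B m" using b unfolding column_lattice_def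
      by (auto intro!: exI[of _ "b + b'"] simp: matrix_vector_right_distrib integral_add) }
  fix c assume "integral c"
  then show "c *s u \<in> column_lattice B m" using b unfolding column_lattice_def
    by (auto intro!: exI[of _ "c *s b"] simp: vector_scalar_commute integral_mult)
qed

lemma column_in_lattice: "column k m \<in> column_lattice B m"
  unfolding column_lattice_def matrix_vector_axis[symmetric]
  by (intro CollectI exI[of _ "axis k 1"] conjI refl) (simp add: axis_def integral_0 integral_1)

lemma column_lattice_in:
  assumes "\<And>j. column j m \<in> L'" "\<And>w w'. w \<in> L' \<Longrightarrow> w' \<in> L' \<Longrightarrow> w + w' \<in> L'"
    "\<And>c w. integral c \<Longrightarrow> w \<in> L' \<Longrightarrow> c *s w \<in> L'" "0 \<in> L'" "v \<in> column_lattice B m"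
  shows "v \<in> L'"
proof -
  obtain b where b: "v = m *v b" "\<And>j. integral (b$j)" using assms(5) by (auto simp: column_lattice_def)
  have "v = (\<Sum>j\<in>UNIV. b$j *s column j m)" unfolding b(1) by (rule matrix_mult_sum)
  moreover have "(\<Sum>j\<in>J. b$j *s column j m) \<in> L'" for J
    by (induction J rule: infinite_finite_induct) (use assms(1-4) b(2) in auto)
  ultimately show ?thesis by simp
qed

text \<open>Over a prime contracting to a principal prime, a basis of the localization of the lattice is
  given by two columns whose minor has least valuation.\<close>

lemma double_dual_locally_in:
  fixes m :: "'k^'n^2"
  assumes p: "is_prime p"
    and val: "\<And>u. \<exists>s. integral s \<and> s \<notin> p \<and> (integral (s * u) \<or> integral (s / u))"
    and nondeg: "det2 (column k0 m) (column l0 m) \<noteq> 0"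
    and v: "\<And>a. (\<And>w. w \<in> column_lattice B m \<Longrightarrow> integral (dot2 a w)) \<Longrightarrow> integral (dot2 a v)"
  obtains s where "integral s" "s \<notin> p" "s *s v \<in> column_lattice B m"
proof -
  let ?L = "column_lattice B m"
  let ?X = "(\<lambda>(k, l). det2 (column k m) (column l m)) ` UNIV"
  have "\<exists>x\<in>?X. x \<noteq> 0" by (rule bexI[of _ "det2 (column k0 m) (column l0 m)"])
      (use nondeg in \<open>auto intro!: image_eqI[of _ _ "(k0, l0)"]\<close>)
  from local_minimal_value[OF p val finite_imageI[OF finite] this]
  obtain \<Delta> where \<Delta>: "\<Delta> \<in> ?X" "\<Delta> \<noteq> 0"
    and min: "\<forall>x\<in>?X. \<exists>s. integral s \<and> s \<notin> p \<and> integral (s * (x / \<Delta>))"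
    by (elim bexE conjE) iprover
  then obtain k l where \<Delta>_def: "\<Delta> = det2 (column k m) (column l m)"
    and kl: "det2 (column k m) (column l m) \<noteq> 0" by auto
  have loc: "\<exists>s. integral s \<and> s \<notin> p \<and> integral (s * x)" if x: "x \<in> (\<lambda>x. x / \<Delta>) ` ?X" for x
  proof -
    obtain y where "x = y / \<Delta>" "y \<in> ?X" using x by (rule imageE)
    then show ?thesis using bspec[OF min] by simp
  qed
  have fin: "finite ((\<lambda>x. x / \<Delta>) ` ?X)" by simp
  \<comment> \<open>A single multiplier for the quotients of all minors by \<Delta>.\<close>
  obtain s where s: "integral s" "s \<notin> p" "\<And>x. x \<in> (\<lambda>x. x / \<Delta>) ` ?X \<Longrightarrow> integral (s * x)"
    by (rule local_denominator[OF p fin loc]) (assumption, (rule that; blast))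
  have s': "integral (s * (det2 (column i m) (column j m) / \<Delta>))" for i j
    by (rule s(3), rule imageI, rule image_eqI[of _ _ "(i, j)"]) auto
  \<comment> \<open>Cramer's rule: \<open>dot2 a w\<close> and \<open>dot2 b w\<close> are
    \<open>s\<close> times the coordinates of \<open>w\<close> with respect to columns
    \<open>k\<close> and \<open>l\<close>. On the columns of \<open>m\<close> they are integral by
    the choice of \<Delta>, so both functionals belong to the dual of the lattice.\<close>
  define a b where "a = (vector [s * column l m $ 2 / \<Delta>, - (s * column l m $ 1 / \<Delta>)] :: 'k^2)"
    and "b = (vector [- (s * column k m $ 2 / \<Delta>), s * column k m $ 1 / \<Delta>] :: 'k^2)"
  have a: "dot2 a w = s * (det2 w (column l m) / \<Delta>)" and b: "dot2 b w = s * (det2 (column k m) w / \<Delta>)" for w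
    by (auto simp: a_def b_def dot2_def det2_def diff_divide_distrib algebra_simps)
  have int: "integral (dot2 c w)" if c: "c = a \<or> c = b" and w: "w \<in> ?L" for c w
  proof -
    have "integral (dot2 c (column j m))" for j using c s' a b by auto
    then have "w \<in> {w. integral (dot2 c w)}"
      by (intro column_lattice_in[OF _ _ _ _ w]) (auto simp: dot2_simps integral_add integral_mult integral_0)
    then show ?thesis by simp
  qed
  have "s *s v = dot2 a v *s column k m + dot2 b v *s column l m"
  proof -
    have "\<Delta> * v$i = det2 v (column l m) * column k m $ i + det2 (column k m) v * column l m $ i" for i
      using exhaust_2[of i] by (auto simp: \<Delta>_def det2_def algebra_simps)
    then have "v$i = (det2 v (column l m) * column k m $ i + det2 (column k m) v * column l m $ i) / \<Delta>" for i
      using kl by (metis \<Delta>_def nonzero_mult_div_cancel_left)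
    then show ?thesis
      unfolding vec_eq_iff a b by (simp add: add_divide_distrib algebra_simps)
  qed
  moreover have "integral (dot2 a v)" "integral (dot2 b v)" using v int by blast+
  ultimately have "s *s v \<in> ?L"
    using is_latticeD[OF column_lattice_lattice] column_in_lattice by metis
  then show ?thesis using s that by blast
qed

text \<open>Let \<open>r\<close> and \<open>t\<close> be the first two entries. In the localization
  \<open>t (r w) = r (t w)\<close> lies in \<open>r L\<close>; as \<open>t\<close> is regular modulo
  \<open>r\<close>, the vector \<open>r w\<close> lies in \<open>r L\<close> too, and
  \<open>r\<close> cancels.\<close>

lemma regular_pair_saturated:
  fixes L :: "('k^'n) set"
  assumes L: "is_lattice L" and p: "is_prime p" and w0: "w0 \<in> L" "w0 \<noteq> 0"
    and reg: "local_regular_sequence B (vec_module L) p rs" and len: "length rs \<ge> 2"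
    and w: "\<exists>s. integral s \<and> s \<notin> p \<and> s *s ((rs!0) *s w) \<in> L" "\<exists>s. integral s \<and> s \<notin> p \<and> s *s ((rs!1) *s w) \<in> L"
  shows "\<exists>s. integral s \<and> s \<notin> p \<and> s *s w \<in> L"
proof -
  let ?r = "rs!0" and ?t = "rs!1"
  have p0: "0 \<in> p" using p by (auto simp: is_prime_def is_ideal_def)
  have one: "integral 1" "1 \<notin> p" using p integral_1 by (auto simp: is_prime_def)
  have "set rs \<subseteq> p" using reg by (simp add: local_regular_sequence_def)
  moreover have "?r \<in> set rs" "?t \<in> set rs" using len by (auto intro!: nth_mem)
  ultimately have in_p: "?r \<in> p" "?t \<in> p" by blast+
  then have int: "integral ?r" "integral ?t" using p by (auto simp: is_prime_def is_ideal_def)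
  have regD: "\<And>i x. i < length rs \<Longrightarrow> x \<in> L \<Longrightarrow>
        (rs!i) *s x \<in> locally_in B (vec_module L) p (multiples (vec_module L) (take i rs)) \<Longrightarrow>
        x \<in> locally_in B (vec_module L) p (multiples (vec_module L) (take i rs))"
    using reg by (auto simp: local_regular_sequence_def)
  \<comment> \<open>If \<open>r\<close> were zero, its regularity would make the nonzero vector
    \<open>w0\<close> locally zero.\<close>
  have r0: "?r \<noteq> 0"
  proof
    assume "?r = 0"
    then have "?r *s w0 \<in> locally_in B (vec_module L) p {0}"
      using one is_latticeD(1)[OF L] unfolding locally_in_def by (auto intro!: bexI[of _ 1])
    moreover have "0 < length rs" using len by linarith
    ultimately have "w0 \<in> locally_in B (vec_module L) p {0}"
      using regD[of 0 w0] w0(1) by simp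
    then show False using w0 p0 by (auto simp: locally_in_def)
  qed
  have take1: "take 1 rs = [?r]" using len by (cases rs) auto
  obtain s1 s2 where s: "integral s1" "s1 \<notin> p" "s1 *s (?r *s w) \<in> L" "integral s2" "s2 \<notin> p" "s2 *s (?t *s w) \<in> L"
    using w by blast
  \<comment> \<open>The product of the two multipliers brings both vectors into \<open>L\<close>
    itself.\<close>
  define x y where "x = (s1 * s2) *s (?r *s w)" and "y = (s1 * s2) *s (?t *s w)"
  have xy: "x \<in> L" "y \<in> L"
    using is_latticeD(3)[OF L s(4,3)] is_latticeD(3)[OF L s(1,6)] by (auto simp: x_def y_def mult_ac)
  have eq: "?t *s x = ?r *s y + 0" by (simp add: x_def y_def mult_ac)
  have "?t *s x \<in> multiples (vec_module L) [?r]" using xy eq by auto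
  moreover have "?t *s x \<in> L" using is_latticeD(3)[OF L int(2) xy(1)] .
  ultimately have "?t *s x \<in> locally_in B (vec_module L) p (multiples (vec_module L) (take 1 rs))"
    unfolding take1 locally_in_def using one by (auto intro!: bexI[of _ 1])
  then have "x \<in> locally_in B (vec_module L) p (multiples (vec_module L) [?r])"
    using regD[of 1 x] xy len take1 by auto
  then obtain t z where t: "integral t" "t \<notin> p" "t *s x = ?r *s z" "z \<in> L" by (auto simp: locally_in_def)
  have "?r *s ((t * (s1 * s2)) *s w) = ?r *s z" using t(3) by (simp add: x_def mult_ac)
  then have "(t * (s1 * s2)) *s w = z" using r0 by (simp add: vec_eq_iff mult.assoc)
  moreover have "integral (t * (s1 * s2))" using s t by (simp add: integral_mult)
  moreover have "s1 * s2 \<notin> p" using is_prime_multD[OF p s(1,4)] s by blast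
  then have "t * (s1 * s2) \<notin> p"
    using is_prime_multD[OF p t(1) integral_mult[OF s(1,4)]] t by blast
  ultimately show ?thesis using t(4) by blast
qed

text \<open>The assumption on \<open>v\<close> says that \<open>v\<close> belongs to the bidual of
  \<open>L\<close>, viewed in the plane.\<close>

theorem lattice_reflexive:
  fixes m :: "'k^'n^2"
  defines "L \<equiv> column_lattice B m"
  assumes depth: "\<And>p. primeideal p B \<Longrightarrow> height B p \<ge> 2 \<Longrightarrow>
        \<exists>rs. local_regular_sequence B (vec_module L) p rs \<and> length rs \<ge> 2"
    and nondeg: "det2 (column k0 m) (column l0 m) \<noteq> 0"
    and v: "\<And>a. (\<And>w. w \<in> L \<Longrightarrow> integral (dot2 a w)) \<Longrightarrow> integral (dot2 a v)"
  shows "v \<in> L"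
proof (rule ccontr)
  assume "v \<notin> L"
  have L: "is_lattice L" unfolding L_def by (rule column_lattice_lattice)
  let ?I = "{c. integral c \<and> c *s v \<in> L}"
  have "is_ideal ?I"
    unfolding is_ideal_def
  proof (intro conjI ballI allI impI)
    show "0 \<in> ?I" using is_latticeD(1)[OF L] by (simp add: integral_0)
    fix x assume x: "x \<in> ?I"
    show "x + y \<in> ?I" if "y \<in> ?I" for y
      using x that is_latticeD(2)[OF L] by (simp add: vector_sadd_rdistrib integral_add)
    show "c * x \<in> ?I" if "integral c" for c
      using x that is_latticeD(3)[OF L that, of "x *s v"] by (simp add: integral_mult)
  qed auto
  moreover have "1 \<notin> ?I" using \<open>v \<notin> L\<close> by simp
  ultimately obtain p where p: "is_prime p" "?I \<subseteq> p"
    and nil: "\<And>r. r \<in> p \<Longrightarrow> \<exists>N s. integral s \<and> s \<notin> p \<and> s * r ^ N \<in> ?I"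
    by (rule exists_minimal_prime) blast
  have not_loc: "\<not> (\<exists>s. integral s \<and> s \<notin> p \<and> s *s v \<in> L)" using p(2) by auto
  from p(1) show False
  proof (cases rule: prime_contraction_cases)
    case (principal \<pi>)
    obtain s where "integral s" "s \<notin> p" "s *s v \<in> L"
      unfolding L_def
      by (rule double_dual_locally_in[OF p(1) local_valuation[OF p(1) principal] nondeg v[unfolded L_def]])
    then show False using not_loc by blast
  next
    case (big \<pi> x)
    then have "height B p \<ge> 2" by (intro height_ge_2[OF p(1)])
    then obtain rs where rs: "local_regular_sequence B (vec_module L) p rs" "length rs \<ge> 2"
      using depth p(1) primeideal_iff by blast
    have "set rs \<subseteq> p" using rs by (simp add: local_regular_sequence_def)
    moreover have "rs!0 \<in> set rs" "rs!1 \<in> set rs" using rs(2) by (auto intro!: nth_mem)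
    ultimately have in_p: "rs!0 \<in> p" "rs!1 \<in> p" by blast+
    have w0: "column k0 m \<in> L" "column k0 m \<noteq> 0"
      using nondeg column_in_lattice by (auto simp: det2_def L_def)
    define loc where "loc w \<longleftrightarrow> (\<exists>s. integral s \<and> s \<notin> p \<and> s *s w \<in> L)" for w
    have mult_loc: "loc (c *s w)" if w: "loc w" and c: "integral c" for c w
    proof -
      obtain s where s: "integral s" "s \<notin> p" "s *s w \<in> L" using w by (auto simp: loc_def)
      have "c *s (s *s w) \<in> L" using is_latticeD(3)[OF L c s(3)] .
      then show ?thesis using s unfolding loc_def by (auto intro!: exI[of _ s] simp: mult.commute)
    qed
    obtain N M where N: "loc ((rs!0) ^ N *s v)" "loc ((rs!1) ^ M *s v)"
      using nil[OF in_p(1)] nil[OF in_p(2)] by (auto simp: loc_def)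
    have int: "integral (rs!0)" "integral (rs!1)" using in_p p(1) by (auto simp: is_prime_def is_ideal_def)
    \<comment> \<open>Descending induction from the exponents \<open>N\<close> and \<open>M\<close>:
      if raising either exponent by one gives a vector that is locally in \<open>L\<close>, then
      \<open>regular_pair_saturated\<close> applies to the vector before raising. The exponents
      \<open>0\<close> and \<open>0\<close> give \<open>v\<close>.\<close>
    have "loc (((rs!0) ^ i * (rs!1) ^ j) *s v)" for i j
    proof (induction "(N - i) + (M - j)" arbitrary: i j rule: less_induct)
      case less
      show ?case
      proof (cases "i \<ge> N \<or> j \<ge> M")
        case True
        then show ?thesis
        proof
          assume "i \<ge> N"
          then have eq: "(rs!0) ^ i * (rs!1) ^ j = (rs!1) ^ j * (rs!0) ^ (i - N) * (rs!0) ^ N"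
            by (simp flip: power_add add: mult_ac)
          show ?thesis unfolding eq
            using mult_loc[OF N(1), of "(rs!1) ^ j * (rs!0) ^ (i - N)"] int
            by (simp add: integral_mult integral_power)
        next
          assume "j \<ge> M"
          then have eq: "(rs!0) ^ i * (rs!1) ^ j = (rs!0) ^ i * (rs!1) ^ (j - M) * (rs!1) ^ M"
            by (simp flip: power_add add: mult_ac)
          show ?thesis unfolding eq
            using mult_loc[OF N(2), of "(rs!0) ^ i * (rs!1) ^ (j - M)"] int
            by (simp add: integral_mult integral_power)
        qed
      next
        case False
        have "loc (((rs!0) ^ Suc i * (rs!1) ^ j) *s v)" "loc (((rs!0) ^ i * (rs!1) ^ Suc j) *s v)"
          using False by (intro less.hyps; arith)+
        then have "loc ((rs!0) *s (((rs!0) ^ i * (rs!1) ^ j) *s v))" "loc ((rs!1) *s (((rs!0) ^ i * (rs!1) ^ j) *s v))"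
          by (simp_all add: mult.assoc mult.left_commute)
        then show ?thesis unfolding loc_def by (rule regular_pair_saturated[OF L p(1) w0 rs])
      qed
    qed
    from this[of 0 0] show False using not_loc by (simp add: loc_def)
  qed
qed

text \<open>Depth passes from \<open>U\<close> to the lattice because an isomorphism matches
  \<open>multiples\<close> with \<open>multiples\<close> and \<open>locally_in\<close> with
  \<open>locally_in\<close>.\<close>

lemma regular_sequence_iso:
  fixes L :: "('k^'n) set" and U :: "('k, 'u) module"
  assumes L: "is_lattice L" and U: "Module.module B U" and p: "is_prime p"
    and f: "f \<in> linear_maps B (vec_module L) U" "bij_betw f L (carrier U)"
    and reg: "local_regular_sequence B U p rs"
  shows "local_regular_sequence B (vec_module L) p rs"
proof -
  interpret U: Module.module B U by (rule U)
  have f_car: "f x \<in> carrier U" if "x \<in> L" for x using f(2) that by (auto simp: bij_betw_def)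
  have f_add: "f (x + y) = f x \<oplus>\<^bsub>U\<^esub> f y" if "x \<in> L" "y \<in> L" for x y
    using f(1) that by (auto simp: linear_maps_def)
  have f_smult: "f (c *s x) = c \<odot>\<^bsub>U\<^esub> f x" if "x \<in> L" "integral c" for c x
    using f(1) that by (auto simp: linear_maps_def)
  have inj: "inj_on f L" and im: "f ` L = carrier U" using f(2) by (auto simp: bij_betw_def)
  have f0: "f 0 = \<zero>\<^bsub>U\<^esub>"
  proof -
    have "f 0 \<oplus>\<^bsub>U\<^esub> f 0 = f 0" using f_add[of 0 0] is_latticeD(1)[OF L] by simp
    then show ?thesis using f_car[OF is_latticeD(1)[OF L]] U.add.r_cancel_one' by metis
  qed
  have mult: "multiples (vec_module L) qs \<subseteq> L \<and> multiples U qs = f ` multiples (vec_module L) qs"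
    if "set qs \<subseteq> {x. integral x}" for qs
    using that
  proof (induction qs)
    case Nil
    then show ?case using is_latticeD(1)[OF L] f0 by simp
  next
    case (Cons r qs)
    let ?N = "multiples (vec_module L) qs"
    have IH: "?N \<subseteq> L" "multiples U qs = f ` ?N" using Cons by auto
    have r: "integral r" using Cons.prems by simp
    have f_rule: "f (r *s x + y) = (r \<odot>\<^bsub>U\<^esub> f x) \<oplus>\<^bsub>U\<^esub> f y" if "x \<in> L" "y \<in> ?N" for x y
      using f_add[of "r *s x" y] f_smult[OF that(1) r] is_latticeD(3)[OF L r that(1)] IH(1) that by auto
    have "multiples U (r # qs) = {(r \<odot>\<^bsub>U\<^esub> f x) \<oplus>\<^bsub>U\<^esub> f y | x y. x \<in> L \<and> y \<in> ?N}"
      using IH(2) by (auto simp flip: im)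
    also have "\<dots> = f ` multiples (vec_module L) (r # qs)"
      by (auto simp: image_iff) (metis f_rule)+
    finally show ?case using IH(1) is_latticeD[OF L] r by auto
  qed
  have loc: "x \<in> locally_in B (vec_module L) p (multiples (vec_module L) qs)
      \<longleftrightarrow> f x \<in> locally_in B U p (multiples U qs)" if x: "x \<in> L" and qs: "set qs \<subseteq> {x. integral x}" for x qs
  proof -
    have "s *s x \<in> multiples (vec_module L) qs \<longleftrightarrow> s \<odot>\<^bsub>U\<^esub> f x \<in> multiples U qs" if "integral s" for s
      using mult[OF qs] inj_on_image_mem_iff[OF inj is_latticeD(3)[OF L that x]] f_smult[OF x that] by metis
    then show ?thesis using x f_car by (auto simp: locally_in_def)
  qed
  have rs: "set rs \<subseteq> p" and rs_int: "set rs \<subseteq> {x. integral x}"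
    using reg p by (auto simp: local_regular_sequence_def is_prime_def is_ideal_def)
  have take_int: "set (take i rs) \<subseteq> {x. integral x}" for i using rs_int set_take_subset[of i rs] by blast
  show ?thesis
    unfolding local_regular_sequence_def
  proof (intro conjI allI impI ballI)
    show "set rs \<subseteq> p" by (rule rs)
    fix i x assume i: "i < length rs" and x: "x \<in> carrier (vec_module L)"
      and h: "rs ! i \<odot>\<^bsub>vec_module L\<^esub> x \<in> locally_in B (vec_module L) p (multiples (vec_module L) (take i rs))"
    have xL: "x \<in> L" using x by simp
    have ri: "integral (rs ! i)" using rs_int i by (auto simp: subset_iff)
    have "rs ! i \<odot>\<^bsub>U\<^esub> f x \<in> locally_in B U p (multiples U (take i rs))"
      using h loc[OF is_latticeD(3)[OF L ri xL] take_int] f_smult[OF xL ri] by simp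
    then have "f x \<in> locally_in B U p (multiples U (take i rs))"
      using reg i f_car[OF xL] by (auto simp: local_regular_sequence_def)
    then show "x \<in> locally_in B (vec_module L) p (multiples (vec_module L) (take i rs))"
      using loc[OF xL take_int] by blast
  next
    show "locally_in B (vec_module L) p (multiples (vec_module L) rs) \<noteq> carrier (vec_module L)"
    proof
      assume all: "locally_in B (vec_module L) p (multiples (vec_module L) rs) = carrier (vec_module L)"
      have "carrier U \<subseteq> locally_in B U p (multiples U rs)"
        using loc[OF _ rs_int] all im by (auto simp flip: im)
      moreover have "locally_in B U p (multiples U rs) \<subseteq> carrier U" by (auto simp: locally_in_def)
      ultimately show False using reg by (auto simp: local_regular_sequence_def)
    qed
  qed
qed

text \<open>The depth is a supremum of lengths, so it would be at most one if all regular sequences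
  had length at most one.\<close>

lemma maximal_CM_regular_pair:
  assumes "maximal_CM B U" "primeideal p B" "height B p \<ge> 2"
  shows "\<exists>rs. local_regular_sequence B U p rs \<and> length rs \<ge> 2"
proof (rule ccontr)
  assume none: "\<not> ?thesis"
  have "local_depth B U p \<le> 1"
    unfolding local_depth_def
  proof (rule Sup_least)
    fix x assume "x \<in> {enat (length rs) | rs. local_regular_sequence B U p rs}"
    then obtain rs where "x = enat (length rs)" "local_regular_sequence B U p rs" by blast
    moreover from this have "length rs \<le> 1" using none by (metis not_less_eq_eq One_nat_def Suc_1)
    ultimately show "x \<le> 1" by (simp add: one_enat_def)
  qed
  moreover have "local_depth B U p \<ge> 2" using assms by (simp add: maximal_CM_def)
  ultimately have "(2::enat) \<le> 1" by (rule order.trans[rotated])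
  then show False by (simp add: numeral_eq_enat one_enat_def)
qed

section \<open>Biduals of modules that map onto a lattice with torsion kernel\<close>

lemma dual_closed:
  assumes "\<And>x y. x \<in> carrier N \<Longrightarrow> y \<in> carrier N \<Longrightarrow> x \<oplus>\<^bsub>N\<^esub> y \<in> carrier N"
      "\<And>c x. integral c \<Longrightarrow> x \<in> carrier N \<Longrightarrow> c \<odot>\<^bsub>N\<^esub> x \<in> carrier N"
  shows "f \<in> carrier (dual B N) \<Longrightarrow> g \<in> carrier (dual B N) \<Longrightarrow> f \<oplus>\<^bsub>dual B N\<^esub> g \<in> carrier (dual B N)"
    "integral c \<Longrightarrow> f \<in> carrier (dual B N) \<Longrightarrow> c \<odot>\<^bsub>dual B N\<^esub> f \<in> carrier (dual B N)"
  using assms unfolding dual_simps linear_maps_def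
  by (auto simp: PiE_iff integral_add integral_mult algebra_simps)

text \<open>A functional into \<open>B\<close> cannot see torsion, so it factors through
  \<open>L\<close> and extends to the plane; this identifies the dual of \<open>N\<close> with the
  vectors \<open>a\<close> satisfying \<open>dl a\<close>. The same argument for that set of vectors
  turns a functional \<eta> on the dual into the pairing with a vector \<open>G \<eta>\<close>,
  which reflexivity puts into \<open>L\<close>. The constants \<open>c\<close> and \<open>d\<close>
  record that \<open>L\<close> lies between \<open>c B^2\<close> and
  \<open>d^-1 B^2\<close>.\<close>

theorem double_dual_iso:
  fixes N :: "('k, 'm) module" and L :: "('k^2) set"
  assumes closed: "\<And>x y. x \<in> carrier N \<Longrightarrow> y \<in> carrier N \<Longrightarrow> x \<oplus>\<^bsub>N\<^esub> y \<in> carrier N"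
      "\<And>c x. integral c \<Longrightarrow> x \<in> carrier N \<Longrightarrow> c \<odot>\<^bsub>N\<^esub> x \<in> carrier N"
    and \<phi>: "\<And>x y. x \<in> carrier N \<Longrightarrow> y \<in> carrier N \<Longrightarrow> \<phi> (x \<oplus>\<^bsub>N\<^esub> y) = \<phi> x + \<phi> y"
      "\<And>c x. integral c \<Longrightarrow> x \<in> carrier N \<Longrightarrow> \<phi> (c \<odot>\<^bsub>N\<^esub> x) = c *s \<phi> x"
      "\<phi> ` carrier N = L"
    and torsion: "\<And>x y. x \<in> carrier N \<Longrightarrow> y \<in> carrier N \<Longrightarrow> \<phi> x = \<phi> y \<Longrightarrow>
        \<exists>t. integral t \<and> t \<noteq> 0 \<and> t \<odot>\<^bsub>N\<^esub> x = t \<odot>\<^bsub>N\<^esub> y"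
    and c: "c \<noteq> 0" "integral c" "vector [c, 0] \<in> L" "vector [0, c] \<in> L"
    and d: "d \<noteq> 0" "integral d" "\<And>w. w \<in> L \<Longrightarrow> integral (d * w$1)" "\<And>w. w \<in> L \<Longrightarrow> integral (d * w$2)"
    and reflexive: "\<And>v. (\<And>a. (\<And>w. w \<in> L \<Longrightarrow> integral (dot2 a w)) \<Longrightarrow> integral (dot2 a v)) \<Longrightarrow> v \<in> L"
  shows "module_iso B (dual B (dual B N)) (vec_module L)"
proof -
  define \<psi> where "\<psi> a = (\<lambda>x\<in>carrier N. dot2 a (\<phi> x))" for a
  define dl where "dl a \<longleftrightarrow> (\<forall>w\<in>L. integral (dot2 a w))" for a
  have \<phi>L: "\<phi> x \<in> L" if "x \<in> carrier N" for x using \<phi>(3) that by blast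
  have \<psi>_dual: "\<psi> a \<in> carrier (dual B N)" if "dl a" for a
    using that closed \<phi> \<phi>L unfolding dual_simps linear_maps_def
    by (auto simp: \<psi>_def dl_def dot2_simps)
  have surj: "\<exists>a. dl a \<and> g = \<psi> a" if g: "g \<in> carrier (dual B N)" for g
  proof -
    have g_int: "integral (g x)" if "x \<in> carrier N" for x
      using g that by (auto simp: dual_simps linear_maps_def)
    have g_add: "g (x \<oplus>\<^bsub>N\<^esub> y) = g x + g y" if "x \<in> carrier N" "y \<in> carrier N" for x y
      using g that by (auto simp: dual_simps linear_maps_def)
    have g_smult: "g (c \<odot>\<^bsub>N\<^esub> x) = c * g x" if "x \<in> carrier N" "integral c" for x c
      using g that by (auto simp: dual_simps linear_maps_def)
    have g_cong: "g x = g y" if xy: "x \<in> carrier N" "y \<in> carrier N" "\<phi> x = \<phi> y" for x y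
    proof -
      obtain t where t: "integral t" "t \<noteq> 0" "t \<odot>\<^bsub>N\<^esub> x = t \<odot>\<^bsub>N\<^esub> y" using torsion[OF xy] by blast
      then have "t * g x = t * g y" using g_smult xy by metis
      then show ?thesis using t(2) by simp
    qed
    obtain x1 where x1: "x1 \<in> carrier N" "vector [c, 0] = \<phi> x1"
      using c(3) unfolding \<phi>(3)[symmetric] by (rule imageE)
    obtain x2 where x2: "x2 \<in> carrier N" "vector [0, c] = \<phi> x2"
      using c(4) unfolding \<phi>(3)[symmetric] by (rule imageE)
    note x = x1(1) x2(1) x1(2)[symmetric] x2(2)[symmetric]
    \<comment> \<open>The value of \<open>g\<close> at a preimage of \<open>c\<close> times a unit
      vector is \<open>c\<close> times the coordinate sought.\<close>
    define a where "a = (vector [g x1 / c, g x2 / c] :: 'k^2)"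
    have ga: "g x = dot2 a (\<phi> x)" if xN: "x \<in> carrier N" for x
    proof -
      define u where "u = \<phi> x"
      have u: "integral (d * u$1)" "integral (d * u$2)" using d \<phi>L[OF xN] by (auto simp: u_def)
      have cd: "integral (c * d)" using c d by (simp add: integral_mult)
      \<comment> \<open>This element and \<open>c * d\<close> times \<open>x\<close> have the same
        image in \<open>L\<close>, so \<open>g\<close> agrees on them.\<close>
      let ?y = "((d * u$1) \<odot>\<^bsub>N\<^esub> x1) \<oplus>\<^bsub>N\<^esub> ((d * u$2) \<odot>\<^bsub>N\<^esub> x2)"
      have y: "?y \<in> carrier N" using closed x u by auto
      have "\<phi> ?y = (d * u$1) *s vector [c, 0] + (d * u$2) *s vector [0, c]" using closed x u \<phi>(1,2) by simp
      also have "\<dots> = \<phi> ((c * d) \<odot>\<^bsub>N\<^esub> x)"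
        using \<phi>(2)[OF cd xN] by (simp add: vec2_eq_iff u_def)
      finally have "g ((c * d) \<odot>\<^bsub>N\<^esub> x) = g ?y"
        using g_cong y closed(2)[OF cd xN] by metis
      then have "(c * d) * g x = d * u$1 * g x1 + d * u$2 * g x2"
        using g_smult g_add closed x u xN cd by simp
      also have "\<dots> = (c * d) * dot2 a u" using c(1) by (simp add: a_def dot2_def field_simps)
      finally show ?thesis using c d by (simp add: u_def)
    qed
    have "dl a" unfolding dl_def using ga g_int \<phi>(3) by (metis imageE)
    moreover have "g = \<psi> a"
      using g ga by (intro extensionalityI[of g "carrier N"]) (auto simp: \<psi>_def dual_simps linear_maps_def PiE_def)
    ultimately show ?thesis by blast
  qed
  \<comment> \<open>The unit vectors times \<open>d\<close> belong to the dual of \<open>L\<close>,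
    and the values of \<eta> on them determine \<open>G \<eta>\<close>.\<close>
  define e1 e2 where "e1 = (vector [d, 0] :: 'k^2)" and "e2 = (vector [0, d] :: 'k^2)"
  have e: "dl e1" "dl e2" using d by (auto simp: dl_def e1_def e2_def dot2_def)
  define G where "G \<eta> = (vector [\<eta> (\<psi> e1) / d, \<eta> (\<psi> e2) / d] :: 'k^2)" for \<eta>
  let ?NN = "dual B (dual B N)"
  have G: "\<eta> (\<psi> a) = dot2 a (G \<eta>)" if \<eta>: "\<eta> \<in> carrier ?NN" and a: "dl a" for \<eta> a
  proof -
    have \<eta>_add: "\<eta> (f \<oplus>\<^bsub>dual B N\<^esub> g) = \<eta> f + \<eta> g" if "f \<in> carrier (dual B N)" "g \<in> carrier (dual B N)" for f g
      using \<eta> that unfolding dual_simps(1)[of B "dual B N"] linear_maps_def by auto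
    have \<eta>_smult: "\<eta> (c \<odot>\<^bsub>dual B N\<^esub> f) = c * \<eta> f" if "f \<in> carrier (dual B N)" "integral c" for f c
      using \<eta> that unfolding dual_simps(1)[of B "dual B N"] linear_maps_def by auto
    \<comment> \<open>With \<open>t\<close> clearing the denominators of \<open>a\<close>, the
      vector \<open>(t * d) *s a\<close> is a combination of \<open>e1\<close> and \<open>e2\<close>
      with integral coefficients, to which linearity of \<eta> applies.\<close>
    obtain t where t: "integral t" "t \<noteq> 0" "integral (t * a$1)" "integral (t * a$2)"
      by (rule common_denominator[of "{a$1, a$2}"]) (simp, (rule that; blast))
    have td: "integral (t * d)" using t d by (simp add: integral_mult)
    have dl1: "dl ((t * a$1) *s e1)" "dl ((t * a$2) *s e2)" "dl ((t * d) *s a)"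
      using t td a e by (auto simp: dl_def dot2_simps integral_mult)
    have s: "c \<odot>\<^bsub>dual B N\<^esub> \<psi> b = \<psi> (c *s b)" for c b
      by (auto simp: dual_simps \<psi>_def dot2_simps intro!: ext)
    have "(t * d) *s a = (t * a$1) *s e1 + (t * a$2) *s e2"
      by (simp add: vec2_eq_iff e1_def e2_def)
    then have "\<psi> ((t * d) *s a) = \<psi> ((t * a$1) *s e1) \<oplus>\<^bsub>dual B N\<^esub> \<psi> ((t * a$2) *s e2)"
      by (auto simp: dual_simps \<psi>_def dot2_simps intro!: ext)
    then have "(t * d) * \<eta> (\<psi> a) = (t * a$1) * \<eta> (\<psi> e1) + (t * a$2) * \<eta> (\<psi> e2)"
      using \<eta>_add[OF \<psi>_dual[OF dl1(1)] \<psi>_dual[OF dl1(2)]]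
        \<eta>_smult[OF \<psi>_dual[OF e(1)] t(3)] \<eta>_smult[OF \<psi>_dual[OF e(2)] t(4)] \<eta>_smult[OF \<psi>_dual[OF a] td]
      by (simp add: s)
    also have "\<dots> = (t * d) * dot2 a (G \<eta>)" using d(1) by (simp add: dot2_def G_def field_simps)
    finally show ?thesis using t d by simp
  qed
  have \<eta>_int: "integral (\<eta> g)" if "\<eta> \<in> carrier ?NN" "g \<in> carrier (dual B N)" for \<eta> g
    using that unfolding dual_simps(1)[of B "dual B N"] linear_maps_def by auto
  have GL: "G \<eta> \<in> L" if \<eta>: "\<eta> \<in> carrier ?NN" for \<eta>
  proof (rule reflexive)
    fix a assume "\<And>w. w \<in> L \<Longrightarrow> integral (dot2 a w)"
    then have "dl a" by (simp add: dl_def)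
    then show "integral (dot2 a (G \<eta>))" using G[OF \<eta>] \<eta>_int[OF \<eta> \<psi>_dual] by metis
  qed
  define H where "H = restrict G (carrier ?NN)"
  have "H \<in> linear_maps B ?NN (vec_module L)"
  proof -
    note NN_closed = dual_closed[of "dual B N", OF dual_closed[of N, OF closed]]
    have "G (f \<oplus>\<^bsub>?NN\<^esub> g) = G f + G g" for f g
      using \<psi>_dual e by (simp add: dual_simps(2)[of B "dual B N"] G_def vec2_eq_iff add_divide_distrib)
    moreover have "G (c \<odot>\<^bsub>?NN\<^esub> f) = c *s G f" for c f
      using \<psi>_dual e by (simp add: dual_simps(3)[of B "dual B N"] G_def vec2_eq_iff)
    ultimately show ?thesis
      unfolding linear_maps_def H_def using GL NN_closed by (auto simp: PiE_iff)
  qed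
  moreover have "bij_betw H (carrier ?NN) (carrier (vec_module L))"
  proof (rule bij_betw_imageI)
    show "inj_on H (carrier ?NN)"
    proof (rule inj_onI)
      fix \<eta> \<theta> assume h: "\<eta> \<in> carrier ?NN" "\<theta> \<in> carrier ?NN" "H \<eta> = H \<theta>"
      have "\<eta> g = \<theta> g" if "g \<in> carrier (dual B N)" for g
        using surj[OF that] G[OF h(1)] G[OF h(2)] h by (auto simp: H_def)
      moreover have "\<eta> \<in> extensional (carrier (dual B N))" "\<theta> \<in> extensional (carrier (dual B N))"
        using h(1,2) unfolding dual_simps(1)[of B "dual B N"] by (auto simp: linear_maps_def PiE_def)
      ultimately show "\<eta> = \<theta>" by (intro extensionalityI)
    qed
    show "H ` carrier ?NN = carrier (vec_module L)"
    proof
      show "H ` carrier ?NN \<subseteq> carrier (vec_module L)" using GL by (auto simp: H_def)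
      show "carrier (vec_module L) \<subseteq> H ` carrier ?NN"
      proof
        fix w assume "w \<in> carrier (vec_module L)"
        then obtain x where x: "x \<in> carrier N" "\<phi> x = w" using \<phi>(3) by auto
        \<comment> \<open>Evaluation at a preimage of \<open>w\<close>.\<close>
        define \<eta> where "\<eta> = (\<lambda>g\<in>carrier (dual B N). g x)"
        have "\<eta> \<in> carrier ?NN"
          unfolding dual_simps(1)[of B "dual B N"] linear_maps_def \<eta>_def
          using dual_closed[of N, OF closed] x(1)
          by (auto simp: dual_simps(2,3)) (auto simp: dual_simps(1) linear_maps_def)
        moreover have "\<eta> (\<psi> e1) = d * w$1" "\<eta> (\<psi> e2) = d * w$2"
          using \<psi>_dual[OF e(1)] \<psi>_dual[OF e(2)] x
          by (simp_all add: \<eta>_def) (simp_all add: \<psi>_def e1_def e2_def dot2_def)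
        ultimately have "\<eta> \<in> carrier ?NN" "H \<eta> = w"
          using d(1) by (simp_all add: H_def G_def vec2_eq_iff)
        then show "w \<in> H ` carrier ?NN" by blast
      qed
    qed
  qed
  ultimately show ?thesis unfolding module_iso_def by blast
qed

end

section \<open>Tensor products and base change\<close>

definition lin_ext :: "('x \<Rightarrow> 'k::field^'n) \<Rightarrow> ('x \<Rightarrow>\<^sub>0 int) \<Rightarrow> 'k^'n" where
  "lin_ext h f = (\<Sum>k\<in>Poly_Mapping.keys f. of_int (Poly_Mapping.lookup f k) *s h k)"

lemma lin_ext_superset:
  assumes "finite K" "Poly_Mapping.keys f \<subseteq> K"
  shows "lin_ext h f = (\<Sum>k\<in>K. of_int (Poly_Mapping.lookup f k) *s h k)"
  unfolding lin_ext_def using assms by (intro sum.mono_neutral_left) (auto simp: in_keys_iff)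

lemma lin_ext_add: "lin_ext h (f + g) = lin_ext h f + lin_ext h g"
proof -
  let ?K = "Poly_Mapping.keys f \<union> Poly_Mapping.keys g"
  have "lin_ext h (f + g) = (\<Sum>k\<in>?K. of_int (Poly_Mapping.lookup (f + g) k) *s h k)"
    using keys_add[of f g] by (intro lin_ext_superset) auto
  also have "\<dots> = lin_ext h f + lin_ext h g"
    using lin_ext_superset[of ?K f h] lin_ext_superset[of ?K g h]
    by (simp add: lookup_add vector_sadd_rdistrib sum.distrib)
  finally show ?thesis .
qed

lemma lin_ext_0 [simp]: "lin_ext h 0 = 0"
  by (simp add: lin_ext_def)

lemma lin_ext_minus: "lin_ext h (- f) = - lin_ext h f"
  using lin_ext_add[of h f "- f"] by (simp add: eq_neg_iff_add_eq_0 add.commute)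

lemma lin_ext_diff: "lin_ext h (f - g) = lin_ext h f - lin_ext h g"
  using lin_ext_add[of h f "- g"] by (simp add: lin_ext_minus)

lemma lin_ext_frag_of [simp]: "lin_ext h (frag_of a) = h a"
  by (simp add: lin_ext_def)

lemma lin_ext_sum: "lin_ext h (sum f I) = (\<Sum>i\<in>I. lin_ext h (f i))"
  by (induction I rule: infinite_finite_induct) (auto simp: lin_ext_add)

locale base_change = normal_field_over \<rho>
  for \<rho> :: "'r::{factorial_ring_gcd, semiring_Gcd, semiring_gcd_mult_normalize} \<Rightarrow> 'k::field" +
  fixes A :: "'a ring" and M :: "('a, 'm) module" and j :: "'a \<Rightarrow> 'k"
  assumes M_add: "x \<in> carrier M \<Longrightarrow> y \<in> carrier M \<Longrightarrow> x \<oplus>\<^bsub>M\<^esub> y \<in> carrier M"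
    and M_smult: "a \<in> carrier A \<Longrightarrow> x \<in> carrier M \<Longrightarrow> a \<odot>\<^bsub>M\<^esub> x \<in> carrier M"
    and j_integral: "a \<in> carrier A \<Longrightarrow> integral (j a)"
begin

abbreviation (input) "G \<equiv> free_Abelian_group (carrier M \<times> carrier B)"
abbreviation (input) "N \<equiv> tensor_relations A M B j"
abbreviation (input) "TB \<equiv> tensor_algebra A M B j"

definition relators :: "('m \<times> 'k \<Rightarrow>\<^sub>0 int) set" where
  "relators =
     {frag_of (x \<oplus>\<^bsub>M\<^esub> y, b) - frag_of (x, b) - frag_of (y, b) | x y b.
         x \<in> carrier M \<and> y \<in> carrier M \<and> integral b} \<union>
     {frag_of (x, b + b') - frag_of (x, b) - frag_of (x, b') | x b b'.
         x \<in> carrier M \<and> integral b \<and> integral b'} \<union>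
     {frag_of (a \<odot>\<^bsub>M\<^esub> x, b) - frag_of (x, j a * b) | a x b.
         a \<in> carrier A \<and> x \<in> carrier M \<and> integral b}"

lemma relations_eq: "N = generate G relators"
  by (simp add: tensor_relations_def relators_def)

lemma keys_frag_diff: "Poly_Mapping.keys f \<subseteq> K \<Longrightarrow> Poly_Mapping.keys g \<subseteq> K \<Longrightarrow> Poly_Mapping.keys (f - g) \<subseteq> K"
  using keys_diff[of f g] by auto

lemma keys_relator:
  assumes "r \<in> relators"
  shows "Poly_Mapping.keys r \<subseteq> carrier M \<times> carrier B"
  using assms unfolding relators_def
  by (elim UnE CollectE exE conjE; hypsubst; intro keys_frag_diff)
    (simp_all add: M_add M_smult j_integral integral_add integral_mult)

lemma relators_carrier: "relators \<subseteq> carrier G"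
  using keys_relator by (simp add: subset_iff)

lemma relations_subgroup: "subgroup N G"
  unfolding relations_eq by (rule group.generate_is_subgroup[OF group_free_Abelian_group relators_carrier])

lemma relations_0: "0 \<in> N"
  using subgroup.one_closed[OF relations_subgroup] by simp

lemma relations_add: "f \<in> N \<Longrightarrow> g \<in> N \<Longrightarrow> f + g \<in> N"
  using subgroup.m_closed[OF relations_subgroup, of f g] by simp

lemma relations_carrier: "f \<in> N \<Longrightarrow> Poly_Mapping.keys f \<subseteq> carrier M \<times> carrier B"
  using subsetD[OF subgroup.subset[OF relations_subgroup], of f] by (simp only: carrier_free_Abelian_group_iff)

lemma relations_minus: "f \<in> N \<Longrightarrow> - f \<in> N"
  using subgroup.m_inv_closed[OF relations_subgroup, of f] relations_carrier[of f] by simp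

lemma relations_diff: "f \<in> N \<Longrightarrow> g \<in> N \<Longrightarrow> f - g \<in> N"
  using relations_add[of f "- g"] relations_minus by simp

text \<open>Tensors are computed with on representatives, modulo the relations.\<close>

definition equiv :: "('m \<times> 'k \<Rightarrow>\<^sub>0 int) \<Rightarrow> ('m \<times> 'k \<Rightarrow>\<^sub>0 int) \<Rightarrow> bool" (infix "\<doteq>" 50) where
  "f \<doteq> g \<longleftrightarrow> f - g \<in> N"

lemma equiv_refl: "f \<doteq> f"
  by (simp add: equiv_def relations_0)

lemma equiv_sym: "f \<doteq> g \<Longrightarrow> g \<doteq> f"
  using relations_minus[of "f - g"] by (simp add: equiv_def)

lemma equiv_trans [trans]: "f \<doteq> g \<Longrightarrow> g \<doteq> h \<Longrightarrow> f \<doteq> h"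
  using relations_add[of "f - g" "g - h"] by (simp add: equiv_def)

lemma equiv_add: "f \<doteq> g \<Longrightarrow> f' \<doteq> g' \<Longrightarrow> f + f' \<doteq> g + g'"
  using relations_add[of "f - g" "f' - g'"] by (simp add: equiv_def algebra_simps)

lemma equiv_diff: "f \<doteq> g \<Longrightarrow> f' \<doteq> g' \<Longrightarrow> f - f' \<doteq> g - g'"
  using relations_diff[of "f - g" "f' - g'"] by (simp add: equiv_def algebra_simps)

lemma equiv_sum: "(\<And>i. i \<in> I \<Longrightarrow> f i \<doteq> g i) \<Longrightarrow> sum f I \<doteq> sum g I"
  by (induction I rule: infinite_finite_induct) (auto simp: equiv_refl equiv_add)

lemma tensor_add_left:
  "x \<in> carrier M \<Longrightarrow> y \<in> carrier M \<Longrightarrow> integral b \<Longrightarrow> frag_of (x \<oplus>\<^bsub>M\<^esub> y, b) \<doteq> frag_of (x, b) + frag_of (y, b)"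
  unfolding equiv_def relations_eq
  by (rule generate.incl) (auto simp: relators_def diff_diff_eq)

lemma tensor_add_right:
  "x \<in> carrier M \<Longrightarrow> integral b \<Longrightarrow> integral b' \<Longrightarrow> frag_of (x, b + b') \<doteq> frag_of (x, b) + frag_of (x, b')"
  unfolding equiv_def relations_eq
  by (rule generate.incl) (auto simp: relators_def diff_diff_eq)

lemma tensor_smult:
  "a \<in> carrier A \<Longrightarrow> x \<in> carrier M \<Longrightarrow> integral b \<Longrightarrow> frag_of (a \<odot>\<^bsub>M\<^esub> x, b) \<doteq> frag_of (x, j a * b)"
  unfolding equiv_def relations_eq
  by (rule generate.incl) (auto simp: relators_def)

lemma tensor_0_right: "x \<in> carrier M \<Longrightarrow> frag_of (x, 0) \<doteq> 0"
  using tensor_add_right[of x 0 0] relations_minus integral_0 by (force simp: equiv_def)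

lemma tensor_diff_right:
  assumes "x \<in> carrier M" "integral b" "integral b'"
  shows "frag_of (x, b) - frag_of (x, b') \<doteq> frag_of (x, b - b')"
proof -
  have "frag_of (x, b - b' + b') \<doteq> frag_of (x, b - b') + frag_of (x, b')"
    using assms by (intro tensor_add_right integral_diff)
  then show ?thesis by (simp add: equiv_def algebra_simps)
qed

lemma tensor_sum_right:
  assumes "x \<in> carrier M" "finite I" "\<And>i. i \<in> I \<Longrightarrow> integral (b i)"
  shows "frag_of (x, sum b I) \<doteq> (\<Sum>i\<in>I. frag_of (x, b i))"
  using assms(2,3)
proof (induction I rule: finite_induct)
  case (insert i I)
  have "frag_of (x, b i + sum b I) \<doteq> frag_of (x, b i) + frag_of (x, sum b I)"
    using insert assms(1) by (intro tensor_add_right integral_sum) auto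
  also have "\<dots> \<doteq> frag_of (x, b i) + (\<Sum>i\<in>I. frag_of (x, b i))"
    using insert by (intro equiv_add equiv_refl) auto
  finally show ?case using insert by simp
qed (simp add: tensor_0_right assms)

definition scale :: "'k \<Rightarrow> ('m \<times> 'k \<Rightarrow>\<^sub>0 int) \<Rightarrow> ('m \<times> 'k \<Rightarrow>\<^sub>0 int)" where
  "scale c = frag_extend (\<lambda>(x, b). frag_of (x, c * b))"

text \<open>Scaling sends each relator to a relator of the same kind, which makes the action of
  \<open>B\<close> on classes well defined.\<close>

lemma scale_relations:
  assumes c: "integral c" and f: "f \<in> N"
  shows "scale c f \<in> N"
proof -
  have rel: "scale c r \<in> N" if "r \<in> relators" for r
    using that unfolding relators_def
  proof (elim UnE CollectE exE conjE)
    fix x y b assume "r = frag_of (x \<oplus>\<^bsub>M\<^esub> y, b) - frag_of (x, b) - frag_of (y, b)"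
      "x \<in> carrier M" "y \<in> carrier M" "integral b"
    then show ?thesis
      using tensor_add_left[of x y "c * b"] integral_mult[OF c, of b]
      by (simp add: scale_def frag_extend_diff frag_extend_add equiv_def diff_diff_eq)
  next
    fix x b b' assume "r = frag_of (x, b + b') - frag_of (x, b) - frag_of (x, b')"
      "x \<in> carrier M" "integral b" "integral b'"
    then show ?thesis
      using tensor_add_right[of x "c * b" "c * b'"] integral_mult[OF c, of b] integral_mult[OF c, of b']
      by (simp add: scale_def frag_extend_diff frag_extend_add equiv_def diff_diff_eq distrib_left)
  next
    fix a x b assume "r = frag_of (a \<odot>\<^bsub>M\<^esub> x, b) - frag_of (x, j a * b)"
      "a \<in> carrier A" "x \<in> carrier M" "integral b"
    then show ?thesis
      using tensor_smult[of a x "c * b"] integral_mult[OF c, of b]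
      by (simp add: scale_def frag_extend_diff frag_extend_add equiv_def mult.left_commute)
  qed
  have "Poly_Mapping.keys f \<subseteq> carrier M \<times> carrier B \<and> scale c f \<in> N"
    using f unfolding relations_eq
  proof (induction rule: generate.induct)
    case one
    then show ?case using relations_0 by (simp add: scale_def flip: relations_eq)
  next
    case (incl h)
    then show ?case using rel keys_relator by (simp flip: relations_eq)
  next
    case (inv h)
    have "Poly_Mapping.keys h \<subseteq> carrier M \<times> carrier B" by (rule keys_relator[OF inv])
    then show ?case using rel[OF inv] relations_minus
      by (simp add: scale_def frag_extend_minus flip: relations_eq)
  next
    case (eng h1 h2)
    then show ?case using relations_add keys_add[of h1 h2]
      by (auto simp: scale_def frag_extend_add simp flip: relations_eq)
  qed
  then show ?thesis by simp
qed

lemma scale_equiv: "integral c \<Longrightarrow> f \<doteq> g \<Longrightarrow> scale c f \<doteq> scale c g"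
  using scale_relations[of c "f - g"] by (simp add: equiv_def scale_def frag_extend_diff)

definition cls :: "('m \<times> 'k \<Rightarrow>\<^sub>0 int) \<Rightarrow> ('m \<times> 'k \<Rightarrow>\<^sub>0 int) set" where
  "cls f = {g. g \<doteq> f}"

lemma cls_eq_iff: "cls f = cls g \<longleftrightarrow> f \<doteq> g"
  unfolding cls_def using equiv_refl equiv_sym equiv_trans by blast

lemma coset_eq_cls: "N #>\<^bsub>G\<^esub> f = cls f"
proof -
  have "N #>\<^bsub>G\<^esub> f = {h + f | h. h \<in> N}" by (auto simp: r_coset_def)
  also have "\<dots> = cls f" by (force simp: cls_def equiv_def intro: exI[of _ "_ - f"])
  finally show ?thesis .
qed

lemma tensor_carrier: "carrier TB = cls ` {f. Poly_Mapping.keys f \<subseteq> carrier M \<times> carrier B}"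
  unfolding tensor_algebra_def Let_def FactGroup_def
  by (auto simp: RCOSETS_def coset_eq_cls)

lemma tensor_add:
  assumes "Poly_Mapping.keys f \<subseteq> carrier M \<times> carrier B" "Poly_Mapping.keys g \<subseteq> carrier M \<times> carrier B"
  shows "cls f \<oplus>\<^bsub>TB\<^esub> cls g = cls (f + g)"
proof -
  have "cls f \<oplus>\<^bsub>TB\<^esub> cls g = {u + v | u v. u \<in> cls f \<and> v \<in> cls g}"
    by (auto simp: tensor_algebra_def Let_def FactGroup_def set_mult_def)
  also have "\<dots> = cls (f + g)"
  proof
    show "{u + v | u v. u \<in> cls f \<and> v \<in> cls g} \<subseteq> cls (f + g)" by (auto simp: cls_def equiv_add)
    show "cls (f + g) \<subseteq> {u + v | u v. u \<in> cls f \<and> v \<in> cls g}"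
    proof
      fix h assume "h \<in> cls (f + g)"
      then have "h - g \<doteq> f" by (simp add: cls_def equiv_def algebra_simps)
      then show "h \<in> {u + v | u v. u \<in> cls f \<and> v \<in> cls g}"
        by (intro CollectI exI[of _ "h - g"] exI[of _ g]) (simp add: cls_def equiv_refl)
    qed
  qed
  finally show ?thesis .
qed

lemma tensor_scale:
  assumes "integral c"
  shows "c \<odot>\<^bsub>TB\<^esub> cls f = cls (scale c f)"
proof -
  have "c \<odot>\<^bsub>TB\<^esub> cls f = (\<Union>g\<in>cls f. cls (scale c g))"
    by (simp add: tensor_algebra_def Let_def coset_eq_cls scale_def)
  also have "\<dots> = (\<Union>g\<in>cls f. cls (scale c f))"
    using scale_equiv[OF assms] by (intro SUP_cong refl) (simp add: cls_eq_iff, simp add: cls_def)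
  also have "\<dots> = cls (scale c f)" using equiv_refl[of f] by (auto simp: cls_def)
  finally show ?thesis .
qed

lemma keys_scale:
  assumes "integral c" "Poly_Mapping.keys f \<subseteq> carrier M \<times> carrier B"
  shows "Poly_Mapping.keys (scale c f) \<subseteq> carrier M \<times> carrier B"
  using assms(2)
proof (induction f rule: frag_induction)
  case (diff f g)
  then show ?case by (simp add: scale_def frag_extend_diff keys_frag_diff)
qed (use assms(1) in \<open>auto simp: scale_def integral_mult\<close>)

lemma tensor_closed:
  "V \<in> carrier TB \<Longrightarrow> W \<in> carrier TB \<Longrightarrow> V \<oplus>\<^bsub>TB\<^esub> W \<in> carrier TB"
  "integral c \<Longrightarrow> V \<in> carrier TB \<Longrightarrow> c \<odot>\<^bsub>TB\<^esub> V \<in> carrier TB"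
proof -
  assume V: "V \<in> carrier TB"
  then obtain f where f: "V = cls f" "Poly_Mapping.keys f \<subseteq> carrier M \<times> carrier B"
    unfolding tensor_carrier by blast
  show "c \<odot>\<^bsub>TB\<^esub> V \<in> carrier TB" if c: "integral c"
    unfolding f(1) tensor_scale[OF c] tensor_carrier using keys_scale[OF c f(2)] by (intro imageI CollectI)
  assume "W \<in> carrier TB"
  then obtain g where g: "W = cls g" "Poly_Mapping.keys g \<subseteq> carrier M \<times> carrier B"
    unfolding tensor_carrier by blast
  have "Poly_Mapping.keys (f + g) \<subseteq> carrier M \<times> carrier B" using keys_add[of f g] f(2) g(2) by (meson Un_least order.trans)
  then show "V \<oplus>\<^bsub>TB\<^esub> W \<in> carrier TB"
    unfolding f(1) g(1) tensor_add[OF f(2) g(2)] tensor_carrier by (intro imageI CollectI)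
qed

section \<open>Linear maps out of the base change\<close>

context
  fixes \<tau> :: "'m \<Rightarrow> 'k^'n"
  assumes \<tau>_add: "x \<in> carrier M \<Longrightarrow> y \<in> carrier M \<Longrightarrow> \<tau> (x \<oplus>\<^bsub>M\<^esub> y) = \<tau> x + \<tau> y"
    and \<tau>_smult: "a \<in> carrier A \<Longrightarrow> x \<in> carrier M \<Longrightarrow> \<tau> (a \<odot>\<^bsub>M\<^esub> x) = j a *s \<tau> x"
begin

abbreviation (input) "bil \<equiv> \<lambda>(x, b). b *s \<tau> x"

lemma lin_ext_relations:
  assumes f: "f \<in> N"
  shows "lin_ext bil f = 0"
proof -
  have rel: "lin_ext bil r = 0" if "r \<in> relators" for r
    using that unfolding relators_def
    by (auto simp: lin_ext_diff \<tau>_add \<tau>_smult vector_add_ldistrib vector_sadd_rdistrib mult.commute)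
  have "Poly_Mapping.keys f \<subseteq> carrier M \<times> carrier B \<and> lin_ext bil f = 0"
    using f unfolding relations_eq
  proof (induction rule: generate.induct)
    case (incl h)
    then show ?case using rel keys_relator by simp
  next
    case (inv h)
    have "Poly_Mapping.keys h \<subseteq> carrier M \<times> carrier B" by (rule keys_relator[OF inv])
    then show ?case using rel[OF inv] by (simp add: lin_ext_minus)
  next
    case (eng h1 h2)
    then show ?case using keys_add[of h1 h2] by (auto simp: lin_ext_add)
  qed simp
  then show ?thesis by simp
qed

text \<open>The choice of a representative is immaterial because \<open>lin_ext bil\<close> vanishes
  on the relations.\<close>

definition induced :: "('m \<times> 'k \<Rightarrow>\<^sub>0 int) set \<Rightarrow> 'k^'n" where
  "induced V = lin_ext bil (SOME f. f \<in> V)"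

lemma induced_cls: "induced (cls f) = lin_ext bil f"
proof -
  have "(SOME g. g \<in> cls f) \<in> cls f" by (rule someI[of _ f]) (simp add: cls_def equiv_refl)
  then have "lin_ext bil ((SOME g. g \<in> cls f) - f) = 0"
    by (intro lin_ext_relations) (simp add: cls_def equiv_def)
  then show ?thesis by (simp add: induced_def lin_ext_diff)
qed

lemma lin_ext_scale: "lin_ext bil (scale c f) = c *s lin_ext bil f"
  using subset_UNIV
proof (induction f rule: frag_induction)
  case zero
  then show ?case by (simp add: scale_def)
next
  case (one x)
  then show ?case by (simp add: scale_def split_beta)
next
  case (diff f g)
  then show ?case by (simp add: scale_def frag_extend_diff lin_ext_diff vector_ssub_ldistrib)
qed

lemma induced_add: "V \<in> carrier TB \<Longrightarrow> W \<in> carrier TB \<Longrightarrow> induced (V \<oplus>\<^bsub>TB\<^esub> W) = induced V + induced W"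
  unfolding tensor_carrier by (auto simp: tensor_add induced_cls lin_ext_add)

lemma induced_smult: "integral c \<Longrightarrow> V \<in> carrier TB \<Longrightarrow> induced (c \<odot>\<^bsub>TB\<^esub> V) = c *s induced V"
  unfolding tensor_carrier by (auto simp: tensor_scale induced_cls lin_ext_scale)

end

end

section \<open>Hypersurfaces and cokernels of matrix factorizations\<close>

lemma ring_of_type_algebra_simps [simp]:
  "carrier ring_of_type_algebra = UNIV" "x \<otimes>\<^bsub>ring_of_type_algebra\<^esub> y = x * y"
  "x \<oplus>\<^bsub>ring_of_type_algebra\<^esub> y = x + y" "\<one>\<^bsub>ring_of_type_algebra\<^esub> = 1" "\<zero>\<^bsub>ring_of_type_algebra\<^esub> = 0"
  by (auto simp: ring_of_type_algebra_def)

text \<open>Polynomials are univariate in \<open>y\<close> over \<complex>[x, z], so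
  \<open>lead_coeff\<close> and \<open>degree\<close> refer to \<open>y\<close>.\<close>

locale hypersurface =
  fixes F :: poly3 and \<iota> :: "poly3 set \<Rightarrow> 'k::field"
  assumes fraction_field: "is_fraction_field (hypersurface_ring F) \<iota>"
    and monic: "lead_coeff F = 1" and degree_pos: "degree F > 0"
begin

abbreviation "\<phi> \<equiv> eval_K F \<iota>"
abbreviation "I \<equiv> PIdl\<^bsub>S3\<^esub> F"

lemma ideal_F: "ideal I S3"
  by (rule cring.cgenideal_ideal[OF cring_from_type_algebra]) simp

lemma hom_eval: "\<phi> \<in> ring_hom S3 ring_of_type_algebra"
proof -
  have "(+>\<^bsub>S3\<^esub>) I \<in> ring_hom S3 (hypersurface_ring F)"
    unfolding hypersurface_ring_def by (rule ideal.rcos_ring_hom[OF ideal_F])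
  moreover have "\<iota> \<in> ring_hom (hypersurface_ring F) ring_of_type_algebra"
    using fraction_field by (simp add: is_fraction_field_def)
  ultimately have "\<iota> \<circ> (+>\<^bsub>S3\<^esub>) I \<in> ring_hom S3 ring_of_type_algebra" by (rule ring_hom_trans)
  moreover have "\<phi> = \<iota> \<circ> (+>\<^bsub>S3\<^esub>) I" by (auto simp: eval_K_def)
  ultimately show ?thesis by simp
qed

sublocale S: field_over \<phi>
  using ring_hom_add[OF hom_eval] ring_hom_mult[OF hom_eval] ring_hom_one[OF hom_eval]
  by unfold_locales auto

lemma carrier_hypersurface: "carrier (hypersurface_ring F) = range (\<lambda>s. I +>\<^bsub>S3\<^esub> s)"
  unfolding hypersurface_ring_def FactRing_def by (auto simp: A_RCOSETS_def')

lemma eval_eq_0_iff: "\<phi> s = 0 \<longleftrightarrow> F dvd s"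
proof -
  interpret ideal I S3 by (rule ideal_F)
  have I: "s \<in> I \<longleftrightarrow> F dvd s" for s by (auto simp: cgenideal_def dvd_def mult.commute)
  have "\<phi> s = 0 \<longleftrightarrow> \<iota> (I +>\<^bsub>S3\<^esub> s) = \<iota> (I +>\<^bsub>S3\<^esub> 0)"
    using S.hom_0 by (simp add: eval_K_def)
  also have "\<dots> \<longleftrightarrow> I +>\<^bsub>S3\<^esub> s = I +>\<^bsub>S3\<^esub> 0"
    using fraction_field carrier_hypersurface by (auto simp: is_fraction_field_def dest: inj_onD)
  also have "I +>\<^bsub>S3\<^esub> 0 = I"
    using a_coset_add_zero[OF a_subset] by simp
  also have "I +>\<^bsub>S3\<^esub> s = I \<longleftrightarrow> s \<in> I"
    using a_rcos_const[of s] a_rcos_self[of s] by auto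
  finally show ?thesis by (simp add: I)
qed

text \<open>The polynomials constant in \<open>y\<close> form \<complex>[x, z], which becomes the
  factorial base ring.\<close>

abbreviation "\<rho> \<equiv> \<lambda>r. \<phi> [:r:]"
abbreviation "y \<equiv> \<phi> Y3"

sublocale R: field_over \<rho>
proof
  show "\<rho> 1 = 1" by (simp add: S.hom_1 flip: one_pCons)
  show "\<rho> (a + b) = \<rho> a + \<rho> b" for a b by (simp flip: S.hom_add)
  show "\<rho> (a * b) = \<rho> a * \<rho> b" for a b by (simp add: mult.commute flip: S.hom_mult)
qed

lemma eval_eq_ev: "\<phi> s = R.ev s y"
proof (induction s)
  case (pCons a s)
  have "pCons a s = [:a:] + Y3 * s" by (simp add: Y3_def)
  then have "\<phi> (pCons a s) = \<rho> a + y * \<phi> s" by (simp only: S.hom_add S.hom_mult)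
  then show ?case using pCons by simp
qed simp

text \<open>The equation \<open>F\<close> makes \<open>y\<close> integral over \<complex>[x, z], and
  every image is a polynomial in \<open>y\<close>.\<close>

lemma integral_eval: "R.integral (\<phi> s)"
proof -
  have "R.integral y"
    unfolding R.integral_def using monic eval_eq_0_iff[of F] eval_eq_ev[of F] by auto
  moreover have "R.ev s y = (\<Sum>i\<le>degree s. \<rho> (coeff s i) * y ^ i)" by (rule R.ev_altdef) simp
  ultimately show ?thesis
    by (simp add: eval_eq_ev R.integral_sum R.integral_mult R.integral_hom R.integral_power flip: eval_eq_ev)
qed

sublocale R: normal_field_over \<rho>
proof
  fix a assume "\<rho> a = 0"
  then have "F dvd [:a:]" by (simp add: eval_eq_0_iff)
  then show "a = 0" using degree_pos dvd_imp_degree_le[of F "[:a:]"] by auto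
next
  fix u
  obtain a b where ab: "a \<in> carrier (hypersurface_ring F)" "b \<in> carrier (hypersurface_ring F)"
    "\<iota> b \<noteq> 0" "u = \<iota> a / \<iota> b"
    using fraction_field unfolding is_fraction_field_def by blast
  then obtain s t where st: "\<phi> t \<noteq> 0" "u = \<phi> s / \<phi> t"
    by (auto simp: carrier_hypersurface eval_K_def)
  obtain f0 where "lead_coeff f0 = 1" "R.ev f0 (\<phi> t) = 0"
    using integral_eval[of t] by (auto simp: R.integral_def)
  then have "f0 \<noteq> 0 \<and> R.ev f0 (\<phi> t) = 0" by auto
  then obtain f where f: "f \<noteq> 0" "R.ev f (\<phi> t) = 0"
    and least: "\<And>g. g \<noteq> 0 \<Longrightarrow> R.ev g (\<phi> t) = 0 \<Longrightarrow> degree f \<le> degree g"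
    using ex_has_least_nat[of "\<lambda>g. g \<noteq> 0 \<and> R.ev g (\<phi> t) = 0" f0 degree] by blast
  \<comment> \<open>By minimality the constant term \<open>c\<close> is nonzero, as
    \<open>\<phi> t\<close> would cancel otherwise. It is \<open>\<phi> t\<close> times an integral
    element, hence a denominator of \<open>u\<close>.\<close>
  obtain c g where cg: "f = pCons c g" by (cases f rule: pCons_cases)
  have "c \<noteq> 0"
  proof
    assume "c = 0"
    then have "g \<noteq> 0" "R.ev g (\<phi> t) = 0" using f cg st(1) by (auto simp: R.hom_0)
    then show False using least[of g] \<open>c = 0\<close> cg by simp
  qed
  moreover have "\<rho> c = - (\<phi> t * R.ev g (\<phi> t))" using f(2) cg by (simp add: eq_neg_iff_add_eq_0)
  then have "\<rho> c * u = - (R.ev g (\<phi> t) * \<phi> s)" using st by simp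
  moreover have "R.integral (R.ev g (\<phi> t))"
    by (subst R.ev_altdef[OF order_refl])
      (intro R.integral_sum R.integral_mult R.integral_hom R.integral_power integral_eval)
  ultimately show "\<exists>r. r \<noteq> 0 \<and> R.integral (\<rho> r * u)"
    using integral_eval[of s] by (intro exI[of _ c]) (simp add: R.integral_uminus R.integral_mult)
qed

text \<open>The elements of the hypersurface ring are themselves integral over \<complex>[x, z], so
  integral equations over it are pushed down by \<open>integral_tower\<close>.\<close>

lemma normalization_eq: "normalization (hypersurface_ring F) \<iota> = R.B"
proof -
  have image: "\<iota> ` carrier (hypersurface_ring F) = range \<phi>"
    by (auto simp: carrier_hypersurface eval_K_def)
  have "(\<exists>f. lead_coeff f = 1 \<and> (\<forall>i. coeff f i \<in> range \<phi>) \<and> poly f x = 0) \<longleftrightarrow> R.integral x" (is "?l \<longleftrightarrow> ?r") for x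
  proof
    assume ?l
    then obtain f where f: "lead_coeff f = 1" "\<And>i. coeff f i \<in> range \<phi>" "poly f x = 0" by blast
    have "R.integral (coeff f i)" for i using f(2)[of i] integral_eval by auto
    then show ?r using R.integral_tower f(1,3) by blast
  next
    assume ?r
    then obtain f where f: "lead_coeff f = 1" "R.ev f x = 0" by (auto simp: R.integral_def)
    have "degree (map_poly \<rho> f) = degree f"
      by (intro antisym degree_le le_degree) (use f(1) in \<open>auto simp: coeff_map_poly coeff_eq_0 R.hom_1\<close>)
    then have "lead_coeff (map_poly \<rho> f) = 1" using f(1) by (simp add: coeff_map_poly R.hom_1)
    moreover have "coeff (map_poly \<rho> f) i \<in> range \<phi>" for i by (simp add: coeff_map_poly)
    ultimately show ?l using f(2) unfolding R.ev_def by blast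
  qed
  then show ?thesis unfolding normalization_def R.B_def image by simp
qed

end

section \<open>The cokernel of one half of a matrix factorization and its base change\<close>

locale matrix_factor = hypersurface F \<iota>
  for F and \<iota> :: "poly3 set \<Rightarrow> 'k::field" +
  fixes \<Phi> \<Psi> :: "poly3^'n^'n"
  assumes factor: "\<Phi> ** \<Psi> = mat F"
begin

definition cs :: "poly3^'n \<Rightarrow> (poly3^'n) set" where
  "cs w = {\<Phi> *v u + w | u. True}"

lemma cs_eq_iff: "cs w = cs w' \<longleftrightarrow> (\<exists>u. w - w' = \<Phi> *v u)"
proof
  assume "cs w = cs w'"
  moreover have "w \<in> cs w" by (auto simp: cs_def intro: exI[of _ 0])
  ultimately show "\<exists>u. w - w' = \<Phi> *v u" by (auto simp: cs_def)
next
  assume "\<exists>u. w - w' = \<Phi> *v u"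
  then obtain u where u: "w = w' + \<Phi> *v u" by (metis add_diff_cancel_left' diff_add_cancel add.commute)
  have "\<Phi> *v v + w = \<Phi> *v (v + u) + w'" "\<Phi> *v v + w' = \<Phi> *v (v - u) + w" for v
    by (auto simp: u matrix_vector_right_distrib matrix_vector_mult_diff_distrib)
  then show "cs w = cs w'" unfolding cs_def by blast
qed

text \<open>This is why \<open>F\<close> kills the cokernel, so that the hypersurface ring acts on
  it.\<close>

lemma F_smult: "F *s v = \<Phi> *v (\<Psi> *v v)"
  by (simp add: matrix_vector_mul_assoc factor) (simp add: vec_eq_iff matrix_vector_mult_def mat_def if_distrib[where f = "\<lambda>c. c * _"] cong: if_cong)

lemma coset_eq_cs: "range (\<lambda>v. \<Phi> *v v) +>\<^bsub>vec_module UNIV\<^esub> w = cs w"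
  by (auto simp: a_r_coset_def' cs_def)

lemma carrier_coker: "carrier (coker \<Phi>) = range cs"
  unfolding coker_def factor_scalars_def quotient_module_def by (auto simp: A_RCOSETS_def' coset_eq_cs)

lemma coker_add: "cs v \<oplus>\<^bsub>coker \<Phi>\<^esub> cs w = cs (v + w)"
proof -
  have "cs v \<oplus>\<^bsub>coker \<Phi>\<^esub> cs w = {a + b | a b. a \<in> cs v \<and> b \<in> cs w}"
    unfolding coker_def factor_scalars_def quotient_module_def by (auto simp: set_add_def')
  also have "\<dots> = cs (v + w)"
  proof
    show "{a + b | a b. a \<in> cs v \<and> b \<in> cs w} \<subseteq> cs (v + w)"
      unfolding cs_def by (auto simp: algebra_simps simp flip: matrix_vector_right_distrib)
    show "cs (v + w) \<subseteq> {a + b | a b. a \<in> cs v \<and> b \<in> cs w}"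
    proof
      fix x assume "x \<in> cs (v + w)"
      then obtain u where "x = \<Phi> *v u + (v + w)" by (auto simp: cs_def)
      then have "x = (\<Phi> *v u + v) + (\<Phi> *v 0 + w)" by (simp add: algebra_simps)
      then show "x \<in> {a + b | a b. a \<in> cs v \<and> b \<in> cs w}" unfolding cs_def by blast
    qed
  qed
  finally show ?thesis .
qed

text \<open>Representatives of the scalar differ by a multiple of \<open>F\<close>, which
  \<open>F_smult\<close> turns into a vector in the image of \<Phi>.\<close>

lemma coker_smult: "(I +>\<^bsub>S3\<^esub> s) \<odot>\<^bsub>coker \<Phi>\<^esub> cs w = cs (s *s w)"
proof -
  have eq: "cs (s' *s x) = cs (s *s w)" if s': "s' \<in> I +>\<^bsub>S3\<^esub> s" and x: "x \<in> cs w" for s' x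
  proof -
    obtain g where g: "s' = g * F + s" using s' by (auto simp: a_r_coset_def' cgenideal_def)
    obtain u where u: "x = \<Phi> *v u + w" using x by (auto simp: cs_def)
    have "s' *s x - s *s w = s *s (\<Phi> *v u) + g *s (F *s x)"
      by (simp add: g u vec_eq_iff algebra_simps)
    also have "\<dots> = \<Phi> *v (s *s u + g *s (\<Psi> *v x))"
      by (simp add: F_smult matrix_vector_right_distrib)
        (simp add: vec_eq_iff matrix_vector_mult_def sum_distrib_left mult.left_commute)
    finally show ?thesis using cs_eq_iff by blast
  qed
  have "(I +>\<^bsub>S3\<^esub> s) \<odot>\<^bsub>coker \<Phi>\<^esub> cs w = (\<Union>s'\<in>I +>\<^bsub>S3\<^esub> s. \<Union>x\<in>cs w. cs (s' *s x))"
    unfolding coker_def factor_scalars_def quotient_module_def by (simp add: coset_eq_cs)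
  also have "\<dots> = (\<Union>s'\<in>I +>\<^bsub>S3\<^esub> s. \<Union>x\<in>cs w. cs (s *s w))" using eq by (intro SUP_cong refl)
  also have "\<dots> = cs (s *s w)"
  proof -
    have "s \<in> I +>\<^bsub>S3\<^esub> s" by (auto simp: a_r_coset_def' cgenideal_def intro!: exI[of _ 0])
    moreover have "w \<in> cs w" by (auto simp: cs_def intro: exI[of _ 0])
    ultimately show ?thesis by auto
  qed
  finally show ?thesis .
qed

sublocale T: base_change \<rho> "hypersurface_ring F" "coker \<Phi>" \<iota>
proof
  show "x \<oplus>\<^bsub>coker \<Phi>\<^esub> y \<in> carrier (coker \<Phi>)" if "x \<in> carrier (coker \<Phi>)" "y \<in> carrier (coker \<Phi>)" for x y
    using that by (auto simp: carrier_coker coker_add)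
  show "a \<odot>\<^bsub>coker \<Phi>\<^esub> x \<in> carrier (coker \<Phi>)" if "a \<in> carrier (hypersurface_ring F)" "x \<in> carrier (coker \<Phi>)" for a x
    using that by (auto simp: carrier_coker carrier_hypersurface coker_smult)
  show "R.integral (\<iota> a)" if "a \<in> carrier (hypersurface_ring F)" for a
    using that integral_eval by (auto simp: carrier_hypersurface eval_K_def)
qed

definition gen :: "'n \<Rightarrow> (poly3^'n) set" where
  "gen k = cs (axis k 1)"

lemma gen_carrier: "gen k \<in> carrier (coker \<Phi>)"
  by (auto simp: gen_def carrier_coker)

text \<open>On integral vectors this presents the base change: it is onto by
  \<open>\<kappa>_surj\<close> and kills the image of \<Phi> by
  \<open>\<kappa>_image\<close>.\<close>

definition \<kappa> :: "'k^'n \<Rightarrow> ((poly3^'n) set \<times> 'k \<Rightarrow>\<^sub>0 int)" where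
  "\<kappa> b = (\<Sum>k\<in>UNIV. frag_of (gen k, b$k))"

definition integral_vec :: "'k^'n \<Rightarrow> bool" where
  "integral_vec b \<longleftrightarrow> (\<forall>k. R.integral (b$k))"

lemma keys_\<kappa>: "integral_vec b \<Longrightarrow> Poly_Mapping.keys (\<kappa> b) \<subseteq> carrier (coker \<Phi>) \<times> carrier R.B"
  using sum_closed_free_Abelian_group[of UNIV "\<lambda>k. frag_of (gen k, b$k)" "carrier (coker \<Phi>) \<times> carrier R.B"] gen_carrier
  by (auto simp: \<kappa>_def integral_vec_def)

lemma \<kappa>_diff:
  assumes "integral_vec b" "integral_vec b'"
  shows "T.equiv (\<kappa> b - \<kappa> b') (\<kappa> (b - b'))"
  unfolding \<kappa>_def sum_subtractf[symmetric] vector_minus_component using assms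
  by (intro T.equiv_sum T.tensor_diff_right gen_carrier) (auto simp: integral_vec_def)

lemma scale_\<kappa>: "T.scale c (\<kappa> b) = \<kappa> (c *s b)"
  by (simp add: \<kappa>_def T.scale_def frag_extend_sum o_def)

lemma tensor_sum_left:
  assumes "finite J" "R.integral b"
  shows "T.equiv (frag_of (cs (sum w J), b)) (\<Sum>k\<in>J. frag_of (cs (w k), b))"
  using assms(1)
proof (induction J rule: finite_induct)
  case empty
  \<comment> \<open>As zero is its own double, its pure tensor equals twice itself and
    vanishes.\<close>
  have "T.equiv (frag_of (cs 0 \<oplus>\<^bsub>coker \<Phi>\<^esub> cs 0, b)) (frag_of (cs 0, b) + frag_of (cs 0, b))"
    using assms(2) by (intro T.tensor_add_left) (auto simp: carrier_coker)
  then have "T.equiv 0 (frag_of (cs 0, b))" by (simp add: coker_add T.equiv_def)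
  then show ?case using T.equiv_sym by simp
next
  case (insert i J)
  have "T.equiv (frag_of (cs (w i) \<oplus>\<^bsub>coker \<Phi>\<^esub> cs (sum w J), b)) (frag_of (cs (w i), b) + frag_of (cs (sum w J), b))"
    using assms(2) by (intro T.tensor_add_left) (auto simp: carrier_coker)
  also have "T.equiv \<dots> (frag_of (cs (w i), b) + (\<Sum>k\<in>J. frag_of (cs (w k), b)))"
    using insert by (intro T.equiv_add T.equiv_refl) auto
  finally show ?case using insert by (simp add: coker_add)
qed

lemma tensor_scalar:
  assumes "R.integral b"
  shows "T.equiv (frag_of (cs (s *s axis k 1), b)) (frag_of (gen k, \<phi> s * b))"
  using T.tensor_smult[of "I +>\<^bsub>S3\<^esub> s" "gen k" b] assms gen_carrier
  by (auto simp: carrier_hypersurface coker_smult gen_def eval_K_def)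

definition eval_vec :: "poly3^'n \<Rightarrow> 'k^'n" where
  "eval_vec w = (\<chi> k. \<phi> (w$k))"

lemma vec_sum_axis: "(\<Sum>k\<in>UNIV. w$k *s axis k 1) = w" for w :: "poly3^'n"
  by (simp add: vec_eq_iff axis_def if_distrib cong: if_cong)

lemma tensor_pure:
  assumes "R.integral b"
  shows "T.equiv (frag_of (cs w, b)) (\<kappa> (b *s eval_vec w))"
proof -
  have "T.equiv (frag_of (cs (\<Sum>k\<in>UNIV. w$k *s axis k 1), b)) (\<Sum>k\<in>UNIV. frag_of (cs (w$k *s axis k 1), b))"
    using assms by (intro tensor_sum_left) auto
  also have "T.equiv \<dots> (\<Sum>k\<in>UNIV. frag_of (gen k, \<phi> (w$k) * b))"
    using assms by (intro T.equiv_sum tensor_scalar)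
  finally show ?thesis unfolding vec_sum_axis by (simp add: \<kappa>_def eval_vec_def mult.commute)
qed

lemma \<kappa>_surj:
  assumes "Poly_Mapping.keys f \<subseteq> carrier (coker \<Phi>) \<times> carrier R.B"
  shows "\<exists>b. integral_vec b \<and> T.equiv f (\<kappa> b)"
  using assms
proof (induction f rule: frag_induction)
  case zero
  have "T.equiv (\<kappa> 0 - \<kappa> 0) (\<kappa> (0 - 0))" by (rule \<kappa>_diff) (auto simp: integral_vec_def R.integral_0)
  then show ?case by (intro exI[of _ 0]) (simp add: integral_vec_def R.integral_0)
next
  case (one x)
  then obtain w b where wb: "x = (cs w, b)" "R.integral b" by (auto simp: carrier_coker)
  then show ?case
    using tensor_pure[OF wb(2), of w]
    by (intro exI[of _ "b *s eval_vec w"] conjI)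
      (simp add: integral_vec_def eval_vec_def R.integral_mult integral_eval, simp)
next
  case (diff f g)
  then obtain b b' where b: "integral_vec b" "T.equiv f (\<kappa> b)" "integral_vec b'" "T.equiv g (\<kappa> b')" by blast
  have "T.equiv (f - g) (\<kappa> b - \<kappa> b')" using b by (intro T.equiv_diff)
  also have "T.equiv \<dots> (\<kappa> (b - b'))" using b by (intro \<kappa>_diff)
  finally show ?case using b by (intro exI[of _ "b - b'"]) (auto simp: integral_vec_def R.integral_diff)
qed

text \<open>Collected by columns, the tensor is the sum of the columns of \<Phi> tensored with the
  entries of \<open>u\<close>, and a column of \<Phi> has class zero in the cokernel.\<close>

lemma \<kappa>_image:
  assumes u: "integral_vec u"
  shows "T.equiv (\<kappa> (map_matrix \<phi> \<Phi> *v u)) 0"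
proof -
  have "T.equiv (\<kappa> (map_matrix \<phi> \<Phi> *v u)) (\<Sum>k\<in>UNIV. \<Sum>l\<in>UNIV. frag_of (gen k, \<phi> (\<Phi>$k$l) * u$l))"
    unfolding \<kappa>_def using u
    by (intro T.equiv_sum)
      (auto simp: matrix_vector_mult_def map_matrix_def integral_vec_def
        intro!: T.tensor_sum_right gen_carrier R.integral_mult integral_eval)
  also have "\<dots> = (\<Sum>l\<in>UNIV. \<Sum>k\<in>UNIV. frag_of (gen k, \<phi> (\<Phi>$k$l) * u$l))" by (rule sum.swap)
  also have "T.equiv \<dots> (\<Sum>l\<in>(UNIV :: 'n set). 0)"
  proof (intro T.equiv_sum)
    fix l
    have col: "\<kappa> (u$l *s eval_vec (column l \<Phi>)) = (\<Sum>k\<in>UNIV. frag_of (gen k, \<phi> (\<Phi>$k$l) * u$l))"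
      by (simp add: \<kappa>_def eval_vec_def column_def mult.commute)
    have "cs (column l \<Phi>) = cs 0"
      unfolding cs_eq_iff by (intro exI[of _ "axis l 1"]) (simp add: matrix_vector_axis)
    then have "T.equiv (\<kappa> (u$l *s eval_vec (column l \<Phi>))) (frag_of (cs 0, u$l))"
      using tensor_pure[of "u$l" "column l \<Phi>"] u T.equiv_sym by (simp add: integral_vec_def)
    also have "T.equiv \<dots> 0"
      using tensor_sum_left[of "{}" "u$l"] u by (simp add: integral_vec_def)
    finally show "T.equiv (\<Sum>k\<in>UNIV. frag_of (gen k, \<phi> (\<Phi>$k$l) * u$l)) 0" by (simp add: col)
  qed
  finally show ?thesis by simp
qed

end

section \<open>The Koszul matrix factorization\<close>

context matrix_factor
begin

text \<open>By \<open>T0\<close> and \<open>ker\<close> the matrices \<Phi> and \<open>T\<close>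
  form an exact sequence over the field. Over \<open>B\<close> exactness may fail, but a denominator
  of the preimage under \<Phi> kills the discrepancy, which is therefore torsion.\<close>

theorem coker_double_dual:
  fixes T :: "'k^'n^2" and U :: "('k, 'u) module"
  assumes T0: "T ** map_matrix \<phi> \<Phi> = 0"
    and ker: "\<And>w. T *v w = 0 \<Longrightarrow> \<exists>u. w = map_matrix \<phi> \<Phi> *v u"
    and nondeg: "det2 (column k T) (column l T) \<noteq> 0"
    and U: "Module.module R.B U" "maximal_CM R.B U"
    and iso: "module_iso R.B (vec_module (column_lattice R.B T)) U"
  shows "module_iso R.B (dual R.B (dual R.B (tensor_algebra (hypersurface_ring F) (coker \<Phi>) R.B \<iota>))) U"
proof -
  let ?L = "column_lattice R.B T"
  let ?N = "tensor_algebra (hypersurface_ring F) (coker \<Phi>) R.B \<iota>"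
  have L: "R.is_lattice ?L" by (rule R.column_lattice_lattice)
  \<comment> \<open>The map induced by \<open>T\<close> on the cokernel, through an arbitrary
    representative; \<open>T0\<close> makes the choice irrelevant.\<close>
  define \<tau> where "\<tau> V = T *v eval_vec (SOME w. w \<in> V)" for V
  have eval_mult: "eval_vec (\<Phi> *v u) = map_matrix \<phi> \<Phi> *v eval_vec u" for u
    by (simp add: eval_vec_def vec_eq_iff matrix_vector_mult_def map_matrix_def S.hom_sum S.hom_mult)
  have eval_add: "eval_vec (v + w) = eval_vec v + eval_vec w" for v w
    by (simp add: eval_vec_def vec_eq_iff S.hom_add)
  have eval_smult: "eval_vec (s *s w) = \<phi> s *s eval_vec w" for s w
    by (simp add: eval_vec_def vec_eq_iff S.hom_mult)
  have \<tau>: "\<tau> (cs w) = T *v eval_vec w" for w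
  proof -
    have "w \<in> cs w" by (auto simp: cs_def intro: exI[of _ 0])
    then have "(SOME v. v \<in> cs w) \<in> cs w" by (rule someI)
    then obtain u where u: "(SOME v. v \<in> cs w) = \<Phi> *v u + w" by (auto simp: cs_def)
    have "T *v (map_matrix \<phi> \<Phi> *v eval_vec u) = 0"
      by (simp add: matrix_vector_mul_assoc T0)
    then show ?thesis by (simp add: \<tau>_def u eval_add eval_mult matrix_vector_right_distrib)
  qed
  have \<tau>_add: "\<tau> (V \<oplus>\<^bsub>coker \<Phi>\<^esub> W) = \<tau> V + \<tau> W" if "V \<in> carrier (coker \<Phi>)" "W \<in> carrier (coker \<Phi>)" for V W
    using that by (auto simp: carrier_coker coker_add \<tau> eval_add matrix_vector_right_distrib)
  have \<tau>_smult: "\<tau> (a \<odot>\<^bsub>coker \<Phi>\<^esub> V) = \<iota> a *s \<tau> V"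
    if "a \<in> carrier (hypersurface_ring F)" "V \<in> carrier (coker \<Phi>)" for a V
    using that by (auto simp: carrier_coker carrier_hypersurface coker_smult \<tau> eval_smult vector_scalar_commute
        simp flip: eval_K_def)
  define h where "h = T.induced \<tau>"
  have h_add: "h (V \<oplus>\<^bsub>?N\<^esub> W) = h V + h W" if "V \<in> carrier ?N" "W \<in> carrier ?N" for V W
    unfolding h_def by (rule T.induced_add[OF \<tau>_add \<tau>_smult that])
  have h_smult: "h (c \<odot>\<^bsub>?N\<^esub> V) = c *s h V" if "R.integral c" "V \<in> carrier ?N" for c V
    unfolding h_def by (rule T.induced_smult[OF \<tau>_add \<tau>_smult that])
  have h_\<kappa>: "h (T.cls (\<kappa> b)) = T *v b" for b
  proof -
    have "h (T.cls (\<kappa> b)) = lin_ext (\<lambda>(V, c). c *s \<tau> V) (\<kappa> b)"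
      unfolding h_def by (rule T.induced_cls[OF \<tau>_add \<tau>_smult])
    also have "\<dots> = (\<Sum>k\<in>UNIV. b$k *s \<tau> (gen k))"
      by (simp add: \<kappa>_def lin_ext_sum)
    also have "\<dots> = (\<Sum>k\<in>UNIV. b$k *s column k T)"
    proof (intro sum.cong refl)
      fix k
      have "eval_vec (axis k 1) = axis k 1" by (simp add: eval_vec_def vec_eq_iff axis_def S.hom_1)
      then have "\<tau> (gen k) = column k T"
        unfolding gen_def \<tau> by (simp only: matrix_vector_axis)
      then show "b$k *s \<tau> (gen k) = b$k *s column k T" by simp
    qed
    also have "\<dots> = T *v b" by (rule matrix_mult_sum[symmetric])
    finally show ?thesis .
  qed
  have N_carrier: "carrier ?N = (\<lambda>b. T.cls (\<kappa> b)) ` {b. integral_vec b}"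
  proof
    show "carrier ?N \<subseteq> (\<lambda>b. T.cls (\<kappa> b)) ` {b. integral_vec b}"
    proof
      fix V assume "V \<in> carrier ?N"
      then obtain f where f: "V = T.cls f" "Poly_Mapping.keys f \<subseteq> carrier (coker \<Phi>) \<times> carrier R.B"
        unfolding T.tensor_carrier by blast
      obtain b where "integral_vec b" "T.equiv f (\<kappa> b)" using \<kappa>_surj[OF f(2)] by blast
      then show "V \<in> (\<lambda>b. T.cls (\<kappa> b)) ` {b. integral_vec b}" using f(1) T.cls_eq_iff by blast
    qed
    show "(\<lambda>b. T.cls (\<kappa> b)) ` {b. integral_vec b} \<subseteq> carrier ?N"
      unfolding T.tensor_carrier using keys_\<kappa> by blast
  qed
  have torsion: "\<exists>t. R.integral t \<and> t \<noteq> 0 \<and> t \<odot>\<^bsub>?N\<^esub> V = t \<odot>\<^bsub>?N\<^esub> W"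
    if VW: "V \<in> carrier ?N" "W \<in> carrier ?N" "h V = h W" for V W
  proof -
    obtain b b' where b: "integral_vec b" "V = T.cls (\<kappa> b)" "integral_vec b'" "W = T.cls (\<kappa> b')"
      using VW(1,2) unfolding N_carrier by blast
    have "T *v (b - b') = 0" using VW(3) by (simp add: b h_\<kappa> matrix_vector_mult_diff_distrib)
    then obtain u where u: "b - b' = map_matrix \<phi> \<Phi> *v u" using ker by blast
    \<comment> \<open>The entries of \<open>u\<close> lie in the field. After multiplication by
      \<open>t\<close> they lie in \<open>B\<close>, where \<open>\<kappa>_image\<close>
      applies.\<close>
    obtain t where t: "R.integral t" "t \<noteq> 0" "\<And>x. x \<in> range (($) u) \<Longrightarrow> R.integral (t * x)"
      by (rule R.common_denominator[of "range (($) u)"]) (simp, (rule that; blast))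
    have tu: "integral_vec (t *s u)" using t(3) by (simp add: integral_vec_def)
    have tb: "integral_vec (t *s b)" "integral_vec (t *s b')"
      using b t(1) by (auto simp: integral_vec_def R.integral_mult)
    have "t *s b - t *s b' = map_matrix \<phi> \<Phi> *v (t *s u)"
      using u by (simp add: vector_scalar_commute flip: vector_ssub_ldistrib)
    then have "T.equiv (\<kappa> (t *s b) - \<kappa> (t *s b')) 0"
      using T.equiv_trans[OF \<kappa>_diff[OF tb]] \<kappa>_image[OF tu] by simp
    then have "T.equiv (\<kappa> (t *s b)) (\<kappa> (t *s b'))" by (simp add: T.equiv_def)
    then have "t \<odot>\<^bsub>?N\<^esub> V = t \<odot>\<^bsub>?N\<^esub> W"
      unfolding b T.tensor_scale[OF t(1)] scale_\<kappa> by (simp add: T.cls_eq_iff)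
    then show ?thesis using t by blast
  qed
  have image: "h ` carrier ?N = ?L"
    unfolding N_carrier column_lattice_def by (auto simp: image_iff h_\<kappa> integral_vec_def) (metis h_\<kappa>)
  obtain d where d: "R.integral d" "d \<noteq> 0"
    "\<And>x. x \<in> range (\<lambda>(r, k). T$r$k) \<Longrightarrow> R.integral (d * x)"
    by (rule R.common_denominator[of "range (\<lambda>(r, k). T$r$k)"]) (simp, (rule that; blast))
  have dT: "R.integral (d * T$r$k)" for r k by (rule d(3)) (auto intro!: image_eqI[of _ _ "(r, k)"])
  have dL: "R.integral (d * w$r)" if w: "w \<in> ?L" for w r
  proof -
    obtain b where b: "w = T *v b" "\<And>k. R.integral (b$k)" using w by (auto simp: column_lattice_def)
    have "d * w$r = (\<Sum>k\<in>UNIV. (d * T$r$k) * b$k)"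
      by (simp add: b(1) matrix_vector_mult_def sum_distrib_left mult.assoc)
    then show ?thesis using dT b(2) by (simp add: R.integral_sum R.integral_mult)
  qed
  \<comment> \<open>By Cramer's rule, \<open>d * \<Delta>\<close> times a unit vector is a
    combination of the two columns whose coefficients are \<open>d\<close> times entries of
    \<open>T\<close>, up to sign. The further factor \<open>d\<close> makes the constant itself
    integral, as a difference of products of two such coefficients.\<close>
  define \<Delta> where "\<Delta> = det2 (column k T) (column l T)"
  have dd: "R.integral (d * (d * T$r$i))" for r i using R.integral_mult[OF d(1) dT] .
  have c: "R.integral (d * d * \<Delta>)"
  proof -
    have "d * d * \<Delta> = (d * T$1$k) * (d * T$2$l) - (d * T$2$k) * (d * T$1$l)"
      by (simp add: \<Delta>_def det2_def column_def algebra_simps)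
    then show ?thesis using dT by (simp add: R.integral_diff R.integral_mult)
  qed
  have c0: "d * d * \<Delta> \<noteq> 0" using d nondeg by (simp add: \<Delta>_def)
  have comb: "x *s column k T + y *s column l T \<in> ?L" if "R.integral x" "R.integral y" for x y
    using that R.is_latticeD[OF L] R.column_in_lattice by blast
  have e1: "vector [d * d * \<Delta>, 0] \<in> ?L"
  proof -
    have "vector [d * d * \<Delta>, 0] = (d * (d * T$2$l)) *s column k T + (- (d * (d * T$2$k))) *s column l T"
      by (simp add: vec2_eq_iff \<Delta>_def det2_def column_def algebra_simps)
    then show ?thesis using comb[OF dd R.integral_uminus[OF dd]] by simp
  qed
  have e2: "vector [0, d * d * \<Delta>] \<in> ?L"
  proof -
    have "vector [0, d * d * \<Delta>] = (- (d * (d * T$1$l))) *s column k T + (d * (d * T$1$k)) *s column l T"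
      by (simp add: vec2_eq_iff \<Delta>_def det2_def column_def algebra_simps)
    then show ?thesis using comb[OF R.integral_uminus[OF dd] dd] by simp
  qed
  obtain f where f: "f \<in> linear_maps R.B (vec_module ?L) U" "bij_betw f ?L (carrier U)"
    using iso by (auto simp: module_iso_def)
  have depth: "\<exists>rs. local_regular_sequence R.B (vec_module ?L) p rs \<and> length rs \<ge> 2"
    if p: "primeideal p R.B" "height R.B p \<ge> 2" for p
    using R.maximal_CM_regular_pair[OF U(2) p] R.regular_sequence_iso[OF L U(1) _ f] p(1) R.primeideal_iff by blast
  have refl: "v \<in> ?L" if "\<And>a. (\<And>w. w \<in> ?L \<Longrightarrow> R.integral (dot2 a w)) \<Longrightarrow> R.integral (dot2 a v)" for v
    by (rule R.lattice_reflexive[OF depth nondeg that])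
  note closed = R.dual_closed[of "dual R.B ?N", OF R.dual_closed[of ?N, OF T.tensor_closed]]
  have "module_iso R.B (dual R.B (dual R.B ?N)) (vec_module ?L)"
    by (rule R.double_dual_iso[where \<phi> = h and c = "d * d * \<Delta>" and d = d])
      (fact T.tensor_closed h_add h_smult image torsion c0 c e1 e2 d(1,2) dL refl)+
  then show ?thesis
    using iso closed by (rule module_iso_trans) (simp_all only: R.B_simps)
qed

end

lemma vector_4 [simp]:
  "(vector [x, y, z, w] :: 'a::zero^4)$1 = x" "(vector [x, y, z, w] :: 'a::zero^4)$2 = y"
  "(vector [x, y, z, w] :: 'a::zero^4)$3 = z" "(vector [x, y, z, w] :: 'a::zero^4)$4 = w"
  unfolding vector_def by simp_all

lemma koszul_product:
  fixes P Q :: "'c::comm_ring_1^3"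
  shows "koszul_Phi P Q ** koszul_Psi P Q = mat (P$1 * Q$1 + P$2 * Q$2 + P$3 * Q$3)"
    and "koszul_Psi P Q ** koszul_Phi P Q = mat (P$1 * Q$1 + P$2 * Q$2 + P$3 * Q$3)"
  by (simp_all add: koszul_Phi_def koszul_Psi_def vec_eq_iff forall_4 matrix_matrix_mult_def sum_4 mat_def algebra_simps)

text \<open>Solving the Koszul relations for the second and third column by \<open>Q\<^sub>1\<close> shows that the
  first and last column span.\<close>

lemma koszul_kernel:
  fixes T :: "'k::field^4^2"
  assumes T0: "T ** koszul_Phi P Q = 0" and Q1: "Q$1 \<noteq> 0"
    and nondeg: "\<And>a. (\<And>k. dot2 a (column k T) = 0) \<Longrightarrow> a = 0"
  shows "det2 (column 1 T) (column 4 T) \<noteq> 0"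
    and "T *v w = 0 \<Longrightarrow> \<exists>u. w = koszul_Phi P Q *v u"
proof -
  have rel: "Q$1 * T$r$2 = Q$2 * T$r$1 - P$3 * T$r$4" "Q$1 * T$r$3 = Q$3 * T$r$1 + P$2 * T$r$4" for r
  proof -
    have "(T ** koszul_Phi P Q)$r$2 = 0" "(T ** koszul_Phi P Q)$r$3 = 0" using T0 by simp_all
    then have "- (T$r$1 * Q$2) + T$r$2 * Q$1 + T$r$4 * P$3 = 0" "- (T$r$1 * Q$3) + T$r$3 * Q$1 - T$r$4 * P$2 = 0"
      by (simp_all add: matrix_matrix_mult_def sum_4 koszul_Phi_def)
    then show "Q$1 * T$r$2 = Q$2 * T$r$1 - P$3 * T$r$4" "Q$1 * T$r$3 = Q$3 * T$r$1 + P$2 * T$r$4"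
      by (simp_all add: algebra_simps)
  qed
  show det: "det2 (column 1 T) (column 4 T) \<noteq> 0"
  proof
    assume 0: "det2 (column 1 T) (column 4 T) = 0"
    have spread: "a = 0" if a: "dot2 a (column 1 T) = 0" "dot2 a (column 4 T) = 0" for a
    proof (rule nondeg)
      fix k
      have col: "Q$1 * dot2 a (column l T) = a$1 * (Q$1 * T$1$l) + a$2 * (Q$1 * T$2$l)" for l
        by (simp add: dot2_def column_def distrib_left mult.left_commute)
      have "Q$1 * dot2 a (column 2 T) = Q$2 * dot2 a (column 1 T) - P$3 * dot2 a (column 4 T)"
        "Q$1 * dot2 a (column 3 T) = Q$3 * dot2 a (column 1 T) + P$2 * dot2 a (column 4 T)"
        unfolding col rel by (simp_all add: dot2_def column_def algebra_simps)
      then show "dot2 a (column k T) = 0" using a Q1 exhaust_4[of k] by auto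
    qed
    \<comment> \<open>If the minor vanishes, these vectors annihilate columns \<open>1\<close> and
      \<open>4\<close> and hence are zero. Then both columns vanish, and even \<open>(1, 0)\<close>
      annihilates them.\<close>
    have "(vector [- (T$2$1), T$1$1] :: 'k^2) = 0" "(vector [- (T$2$4), T$1$4] :: 'k^2) = 0"
      using 0 by (auto intro!: spread simp: dot2_def det2_def column_def algebra_simps)
    then have "T$r$1 = 0" "T$r$4 = 0" for r
      using exhaust_2[of r] by (auto simp: vec2_eq_iff)
    then have "(vector [1, 0] :: 'k^2) = 0" by (intro spread) (auto simp: dot2_def column_def)
    then show False by (simp add: vec2_eq_iff)
  qed
  assume "T *v w = 0"
  then have w: "T$r$1 * w$1 + T$r$2 * w$2 + T$r$3 * w$3 + T$r$4 * w$4 = 0" for r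
    by (simp add: vec_eq_iff matrix_vector_mult_def sum_4)
  \<comment> \<open>After elimination of columns \<open>2\<close> and \<open>3\<close>,
    \<open>Q$1\<close> times \<open>T *v w\<close> is \<open>x\<close> times column \<open>1\<close>
    plus \<open>y\<close> times column \<open>4\<close>.\<close>
  define x y where "x = Q$1 * w$1 + Q$2 * w$2 + Q$3 * w$3" and "y = Q$1 * w$4 - P$3 * w$2 + P$2 * w$3"
  have xy: "T$r$1 * x + T$r$4 * y = 0" for r
  proof -
    have "0 = Q$1 * (T$r$1 * w$1 + T$r$2 * w$2 + T$r$3 * w$3 + T$r$4 * w$4)" by (simp add: w)
    also have "\<dots> = Q$1 * T$r$1 * w$1 + (Q$1 * T$r$2) * w$2 + (Q$1 * T$r$3) * w$3 + Q$1 * T$r$4 * w$4"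
      by (simp add: distrib_left mult.assoc)
    also have "\<dots> = T$r$1 * x + T$r$4 * y"
      unfolding rel x_def y_def by (simp add: algebra_simps)
    finally show ?thesis by simp
  qed
  have "x * det2 (column 1 T) (column 4 T) = T$2$4 * (T$1$1 * x + T$1$4 * y) - T$1$4 * (T$2$1 * x + T$2$4 * y)"
    "y * det2 (column 1 T) (column 4 T) = T$1$1 * (T$2$1 * x + T$2$4 * y) - T$2$1 * (T$1$1 * x + T$1$4 * y)"
    by (simp_all add: det2_def column_def algebra_simps)
  then have "x * det2 (column 1 T) (column 4 T) = 0" "y * det2 (column 1 T) (column 4 T) = 0"
    by (simp_all only: xy mult_zero_right diff_self)
  then have "x = 0" "y = 0" using det by simp_all
  then have "w$1 * Q$1 = - (Q$2 * w$2 + Q$3 * w$3)" "w$4 * Q$1 = P$3 * w$2 - P$2 * w$3"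
    by (simp_all add: x_def y_def eq_neg_iff_add_eq_0 algebra_simps)
  then have w14: "w$1 = - (Q$2 * w$2 + Q$3 * w$3) / Q$1" "w$4 = (P$3 * w$2 - P$2 * w$3) / Q$1"
    using Q1 by (simp_all only: eq_divide_eq) simp_all
  show "\<exists>u. w = koszul_Phi P Q *v u"
    \<comment> \<open>The block of the Koszul matrix in rows and columns \<open>2\<close> and
      \<open>3\<close> is \<open>Q$1\<close> times the identity, which gives the witness; rows
      \<open>1\<close> and \<open>4\<close> then say that \<open>x\<close> and \<open>y\<close> are
      zero.\<close>
    by (intro exI[of _ "vector [0, w$2 / Q$1, w$3 / Q$1, 0]"])
      (use Q1 w14 in \<open>simp add: vec_eq_iff forall_4 matrix_vector_mult_def sum_4 koszul_Phi_def field_simps\<close>)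
qed

text \<open>The pairings of \<open>a\<close> with the columns are the entries of the combination of
  the two rows with coefficients \<open>a$1\<close> and \<open>a$2\<close>; a nontrivial relation
  would leave at most a line as row space.\<close>

lemma rank_2_nondegenerate:
  fixes T :: "'k::field^'n^2"
  assumes "rank T = 2" "\<And>k. dot2 a (column k T) = 0"
  shows "a = 0"
proof (rule ccontr)
  assume "a \<noteq> 0"
  have dep: "a$1 *s T$1 = - (a$2 *s T$2)"
    using assms(2) by (simp add: vec_eq_iff dot2_def column_def eq_neg_iff_add_eq_0)
  have rows: "rows T = {T$1, T$2}"
    by (auto simp: rows_def row_def vec_lambda_eta) (metis exhaust_2)
  have "\<exists>v. rows T \<subseteq> vec.span {v}"
  proof (cases "a$1 = 0")
    case True
    then have "a$2 \<noteq> 0" using \<open>a \<noteq> 0\<close> by (simp add: vec2_eq_iff)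
    then have "T$2 = 0" using dep True by (simp add: vec_eq_iff)
    then show ?thesis unfolding rows by (intro exI[of _ "T$1"]) (auto simp: vec.span_base vec.span_zero)
  next
    case False
    have "T$1 = inverse (a$1) *s (a$1 *s T$1)" using False by (simp add: vec_eq_iff)
    also have "\<dots> \<in> vec.span {T$2}"
      unfolding dep by (intro vec.span_scale vec.span_neg vec.span_base) simp
    finally show ?thesis unfolding rows by (intro exI[of _ "T$2"]) (auto simp: vec.span_base)
  qed
  then obtain v where "rows T \<subseteq> vec.span {v}" by blast
  then have "rank T \<le> 1" unfolding row_rank_def_gen using vec.dim_le_card[of "rows T" "{v}"] by simp
  then show False using assms(1) by simp
qed

lemma dot2_mult_column: "dot2 a (column k (C ** T)) = dot2 (vector [dot2 a (column 1 C), dot2 a (column 2 C)]) (column k T)"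
  by (simp add: dot2_def column_def matrix_matrix_mult_def sum_2 algebra_simps)

lemma invertible_nondegenerate:
  fixes C :: "'k::field^2^2"
  assumes C: "invertible C" and a: "\<And>k. dot2 a (column k C) = 0"
  shows "a = 0"
proof -
  obtain C' where "C ** C' = mat 1" using C by (auto simp: invertible_def)
  moreover have "dot2 a (column k (C ** C')) = 0" for k
    unfolding dot2_mult_column a by (simp add: dot2_def)
  ultimately have "dot2 a (column k (mat 1)) = 0" for k by simp
  from this[of 1] this[of 2] show ?thesis by (simp add: dot2_def column_def mat_def vec2_eq_iff)
qed

section \<open>The dihedral hypersurface\<close>

text \<open>Both coefficients of the recursion are at least one, so the next value is at least the
  last one plus the difference of the two before it, and that difference is nonnegative by
  induction.\<close>

lemma s_aux_mono:
  assumes "\<And>i. i \<in> {2..e - 1} \<Longrightarrow> a i \<ge> 2" "k + 3 \<le> e"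
  shows "0 \<le> s_aux e a k \<and> s_aux e a k \<le> s_aux e a (Suc k)"
  using assms(2)
proof (induction k rule: less_induct)
  case (less k)
  consider "k = 0" | "k = 1" | k' where "k = Suc (Suc k')" by (metis One_nat_def not0_implies_Suc)
  then show ?case
  proof cases
    case 2
    have "a (e - 1) \<ge> 2" using less.prems by (intro assms(1)) auto
    then show ?thesis using 2 by (simp add: numeral_2_eq_2)
  next
    case 3
    let ?s = "s_aux e a"
    have s: "0 \<le> ?s k'" "?s k' \<le> ?s (k' + 1)" "?s (k' + 1) \<le> ?s (k' + 2)"
      using less.IH[of k'] less.IH[of "k' + 1"] less.prems 3 by auto
    have "a (e - (k' + 2)) \<ge> 2" "a (e - (k' + 1)) \<ge> 2" using less.prems 3 by (auto intro!: assms(1))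
    then have "1 * ?s (k' + 2) \<le> (int (a (e - (k' + 2))) - 1) * ?s (k' + 2)"
      "1 * ?s (k' + 1) \<le> (int (a (e - (k' + 1))) - 1) * ?s (k' + 1)"
      using s by (intro mult_right_mono; linarith)+
    then have "?s (k' + 2) \<le> ?s (Suc (Suc (Suc k')))" using s by simp
    then show ?thesis using s 3 by simp
  qed simp
qed

lemma s_exp_pos:
  assumes data: "dihedral_data n q e a" and j: "j \<in> {3..e - 1}"
  shows "s_exp e a j \<ge> 1"
proof -
  have a: "\<And>i. i \<in> {2..e - 1} \<Longrightarrow> a i \<ge> 2" using data by (auto simp: dihedral_data_def)
  have "1 \<le> s_aux e a (Suc k)" if "k + 4 \<le> e" for k
    using that
  proof (induction k)
    case (Suc k)
    then show ?case using s_aux_mono[of e a "Suc k"] a by fastforce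
  qed simp
  from this[of "e - j - 1"] j show ?thesis by (auto simp: s_exp_def Suc_diff_Suc)
qed

lemma alpha_exp_pos:
  assumes data: "dihedral_data n q e a"
  shows "alpha_exp e a \<ge> 1"
proof -
  have "(int (a j) - 2) * s_exp e a j \<ge> 0" if j: "j \<in> {3..e - 1}" for j
  proof -
    have "a j \<ge> 2" using data j by (auto simp: dihedral_data_def)
    then show ?thesis using s_exp_pos[OF data j] by simp
  qed
  then have "0 \<le> (\<Sum>j = 3..e - 1. (int (a j) - 2) * s_exp e a j)" by (rule sum_nonneg)
  then show ?thesis by (simp add: alpha_exp_def)
qed

lemma poly3_monomial: "X3 ^ i * Y3 ^ j * Z3 ^ k = monom ([:[:0, 1:]:] ^ i * [:0, 1:] ^ k) j"
proof -
  have "X3 ^ i = [:[:[:0, 1:]:] ^ i:]" "Z3 ^ k = [:[:0, 1:] ^ k:]"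
    by (simp_all add: X3_def Z3_def flip: poly_const_pow)
  moreover have "Y3 ^ j = monom 1 j" by (simp add: Y3_def monom_altdef)
  ultimately show ?thesis by (simp add: smult_monom mult.commute)
qed

text \<open>Positivity of \<open>s_exp e a 3\<close> makes the exponent of the pure power of
  \<open>y\<close> larger than that of the middle term.\<close>

lemma dihedral_poly_monic:
  assumes data: "dihedral_data n q e a"
  shows "lead_coeff (dihedral_poly e a) = 1" "degree (dihedral_poly e a) > 0"
proof -
  define N where "N = nat (2 * alpha_exp e a + 2 * s_exp e a 3)"
  define M where "M = nat (2 * alpha_exp e a)"
  have "s_exp e a 3 \<ge> 1" using data by (intro s_exp_pos[OF data]) (auto simp: dihedral_data_def)
  then have NM: "M < N" "0 < N" using alpha_exp_pos[OF data] by (auto simp: N_def M_def)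
  obtain c d where F: "dihedral_poly e a = monom 1 N + monom c M - monom d 0"
    using poly3_monomial[of 0 N 0] poly3_monomial[of "a 2 - 1" M "nat (2 * s_hat e a 3)"]
      poly3_monomial[of 1 0 "nat (2 * beta_exp e a + 2 * s_hat e a 3)"]
    by (auto simp: dihedral_poly_def N_def M_def)
  have coeff: "coeff (dihedral_poly e a) i = (if i = N then 1 else 0) + (if i = M then c else 0) - (if i = 0 then d else 0)" for i
    by (auto simp: F)
  have deg: "degree (dihedral_poly e a) = N"
    by (intro antisym degree_le le_degree) (use NM in \<open>auto simp: coeff\<close>)
  then show "lead_coeff (dihedral_poly e a) = 1" "degree (dihedral_poly e a) > 0"
    using NM by (auto simp: coeff)
qed

lemma (in hypersurface) eval_constants_neq_0:
  "\<phi> X3 \<noteq> 0" "\<phi> Z3 \<noteq> 0" "c \<noteq> 0 \<Longrightarrow> \<phi> (const3 c) \<noteq> 0"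
  using R.hom_eq_0D[of "[:[:0, 1:]:]"] R.hom_eq_0D[of "[:0, 1:]"] R.hom_eq_0D[of "[:[:c:]:]"]
  by (auto simp: X3_def Z3_def const3_def)

lemma (in hypersurface) eval_monomial_neq_0:
  assumes y: "\<phi> Y3 \<noteq> 0" and p: "is_monomial p"
  shows "\<phi> p \<noteq> 0"
  using p y eval_constants_neq_0 by (auto simp: is_monomial_def S.hom_mult S.hom_power)

text \<open>Setting \<open>y\<close> to zero leaves, up to sign, \<open>x\<close> times a power of
  \<open>z\<close>, while \<complex>[x, z] embeds into the field. With this, all monomials are
  nonzero in \<open>K\<close>.\<close>

lemma (in hypersurface) eval_Y3_neq_0:
  assumes data: "dihedral_data n q e a" and F: "F = dihedral_poly e a"
  shows "\<phi> Y3 \<noteq> 0"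
proof
  assume y: "\<phi> Y3 = 0"
  have "s_exp e a 3 \<ge> 1" using data by (intro s_exp_pos[OF data]) (auto simp: dihedral_data_def)
  then have "nat (2 * alpha_exp e a + 2 * s_exp e a 3) \<noteq> 0" "nat (2 * alpha_exp e a) \<noteq> 0"
    using alpha_exp_pos[OF data] by auto
  moreover have "\<phi> (dihedral_poly e a) = 0" by (simp add: eval_eq_0_iff flip: F)
  ultimately have "\<phi> X3 * \<phi> Z3 ^ nat (2 * beta_exp e a + 2 * s_hat e a 3) = 0"
    using y unfolding dihedral_poly_def by (simp add: power_0_left S.hom_add S.hom_diff S.hom_mult S.hom_power)
  then show False using eval_constants_neq_0(1,2) by simp
qed

section \<open>From the Koszul matrices to \<Phi> and \<Psi>\<close>

lemma map_matrix_simp: "map_matrix f m $ i $ j = f (m $ i $ j)"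
  by (simp add: map_matrix_def)

lemma diagonal_mult:
  fixes D :: "'c::comm_semiring_1^'n^'n"
  assumes "\<And>i j. i \<noteq> j \<Longrightarrow> D$i$j = 0"
  shows "(M ** D)$i$j = M$i$j * D$j$j" "(D ** M)$i$j = D$i$i * M$i$j"
proof -
  have "(\<Sum>k\<in>UNIV. M$i$k * D$k$j) = (\<Sum>k\<in>UNIV. if k = j then M$i$j * D$j$j else 0)"
    using assms by (intro sum.cong) auto
  then show "(M ** D)$i$j = M$i$j * D$j$j" by (simp add: matrix_matrix_mult_def)
  have "(\<Sum>k\<in>UNIV. D$i$k * M$k$j) = (\<Sum>k\<in>UNIV. if k = i then D$i$i * M$i$j else 0)"
    using assms by (intro sum.cong) auto
  then show "(D ** M)$i$j = D$i$i * M$i$j" by (simp add: matrix_matrix_mult_def)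
qed

text \<open>\<open>matrix_inv\<close> is a chosen two-sided inverse, so it suffices to exhibit
  one.\<close>

lemma diagonal_invertible:
  fixes D :: "'c::field^'n^'n"
  assumes "\<And>i j. i \<noteq> j \<Longrightarrow> D$i$j = 0" "\<And>i. D$i$i \<noteq> 0"
  shows "matrix_inv D ** D = mat 1"
proof -
  define D' :: "'c^'n^'n" where "D' = (\<chi> i j. if i = j then inverse (D$i$i) else 0)"
  have "D ** D' = mat 1 \<and> D' ** D = mat 1"
    using assms by (auto simp: vec_eq_iff diagonal_mult D'_def mat_def)
  then have "D ** matrix_inv D = mat 1 \<and> matrix_inv D ** D = mat 1"
    unfolding matrix_inv_def by (rule someI)
  then show ?thesis by simp
qed

theorem theorem6p10:
  fixes n q e :: nat and a :: "nat \<Rightarrow> nat"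
    and F :: poly3 and A :: "poly3 set ring"
    and \<iota> :: "poly3 set \<Rightarrow> 'k::field" and B :: "'k ring"
    and U :: "('k, 'u) module"
    and P Q :: "poly3^3" and m :: poly3
    and D \<Phi> \<Psi> :: "poly3^4^4" and E :: "(poly3 set, (poly3^4) set) module"
    and i j :: 4 and T :: "'k^4^2" and C :: "'k^2^2"
  assumes data: "dihedral_data n q e a"
    and F: "F = dihedral_poly e a"
    and A: "A = hypersurface_ring F"
    and K: "is_fraction_field A \<iota>"
    and B: "B = normalization A \<iota>"
    and U_module: "Module.module B U"
    and U_indecomposable: "indecomposable B U"
    and U_rank: "has_rank B U 2"
    and U_special: "special_CM B U"
    and monomials: "\<forall>l. is_monomial (P$l)" "\<forall>l. is_monomial (Q$l)" "is_monomial m"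
    and PQ: "P$1 * Q$1 + P$2 * Q$2 + P$3 * Q$3 = m * F"
    and U_lattice: "module_iso B U
       (vec_module (column_lattice B (map_matrix (eval_K F \<iota>) (lattice_matrix P Q))))"
    and D: "diagonal_monomial_matrix D"
    and \<Phi>: "map_matrix to_fract \<Phi> =
       map_matrix to_fract (koszul_Phi P Q) ** matrix_inv (map_matrix to_fract D)"
    and \<Psi>: "map_matrix to_fract \<Psi> =
       map_matrix to_fract D ** map_matrix (\<lambda>s. to_fract s / to_fract m) (koszul_Psi P Q)"
    and E: "E = coker \<Phi>"
    and E_rank: "has_rank A E 2"
    and T: "i \<noteq> j" "T = two_rows (map_matrix (eval_K F \<iota>) \<Psi>) i j"
    and T_rank: "rank T = 2"
    and C: "invertible C"
    and T_lattice: "module_iso B (vec_module ((\<lambda>v. C *v v) ` column_lattice B T)) U"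
  shows "module_iso B (dual B (dual B (tensor_algebra A E B \<iota>))) U"
proof -
  interpret H: hypersurface F \<iota>
    using K dihedral_poly_monic[OF data] by unfold_locales (auto simp: A F)
  let ?\<phi> = "eval_K F \<iota>"
  have y: "?\<phi> Y3 \<noteq> 0" by (rule H.eval_Y3_neq_0[OF data F])
  note nz = H.eval_monomial_neq_0[OF y]
  have B_eq: "B = H.R.B" by (simp add: B A H.normalization_eq)
  have D_off: "D$k$l = 0" if "k \<noteq> l" for k l using D that by (simp add: diagonal_monomial_matrix_def)
  have D_diag: "?\<phi> (D$k$k) \<noteq> 0" for k using D nz by (simp add: diagonal_monomial_matrix_def)
  then have D_nz: "D$k$k \<noteq> 0" for k by (metis H.S.hom_0)
  have m: "?\<phi> m \<noteq> 0" "m \<noteq> 0" using nz[OF monomials(3)] by (auto simp: H.S.hom_0)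
  \<comment> \<open>The hypotheses on \<Phi> and \<Psi> live over the field of fractions of the
    polynomial ring. Cleared of the denominators \<open>D\<close> and \<open>m\<close>, they become
    identities of polynomials that can be evaluated in \<open>K\<close>.\<close>
  have Phi_D: "\<Phi>$k$l * D$l$l = koszul_Phi P Q $k$l" for k l
  proof -
    have "map_matrix to_fract \<Phi> ** map_matrix to_fract D = map_matrix to_fract (koszul_Phi P Q)"
      unfolding \<Phi> using D_off D_nz
      by (simp add: map_matrix_simp diagonal_invertible flip: matrix_mul_assoc)
    from arg_cong[OF this, of "\<lambda>M. M$k$l"] have "to_fract (\<Phi>$k$l * D$l$l) = to_fract (koszul_Phi P Q $k$l)"
      using D_off by (simp add: diagonal_mult map_matrix_simp)
    then show ?thesis by (simp only: to_fract_eq_iff)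
  qed
  have Psi_m: "m * \<Psi>$k$l = D$k$k * koszul_Psi P Q $k$l" for k l
  proof -
    from arg_cong[OF \<Psi>, of "\<lambda>M. M$k$l"]
    have "to_fract (\<Psi>$k$l) = to_fract (D$k$k) * (to_fract (koszul_Psi P Q $k$l) / to_fract m)"
      using D_off by (simp add: diagonal_mult map_matrix_simp)
    then have "to_fract (m * \<Psi>$k$l) = to_fract (D$k$k * koszul_Psi P Q $k$l)"
      using m(2) by (simp add: field_simps)
    then show ?thesis by (simp only: to_fract_eq_iff)
  qed
  \<comment> \<open>The factor \<open>D\<close> cancels between \<Phi> and \<Psi>, the Koszul
    product is \<open>m * F\<close>, and \<open>m\<close> cancels in the domain of
    polynomials.\<close>
  have "\<Phi> ** \<Psi> = mat F"
  proof -
    have "m * (\<Phi> ** \<Psi>)$k$l = m * (mat F)$k$l" for k l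
    proof -
      have "m * (\<Phi> ** \<Psi>)$k$l = (\<Sum>r\<in>UNIV. \<Phi>$k$r * (m * \<Psi>$r$l))"
        by (simp add: matrix_matrix_mult_def sum_distrib_left mult.left_commute)
      also have "\<dots> = (\<Sum>r\<in>UNIV. koszul_Phi P Q $k$r * koszul_Psi P Q $r$l)"
        by (simp add: Psi_m mult.assoc flip: Phi_D)
      also have "\<dots> = (koszul_Phi P Q ** koszul_Psi P Q)$k$l" by (simp add: matrix_matrix_mult_def)
      finally show ?thesis by (simp add: koszul_product PQ mat_def)
    qed
    then show ?thesis using m(2) by (simp add: vec_eq_iff)
  qed
  then interpret H: matrix_factor F \<iota> \<Phi> \<Psi> by unfold_locales
  define P' Q' where "P' = (\<chi> l. ?\<phi> (P$l))" and "Q' = (\<chi> l. ?\<phi> (Q$l))"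
  have koszul_eval: "map_matrix ?\<phi> (koszul_Phi P Q) = koszul_Phi P' Q'"
    by (simp add: vec_eq_iff forall_4 map_matrix_simp koszul_Phi_def P'_def Q'_def H.S.hom_0)
  then have koszul_entry: "koszul_Phi P' Q' $k$l = ?\<phi> (koszul_Phi P Q $k$l)" for k l
    by (metis map_matrix_simp)
  have Phi_D': "koszul_Phi P' Q' $k$l = ?\<phi> (\<Phi>$k$l) * ?\<phi> (D$l$l)" for k l
    by (simp only: koszul_entry flip: Phi_D H.S.hom_mult)
  \<comment> \<open>Up to \<open>m\<close> and \<open>D\<close> this is the Koszul product
    \<open>m * F\<close>, and \<open>F\<close> vanishes in \<open>K\<close>.\<close>
  have Psi0: "(\<Sum>r\<in>UNIV. ?\<phi> (\<Psi>$k$r) * koszul_Phi P' Q' $r$l) = 0" for k l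
  proof -
    have "?\<phi> m * (\<Sum>r\<in>UNIV. ?\<phi> (\<Psi>$k$r) * koszul_Phi P' Q' $r$l)
        = ?\<phi> (\<Sum>r\<in>UNIV. (m * \<Psi>$k$r) * koszul_Phi P Q $r$l)"
      by (simp only: H.S.hom_sum H.S.hom_mult koszul_entry sum_distrib_left mult.assoc)
    also have "(\<Sum>r\<in>UNIV. (m * \<Psi>$k$r) * koszul_Phi P Q $r$l) = D$k$k * (koszul_Psi P Q ** koszul_Phi P Q)$k$l"
      by (simp add: Psi_m matrix_matrix_mult_def sum_distrib_left mult.assoc)
    also have "?\<phi> \<dots> = 0" by (simp add: H.eval_eq_0_iff koszul_product PQ mat_def)
    finally show ?thesis using m(1) by simp
  qed
  \<comment> \<open>The lattice known to be isomorphic to \<open>U\<close> is the column lattice of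
    this matrix, so it takes the place of \<open>T\<close> from here on.\<close>
  let ?T = "C ** T"
  have T_koszul: "T ** koszul_Phi P' Q' = 0"
    using Psi0 by (simp add: vec_eq_iff forall_2 T(2) two_rows_def matrix_matrix_mult_def map_matrix_simp)
  have T0: "?T ** koszul_Phi P' Q' = 0"
    by (simp add: T_koszul flip: matrix_mul_assoc)
  have nondeg: "b = 0" if b: "\<And>k. dot2 b (column k ?T) = 0" for b
  proof (rule invertible_nondegenerate[OF C])
    have "vector [dot2 b (column 1 C), dot2 b (column 2 C)] = (0 :: 'k^2)"
      by (rule rank_2_nondegenerate[OF T_rank]) (use b in \<open>simp only: dot2_mult_column\<close>)
    then show "dot2 b (column k C) = 0" for k using exhaust_2[of k] by (auto simp: vec2_eq_iff)
  qed
  \<comment> \<open>A monomial, hence nonzero in \<open>K\<close> and a possible pivot for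
    \<open>koszul_kernel\<close>.\<close>
  have Q1: "Q'$1 \<noteq> 0" using nz monomials(2) by (simp add: Q'_def)
  have det: "det2 (column 1 ?T) (column 4 ?T) \<noteq> 0" by (rule koszul_kernel(1)[OF T0 Q1 nondeg])
  have T0': "?T ** map_matrix ?\<phi> \<Phi> = 0"
  proof -
    have "(?T ** map_matrix ?\<phi> \<Phi>)$r$l * ?\<phi> (D$l$l) = (?T ** koszul_Phi P' Q')$r$l" for r l
      by (simp add: matrix_matrix_mult_def[of "C ** T"] map_matrix_simp Phi_D' sum_distrib_right mult.assoc)
    then show ?thesis using D_diag by (simp add: T0 vec_eq_iff)
  qed
  have ker: "\<exists>u. w = map_matrix ?\<phi> \<Phi> *v u" if "?T *v w = 0" for w
  proof -
    have "\<exists>u. w = koszul_Phi P' Q' *v u" by (rule koszul_kernel(2)[OF T0 Q1 nondeg that])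
    then obtain u where "w = koszul_Phi P' Q' *v u" by blast
    \<comment> \<open>The Koszul matrix is \<Phi> times \<open>D\<close>, so the diagonal of
      \<open>D\<close> moves into the argument.\<close>
    then have "w = map_matrix ?\<phi> \<Phi> *v (\<chi> l. ?\<phi> (D$l$l) * u$l)"
      by (simp add: vec_eq_iff matrix_vector_mult_def map_matrix_simp Phi_D' mult.assoc)
    then show ?thesis by blast
  qed
  have "(\<lambda>v. C *v v) ` column_lattice B T = column_lattice B ?T"
    by (simp add: column_lattice_def setcompr_eq_image image_image matrix_vector_mul_assoc)
  then have iso: "module_iso H.R.B (vec_module (column_lattice H.R.B ?T)) U" using T_lattice by (simp add: B_eq)
  have U': "Module.module H.R.B U" "maximal_CM H.R.B U"
    using U_module U_special by (simp_all add: B_eq special_CM_def)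
  have "module_iso H.R.B (dual H.R.B (dual H.R.B
      (tensor_algebra (hypersurface_ring F) (coker \<Phi>) H.R.B \<iota>))) U"
    by (rule H.coker_double_dual[OF T0' ker det U' iso])
  then show ?thesis by (simp add: A E B_eq)
qed

end
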